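(* Suppose that either (a) $n\in\mathbb N$ is arbitrary and $\alpha_1=\cdots=\alpha_n=\alpha>0$; or (b) $n=2$ and $\alpha_1,\alpha_2$ are distinct and strictly positive. Then for all $x_1,\dots,x_n\in\mathbb R$ there exists a unique Nash equilibrium $(X_1^*,\dots,X_n^* )$ for mean-variance optimization with infinite time horizon, and it is also a Nash equilibrium for CARA utility maximization with infinite time horizon. In case (a), $X_i^*(t)=(x_i-\overline x_n)e^{\theta_-t}+\overline x_ne^{\rho_-t}$, where $\overline x_n=\frac1n\sum_{j=1}^nx_j$, $\theta_-=\frac{\gamma}{2\lambda}-\frac{\sqrt{\gamma^2+4\alpha\sigma^2\lambda}}{2\lambda}$ and $\rho_-=-\frac{(n-1)\gamma}{2(n+1)\lambda}-\frac{\sqrt{(n-1)^2\gamma^2+4(n+1)\alpha\sigma^2\lambda}}{2(n+1)\lambda}$. In case (b), the equation $$\tau^4-\frac{2\gamma}{3\lambda}\tau^3-\frac{\gamma^2+2\lambda\sigma^2(\alpha_1+\alpha_2)}{3\lambda^2}\tau^2+\frac{\sigma^4\alpha_1\alpha_2}{3\lambda^2}=0$$ has precisely two distinct roots $\tau_1,\tau_2$ in $(-\infty,0)$, and $X_1^*$ and $X_2^*$ are linear combinations of $e^{\tau_1t}$ and $e^{\tau_2t}$.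
   Context: Let $(\Omega,\mathcal F,(\mathcal F_t)_{t\ge0},\mathbb P)$ carry a standard $(\mathcal F_t)$-Brownian motion $W$; constants $S_0\in\mathbb R$, $\sigma\neq0$, $\gamma\ge0$, $\lambda>0$. The unaffected price is $S^0(t)=S_0+\sigma W(t)$, $t\ge0$. For $x\in\mathbb R$, $\mathscr X(x,\infty)$ is the set of processes $(X(t))_{t\ge0}$ that are adapted, have $X(0)=x$, are absolutely continuous with $X(t)=X(0)+\int_0^t\dot X(s)ds$ for a progressively measurable $\dot X$ with $\int_0^\infty\dot X(t)^2dt<\infty$ a.s., are bounded, and satisfy $\mathbb E[\int_0^\infty X(t)^2dt]<\infty$ and $\lim_{t\uparrow\infty}X(t)^2t\log\log t=0$ a.s. $\mathscr X_{\det}(x,\infty)$ denotes its deterministic elements. When $n$ agents use $X_i\in\mathscr X(x_i,\infty)$, the price is $S^{X_1,\dots,X_n}(t)=S^0(t)+\gamma\sum_{j=1}^n(X_j(t)-X_j(0))+\lambda\sum_{j=1}^n\dot X_j(t)$ and agent $i$'s revenues are the a.s. limit $\mathscr R(X_i|\mathbf X_{-i})=-\lim_{T\uparrow\infty}\int_0^T\dot X_i(t)S^{X_1,\dots,X_n}(t)dt$, $\mathbf X_{-i}=\{X_j:j\ne i\}$. A Nash equilibrium for mean-variance optimization with infinite horizon (initial positions $x_i$, risk aversions $\alpha_i$) is a collection $X_i^*\in\mathscr X_{\det}(x_i,\infty)$ such that each $X_i^*$ maximizes $X\mapsto\mathbb E[\mathscr R(X|\mathbf X^*_{-i})]-\frac{\alpha_i}2\mathrm{var}(\mathscr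 R(X|\mathbf X^*_{-i}))$ over $\mathscr X_{\det}(x_i,\infty)$ (agent $i$ uses $X$, agents $j\ne i$ use $X_j^*$). With $u_\alpha(x)=\frac1\alpha(1-e^{-\alpha x})$ for $\alpha>0$, a Nash equilibrium for CARA utility maximization with infinite horizon is a collection $X_i^*\in\mathscr X(x_i,\infty)$ such that each $X_i^*$ maximizes $X\mapsto\mathbb E[u_{\alpha_i}(\mathscr R(X|\mathbf X^*_{-i}))]$ over $\mathscr X(x_i,\infty)$. *)

theory Defs
  imports "HOL-Probability.Probability"
begin

definition filtration_on :: "'a measure \<Rightarrow> (real \<Rightarrow> 'a measure) \<Rightarrow> bool" where
  "filtration_on M F \<longleftrightarrow>
     (\<forall>t\<ge>0. space (F t) = space M \<and> sets (F t) \<subseteq> sets M) \<and>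
     (\<forall>s t. 0 \<le> s \<longrightarrow> s \<le> t \<longrightarrow> sets (F s) \<subseteq> sets (F t))"

definition brownian_motion :: "'a measure \<Rightarrow> (real \<Rightarrow> 'a measure) \<Rightarrow> (real \<Rightarrow> 'a \<Rightarrow> real) \<Rightarrow> bool" where
  "brownian_motion M F W \<longleftrightarrow>
     (\<forall>t\<ge>0. W t \<in> borel_measurable (F t)) \<and>
     (\<forall>\<omega>\<in>space M. W 0 \<omega> = 0 \<and> continuous_on {0..} (\<lambda>t. W t \<omega>)) \<and>
     (\<forall>s t. 0 \<le> s \<longrightarrow> s < t \<longrightarrow>
        distributed M lborel (\<lambda>\<omega>. W t \<omega> - W s \<omega>)
          (\<lambda>y. ennreal (normal_density 0 (sqrt (t - s)) y)) \<and>
        (\<forall>A\<in>sets (F s). \<forall>B\<in>sets borel.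
           measure M (A \<inter> {\<omega>\<in>space M. W t \<omega> - W s \<omega> \<in> B})
             = measure M A * measure M {\<omega>\<in>space M. W t \<omega> - W s \<omega> \<in> B}))"

definition is_rate :: "'a measure \<Rightarrow> (real \<Rightarrow> 'a measure) \<Rightarrow> (real \<Rightarrow> 'a \<Rightarrow> real)
    \<Rightarrow> (real \<Rightarrow> 'a \<Rightarrow> real) \<Rightarrow> bool" where
  "is_rate M F X Xd \<longleftrightarrow>
     (\<forall>t\<ge>0. (\<lambda>(s, \<omega>). Xd s \<omega>) \<in> borel_measurable (restrict_space borel {0..t} \<Otimes>\<^sub>M F t)) \<and>
     (\<forall>\<omega>\<in>space M. \<forall>t\<ge>0. set_integrable lborel {0..t} (\<lambda>s. Xd s \<omega>) \<and>
         X t \<omega> = X 0 \<omega> + (LINT s:{0..t}|lborel. Xd s \<omega>)) \<and>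
     (AE \<omega> in M. (\<integral>\<^sup>+ t\<in>{0..}. ennreal ((Xd t \<omega>)\<^sup>2) \<partial>lborel) < \<infinity>)"

text \<open>The rate \<dot>X (unique up to Lebesgue null sets in time for each path).\<close>
definition rate :: "'a measure \<Rightarrow> (real \<Rightarrow> 'a measure) \<Rightarrow> (real \<Rightarrow> 'a \<Rightarrow> real) \<Rightarrow> real \<Rightarrow> 'a \<Rightarrow> real" where
  "rate M F X = (SOME Xd. is_rate M F X Xd)"

definition strategies :: "'a measure \<Rightarrow> (real \<Rightarrow> 'a measure) \<Rightarrow> real \<Rightarrow> (real \<Rightarrow> 'a \<Rightarrow> real) set" where
  "strategies M F x = {X.
     (\<forall>t\<ge>0. X t \<in> borel_measurable (F t)) \<and>
     (\<forall>\<omega>\<in>space M. X 0 \<omega> = x) \<and>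
     (\<exists>Xd. is_rate M F X Xd) \<and>
     (\<exists>C. \<forall>t\<ge>0. \<forall>\<omega>\<in>space M. \<bar>X t \<omega>\<bar> \<le> C) \<and>
     (\<integral>\<^sup>+ \<omega>. (\<integral>\<^sup>+ t\<in>{0..}. ennreal ((X t \<omega>)\<^sup>2) \<partial>lborel) \<partial>M) < \<infinity> \<and>
     (AE \<omega> in M. ((\<lambda>t. (X t \<omega>)\<^sup>2 * t * ln (ln t)) \<longlongrightarrow> 0) at_top)}"

definition det_strategies :: "'a measure \<Rightarrow> (real \<Rightarrow> 'a measure) \<Rightarrow> real \<Rightarrow> (real \<Rightarrow> real) set" where
  "det_strategies M F x = {f. (\<lambda>t \<omega>. f t) \<in> strategies M F x}"

definition price :: "'a measure \<Rightarrow> (real \<Rightarrow> 'a measure) \<Rightarrow> (real \<Rightarrow> 'a \<Rightarrow> real)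
    \<Rightarrow> real \<Rightarrow> real \<Rightarrow> real \<Rightarrow> real \<Rightarrow> nat \<Rightarrow> (nat \<Rightarrow> real \<Rightarrow> 'a \<Rightarrow> real) \<Rightarrow> real \<Rightarrow> 'a \<Rightarrow> real" where
  "price M F W S0 \<sigma> \<gamma> lam n Xs t \<omega> =
     S0 + \<sigma> * W t \<omega> + \<gamma> * (\<Sum>j<n. Xs j t \<omega> - Xs j 0 \<omega>) + lam * (\<Sum>j<n. rate M F (Xs j) t \<omega>)"

definition revenue :: "'a measure \<Rightarrow> (real \<Rightarrow> 'a measure) \<Rightarrow> (real \<Rightarrow> 'a \<Rightarrow> real)
    \<Rightarrow> real \<Rightarrow> real \<Rightarrow> real \<Rightarrow> real \<Rightarrow> nat \<Rightarrow> (nat \<Rightarrow> real \<Rightarrow> 'a \<Rightarrow> real) \<Rightarrow> nat \<Rightarrow> 'a \<Rightarrow> real" where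
  "revenue M F W S0 \<sigma> \<gamma> lam n Xs i \<omega> =
     - Lim at_top (\<lambda>T. LINT t:{0..T}|lborel. rate M F (Xs i) t \<omega> * price M F W S0 \<sigma> \<gamma> lam n Xs t \<omega>)"

definition mean_variance :: "'a measure \<Rightarrow> real \<Rightarrow> ('a \<Rightarrow> real) \<Rightarrow> real" where
  "mean_variance M a R = (\<integral>\<omega>. R \<omega> \<partial>M) - a / 2 * (\<integral>\<omega>. (R \<omega> - (\<integral>\<omega>'. R \<omega>' \<partial>M))\<^sup>2 \<partial>M)"

text \<open>Expected CARA utility E[u_a(R)] = 1/a - (1/a) E[exp(-a R)] in [-\<infinity>, 1/a]
  (u_a is bounded above, so the expectation always exists as an extended real).\<close>
definition cara_utility :: "'a measure \<Rightarrow> real \<Rightarrow> ('a \<Rightarrow> real) \<Rightarrow> ereal" where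
  "cara_utility M a R = ereal (1 / a) - ereal (1 / a) * enn2ereal (\<integral>\<^sup>+ \<omega>. ennreal (exp (- a * R \<omega>)) \<partial>M)"

definition MV_nash :: "'a measure \<Rightarrow> (real \<Rightarrow> 'a measure) \<Rightarrow> (real \<Rightarrow> 'a \<Rightarrow> real)
    \<Rightarrow> real \<Rightarrow> real \<Rightarrow> real \<Rightarrow> real \<Rightarrow> nat \<Rightarrow> (nat \<Rightarrow> real) \<Rightarrow> (nat \<Rightarrow> real)
    \<Rightarrow> (nat \<Rightarrow> real \<Rightarrow> real) \<Rightarrow> bool" where
  "MV_nash M F W S0 \<sigma> \<gamma> lam n x \<alpha> Xs \<longleftrightarrow>
     (\<forall>i<n. Xs i \<in> det_strategies M F (x i) \<and>
        (\<forall>f\<in>det_strategies M F (x i).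
           mean_variance M (\<alpha> i) (revenue M F W S0 \<sigma> \<gamma> lam n (\<lambda>j t \<omega>. (Xs(i := f)) j t) i)
             \<le> mean_variance M (\<alpha> i) (revenue M F W S0 \<sigma> \<gamma> lam n (\<lambda>j t \<omega>. Xs j t) i)))"

definition CARA_nash :: "'a measure \<Rightarrow> (real \<Rightarrow> 'a measure) \<Rightarrow> (real \<Rightarrow> 'a \<Rightarrow> real)
    \<Rightarrow> real \<Rightarrow> real \<Rightarrow> real \<Rightarrow> real \<Rightarrow> nat \<Rightarrow> (nat \<Rightarrow> real) \<Rightarrow> (nat \<Rightarrow> real)
    \<Rightarrow> (nat \<Rightarrow> real \<Rightarrow> 'a \<Rightarrow> real) \<Rightarrow> bool" where
  "CARA_nash M F W S0 \<sigma> \<gamma> lam n x \<alpha> Xs \<longleftrightarrow>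
     (\<forall>i<n. Xs i \<in> strategies M F (x i) \<and>
        (\<forall>X\<in>strategies M F (x i).
           cara_utility M (\<alpha> i) (revenue M F W S0 \<sigma> \<gamma> lam n (Xs(i := X)) i)
             \<le> cara_utility M (\<alpha> i) (revenue M F W S0 \<sigma> \<gamma> lam n Xs i)))"

end

theory Submission
  imports Defs "HOL-Real_Asymp.Real_Asymp"
begin

text \<open>
  Integration by parts turns \<open>\<integral> X' W dt\<close> into \<open>X W - \<integral> X dW\<close>; since \<open>X\<^sup>2 t log log t\<close> vanishes at infinity, the
  boundary term disappears by the (upper) law of the iterated logarithm, and the revenues of an agent are a constant
  plus \<open>\<sigma> \<integral> X dW\<close> minus a quadratic functional of the paths. For deterministic strategies, mean and variance are
  therefore explicit and the mean-variance functional is strictly concave and quadratic, so that equilibria are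
  characterised by a linear stationarity condition. Exponentials solving the Euler--Lagrange system satisfy it.
  For uniqueness, test the difference of two stationarity conditions with the difference of the strategies and sum
  over the agents: the permanent impact terms form a total derivative, and a positive definite form remains.

  For CARA utility, pathwise concavity bounds the revenues of any adapted \<open>X\<close> by their linearisation at the
  candidate \<open>g\<close>. The inequality \<open>exp y \<ge> z (1 + y - ln z)\<close>, with \<open>z\<close> a discretised stochastic exponential of
  \<open>- \<alpha> \<sigma> g\<close> up to a finite time, then yields the required lower bound on the expected exponential; by using \<open>g\<close> and
  not \<open>X\<close> in \<open>z\<close>, one avoids having to know that the stochastic exponential of \<open>X\<close> is a true martingale.
\<close>

section \<open>Absolutely continuous paths on the half-line\<close>

text \<open>Two features of the definitions shape the proof. The rate of a strategy is a selected
  version, which may depend on the sample point even for a deterministic strategy, and versions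
  agree only almost everywhere in time; so rates are exchanged under time integrals only. Moreover
  \<open>mean_variance\<close> uses Bochner integrals, which are 0 by default on nonmeasurable
  functions, and no completeness is assumed: an almost sure formula for the revenues is not enough
  there, and their measurability has to be proved. CARA utilities are nonnegative integrals, for
  which almost sure inequalities suffice.

  The choice of \<open>z\<close> is sharp. For \<open>X = g\<close> the exponent bounded in
  \<open>exp_Iinf_ge\<close> is \<open>\<beta>\<close> times the stochastic integral of
  \<open>g\<close> minus \<open>\<beta>\<^sup>2 / 2 * ip g g\<close>, that is, the logarithm of a
  stochastic exponential of mean 1, so the entropy inequality is an equality in the limit.

  The exponents of the equilibria come from invariant patterns of the Euler-Lagrange system: for
  equal risk aversions deviations from the mean and the common mean evolve separately; for two
  different agents the patterns are kernel vectors of a symmetric matrix.\<close>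

lemma set_integral_Icc_split:
  fixes g :: "real \<Rightarrow> real"
  assumes "a \<le> b" "b \<le> c" "set_integrable lborel {a..c} g"
  shows "(LINT s:{a..c}|lborel. g s) = (LINT s:{a..b}|lborel. g s) + (LINT s:{b..c}|lborel. g s)"
proof -
  have 1: "set_integrable lborel {a..b} g" "set_integrable lborel {b..c} g"
    using assms by (auto intro: set_integrable_subset)
  have "AE x in lborel. \<not> (x \<in> {a..b} \<and> x \<in> {b..c})"
    using AE_lborel_singleton[of b] by eventually_elim auto
  moreover have "{a..c} = {a..b} \<union> {b..c}" using assms by auto
  ultimately show ?thesis
    using set_integral_Un_AE[of "{a..b}" "{b..c}" lborel g] 1 by simp
qed

lemma set_integral_singleton:
  fixes g :: "real \<Rightarrow> real"
  shows "(LINT s:{a}|lborel. g s) = 0"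
proof -
  have "AE s in lborel. indicator {a} s *\<^sub>R g s = 0"
    using AE_lborel_singleton[of a] by eventually_elim (auto simp: indicator_def)
  then show ?thesis unfolding set_lebesgue_integral_def by (rule integral_eq_zero_AE)
qed

section \<open>Equidistant grids and Riemann-Stieltjes sums\<close>

text \<open>The affine formula is kept beyond index \<open>n\<close>, and division by zero gives the
  constant \<open>a\<close> for \<open>n = 0\<close>. So for \<open>0 \<le> a\<close> and
  \<open>a \<le> b\<close> a grid is a nonnegative nondecreasing sequence over all indices, as the
  lemmas on discrete integrals demand of their times.\<close>

definition grid :: "real \<Rightarrow> real \<Rightarrow> nat \<Rightarrow> nat \<Rightarrow> real" where
  "grid a b n k = a + real k * (b - a) / real n"

lemma grid_0 [simp]: "grid a b n 0 = a"
  by (simp add: grid_def)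

lemma grid_last: "n > 0 \<Longrightarrow> grid a b n n = b"
  by (simp add: grid_def)

lemma grid_Suc_diff: "grid a b n (Suc k) - grid a b n k = (b - a) / real n"
  by (simp add: grid_def diff_divide_distrib[symmetric] left_diff_distrib[symmetric])

lemma grid_mono: "a \<le> b \<Longrightarrow> k \<le> l \<Longrightarrow> grid a b n k \<le> grid a b n l"
  by (auto simp: grid_def intro!: divide_right_mono mult_right_mono)

lemma grid_ge: "a \<le> b \<Longrightarrow> a \<le> grid a b n k"
  using grid_mono[of a b 0 k n] by simp

lemma grid_le: "a \<le> b \<Longrightarrow> k \<le> n \<Longrightarrow> grid a b n k \<le> b"
  using grid_mono[of a b k n n] grid_last[of n a b] by (cases "n = 0") (auto simp: grid_def)

lemma set_integral_grid_sum:
  fixes g :: "real \<Rightarrow> real"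
  assumes "a \<le> b" "set_integrable lborel {a..b} g" "n > 0" "m \<le> n"
  shows "(\<Sum>k<m. LINT s:{grid a b n k..grid a b n (Suc k)}|lborel. g s)
    = (LINT s:{a..grid a b n m}|lborel. g s)"
  using assms(4)
proof (induction m)
  case 0
  show ?case by (simp add: set_integral_singleton)
next
  case (Suc m)
  have "set_integrable lborel {a..grid a b n (Suc m)} g"
    by (rule set_integrable_subset[OF assms(2)]) (use Suc.prems assms grid_le[of a b "Suc m" n] in auto)
  from set_integral_Icc_split[OF _ _ this, of "grid a b n m"] show ?case
    using Suc assms grid_ge[of a b n m] grid_mono[of a b m "Suc m" n] by simp
qed

lemma set_integrable_continuous_mult:
  fixes g w :: "real \<Rightarrow> real"
  assumes w: "continuous_on {a..b} w" and g: "set_integrable lborel {a..b} g"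
  shows "set_integrable lborel {a..b} (\<lambda>s. w s * g s)"
proof -
  obtain B where B: "\<And>s. s \<in> {a..b} \<Longrightarrow> \<bar>w s\<bar> \<le> B"
    using continuous_on_compact_bound[OF compact_Icc w] by (metis real_norm_def)
  show ?thesis
  proof (rule set_integrable_bound)
    show "set_integrable lborel {a..b} (\<lambda>s. B * g s)" using g by simp
    have "(\<lambda>s. (indicator {a..b} s *\<^sub>R w s) * (indicator {a..b} s *\<^sub>R g s)) \<in> borel_measurable lborel"
      using borel_measurable_continuous_on_indicator[OF _ w] g
      by (intro borel_measurable_times) (auto simp: set_integrable_def dest: borel_measurable_integrable)
    then show "set_borel_measurable lborel {a..b} (\<lambda>s. w s * g s)"
      unfolding set_borel_measurable_def
      by (rule measurable_cong[THEN iffD1, rotated]) (auto simp: indicator_def)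
    show "AE s in lborel. s \<in> {a..b} \<longrightarrow> norm (w s * g s) \<le> norm (B * g s)"
      using B by (intro AE_I2) (auto simp: abs_mult intro!: mult_right_mono intro: order_trans[OF _ abs_ge_self])
  qed
qed

text \<open>On each cell the error is at most the oscillation of \<open>w\<close> times the integral
  of \<open>\<bar>g s\<bar>\<close>; uniform continuity makes the former small, and the latter sum
  to a fixed total. The free tags \<open>p\<close> serve left and right endpoint sums alike.\<close>

lemma riemann_stieltjes_limit:
  fixes g w :: "real \<Rightarrow> real"
  assumes ab: "a \<le> b" and w: "continuous_on {a..b} w" and g: "set_integrable lborel {a..b} g"
    and p: "\<And>n k. k < n \<Longrightarrow> p n k \<in> {grid a b n k..grid a b n (Suc k)}"
  shows "(\<lambda>n. \<Sum>k<n. w (p n k) * (LINT s:{grid a b n k..grid a b n (Suc k)}|lborel. g s))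
    \<longlonglongrightarrow> (LINT s:{a..b}|lborel. w s * g s)"
proof (rule LIMSEQ_I)
  fix e :: real assume e: "e > 0"
  define G where "G = (LINT s:{a..b}|lborel. \<bar>g s\<bar>)"
  have G0: "G \<ge> 0" unfolding G_def set_lebesgue_integral_def by (rule integral_nonneg_AE) auto
  \<comment> \<open>The summand 1 keeps the quotient meaningful when \<open>G = 0\<close> and makes
    \<open>e' * G < e\<close> strict.\<close>
  define e' where "e' = e / (G + 1)"
  have e': "e' > 0" using e G0 by (simp add: e'_def)
  have "uniformly_continuous_on {a..b} w"
    using w by (simp add: compact_uniformly_continuous)
  then obtain d where d: "d > 0"
    "\<And>x y. x \<in> {a..b} \<Longrightarrow> y \<in> {a..b} \<Longrightarrow> dist x y < d \<Longrightarrow> dist (w x) (w y) < e'"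
    unfolding uniformly_continuous_on_def using e' by metis
  obtain N :: nat where N: "(b - a) / d < real N" using reals_Archimedean2 by blast
  note wg = set_integrable_continuous_mult[OF w g]
  show "\<exists>no. \<forall>n\<ge>no. norm ((\<Sum>k<n. w (p n k) * (LINT s:{grid a b n k..grid a b n (Suc k)}|lborel. g s))
     - (LINT s:{a..b}|lborel. w s * g s)) < e"
  proof (intro exI allI impI)
    fix n assume n: "n \<ge> Suc N"
    have np: "n > 0" using n by simp
    define I where "I k = {grid a b n k..grid a b n (Suc k)}" for k
    have Isub: "I k \<subseteq> {a..b}" if "k < n" for k
      using that ab grid_ge[of a b n k] grid_le[of a b "Suc k" n] by (auto simp: I_def)
    have mesh: "(b - a) / real n < d"
    proof -
      have "(b - a) / d < real n" using N n by linarith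
      then show ?thesis using d(1) np by (simp add: field_simps)
    qed
    have gi: "set_integrable lborel (I k) g" if "k < n" for k
      by (rule set_integrable_subset[OF g _ Isub[OF that]]) (simp add: I_def)
    have wgi: "set_integrable lborel (I k) (\<lambda>s. w s * g s)" if "k < n" for k
      by (rule set_integrable_subset[OF wg _ Isub[OF that]]) (simp add: I_def)
    have tm: "\<bar>w (p n k) * (LINT s:I k|lborel. g s) - (LINT s:I k|lborel. w s * g s)\<bar>
        \<le> e' * (LINT s:I k|lborel. \<bar>g s\<bar>)" if k: "k < n" for k
    proof -
      have cl: "\<bar>w (p n k) - w s\<bar> \<le> e'" if s: "s \<in> I k" for s
      proof -
        have "dist (p n k) s < d"
          using p[OF k] s grid_Suc_diff[of a b n k] mesh by (auto simp: I_def dist_real_def)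
        then have "dist (w (p n k)) (w s) < e'"
          using d(2) p[OF k] s Isub[OF k] unfolding I_def by blast
        then show ?thesis by (simp add: dist_real_def)
      qed
      have i1: "set_integrable lborel (I k) (\<lambda>s. (w (p n k) - w s) * g s)"
        using gi[OF k] wgi[OF k] by (simp add: left_diff_distrib set_integral_diff)
      have "w (p n k) * (LINT s:I k|lborel. g s) - (LINT s:I k|lborel. w s * g s)
          = (LINT s:I k|lborel. (w (p n k) - w s) * g s)"
        using gi[OF k] wgi[OF k] by (simp add: left_diff_distrib set_integral_diff)
      also have "\<bar>\<dots>\<bar> \<le> (LINT s:I k|lborel. \<bar>(w (p n k) - w s) * g s\<bar>)"
        using integral_abs_bound[of lborel "\<lambda>s. indicator (I k) s *\<^sub>R ((w (p n k) - w s) * g s)"]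
        unfolding set_lebesgue_integral_def by (simp add: abs_mult)
      also have "\<dots> \<le> (LINT s:I k|lborel. e' * \<bar>g s\<bar>)"
        using i1 gi[OF k] cl
        by (intro set_integral_mono set_integrable_abs set_integrable_mult_right)
           (auto simp: abs_mult intro!: mult_right_mono)
      finally show ?thesis by simp
    qed
    have s1: "(\<Sum>k<n. LINT s:I k|lborel. w s * g s) = (LINT s:{a..b}|lborel. w s * g s)"
      unfolding I_def using set_integral_grid_sum[OF ab wg np order_refl] grid_last[OF np] by simp
    have s2: "(\<Sum>k<n. LINT s:I k|lborel. \<bar>g s\<bar>) = G"
      unfolding I_def G_def
      using set_integral_grid_sum[OF ab set_integrable_abs[OF g] np order_refl] grid_last[OF np] by simp
    have "\<bar>(\<Sum>k<n. w (p n k) * (LINT s:I k|lborel. g s)) - (LINT s:{a..b}|lborel. w s * g s)\<bar>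
       \<le> (\<Sum>k<n. \<bar>w (p n k) * (LINT s:I k|lborel. g s) - (LINT s:I k|lborel. w s * g s)\<bar>)"
      unfolding s1[symmetric] sum_subtractf[symmetric] by (rule sum_abs)
    also have "\<dots> \<le> (\<Sum>k<n. e' * (LINT s:I k|lborel. \<bar>g s\<bar>))"
      by (intro sum_mono tm) auto
    also have "\<dots> = e' * G" by (simp add: sum_distrib_left[symmetric] s2)
    also have "\<dots> < e" using e G0 by (simp add: e'_def field_simps)
    finally show "norm ((\<Sum>k<n. w (p n k) * (LINT s:{grid a b n k..grid a b n (Suc k)}|lborel. g s))
     - (LINT s:{a..b}|lborel. w s * g s)) < e" by (simp add: I_def)
  qed
qed

section \<open>Absolutely continuous functions and their rates\<close>

text \<open>Integrability is a clause of its own because the integral is 0 by default: otherwise a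
  constant \<open>f\<close> would accept as its rate any \<open>fd\<close> that is integrable on no
  \<open>{0..t}\<close> with \<open>t > 0\<close>.\<close>

definition ac_rate :: "(real \<Rightarrow> real) \<Rightarrow> (real \<Rightarrow> real) \<Rightarrow> bool" where
  "ac_rate f fd \<longleftrightarrow> (\<forall>t\<ge>0. set_integrable lborel {0..t} fd \<and> f t = f 0 + (LINT s:{0..t}|lborel. fd s))"

lemma ac_rate_eq: "ac_rate f fd \<Longrightarrow> 0 \<le> t \<Longrightarrow> f t = f 0 + (LINT s:{0..t}|lborel. fd s)"
  unfolding ac_rate_def by blast

lemma ac_rate_integrable: "ac_rate f fd \<Longrightarrow> 0 \<le> a \<Longrightarrow> set_integrable lborel {a..b} fd"
  by (cases "a \<le> b") (auto simp: ac_rate_def intro!: set_integrable_subset[of lborel "{0..b}" fd "{a..b}"])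

lemma ac_rate_diff:
  assumes "ac_rate f fd" "0 \<le> a" "a \<le> b"
  shows "f b - f a = (LINT s:{a..b}|lborel. fd s)"
proof -
  have "f b = f 0 + (LINT s:{0..b}|lborel. fd s)" "f a = f 0 + (LINT s:{0..a}|lborel. fd s)"
    using assms by (auto intro!: ac_rate_eq)
  then show ?thesis
    using set_integral_Icc_split[of 0 a b fd] ac_rate_integrable[of f fd 0 b] assms by simp
qed

lemma ac_rate_continuous:
  assumes "ac_rate f fd"
  shows "continuous_on {0..} f"
  unfolding continuous_on_eq_continuous_within
proof
  fix t :: real assume t: "t \<in> {0..}"
  define T where "T = t + 1"
  have "fd integrable_on {0..T}"
    by (intro set_borel_integral_eq_integral(1) ac_rate_integrable[OF assms]) simp
  then have "continuous_on {0..T} (\<lambda>t. f 0 + integral {0..t} fd)"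
    by (intro continuous_intros indefinite_integral_continuous_1)
  moreover have "f t = f 0 + integral {0..t} fd" if "t \<in> {0..T}" for t
    unfolding set_borel_integral_eq_integral(2)[OF ac_rate_integrable[OF assms order_refl], symmetric]
    using that by (intro ac_rate_eq[OF assms]) auto
  ultimately have "continuous_on {0..T} f"
    using continuous_on_cong[of "{0..T}" "{0..T}" f "\<lambda>t. f 0 + integral {0..t} fd"] by blast
  then have "continuous (at t within {0..T}) f"
    using t by (auto simp: continuous_on_eq_continuous_within T_def)
  moreover have "at t within {0..T} = at t within {0..}"
    by (rule at_within_nhd[of t "{..<T}"]) (auto simp: T_def)
  ultimately show "continuous (at t within {0..}) f"
    by (simp add: continuous_within)
qed

lemma continuous_indefinite_integral:
  fixes u :: "real \<Rightarrow> real"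
  assumes "\<And>T. set_integrable lborel {0..T} u"
  shows "continuous_on {0..} (\<lambda>T. LINT s:{0..T}|lborel. u s)"
  by (rule ac_rate_continuous[where fd=u]) (use assms in \<open>simp add: ac_rate_def set_integral_singleton\<close>)

lemma ac_rate_continuous_Icc: "ac_rate f fd \<Longrightarrow> 0 \<le> a \<Longrightarrow> continuous_on {a..b} f"
  by (rule continuous_on_subset[OF ac_rate_continuous]) auto

lemma ac_rate_rs_right:
  assumes "ac_rate f fd" "0 \<le> a" "a \<le> b" "continuous_on {a..b} w"
  shows "(\<lambda>n. \<Sum>k<n. w (grid a b n (Suc k)) * (f (grid a b n (Suc k)) - f (grid a b n k)))
    \<longlonglongrightarrow> (LINT s:{a..b}|lborel. w s * fd s)"
proof -
  have "(LINT s:{grid a b n k..grid a b n (Suc k)}|lborel. fd s) = f (grid a b n (Suc k)) - f (grid a b n k)" for n k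
    using ac_rate_diff[OF assms(1), of "grid a b n k" "grid a b n (Suc k)"] grid_mono[OF assms(3)]
      grid_ge[OF assms(3), of n k] assms(2) by simp
  then show ?thesis
    using riemann_stieltjes_limit[OF assms(3,4) ac_rate_integrable[OF assms(1,2)], of "\<lambda>n k. grid a b n (Suc k)"]
      grid_mono[OF assms(3)] by simp
qed

lemma ac_rate_rs_left:
  assumes "ac_rate f fd" "0 \<le> a" "a \<le> b" "continuous_on {a..b} w"
  shows "(\<lambda>n. \<Sum>k<n. w (grid a b n k) * (f (grid a b n (Suc k)) - f (grid a b n k)))
    \<longlonglongrightarrow> (LINT s:{a..b}|lborel. w s * fd s)"
proof -
  have "(LINT s:{grid a b n k..grid a b n (Suc k)}|lborel. fd s) = f (grid a b n (Suc k)) - f (grid a b n k)" for n k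
    using ac_rate_diff[OF assms(1), of "grid a b n k" "grid a b n (Suc k)"] grid_mono[OF assms(3)]
      grid_ge[OF assms(3), of n k] assms(2) by simp
  then show ?thesis
    using riemann_stieltjes_limit[OF assms(3,4) ac_rate_integrable[OF assms(1,2)], of "\<lambda>n k. grid a b n k"]
      grid_mono[OF assms(3)] by simp
qed

text \<open>Abel summation moves the increments from \<open>w\<close> to \<open>f\<close>. Only
  continuity of \<open>w\<close> is asked, so Brownian paths qualify: left endpoint sums of an
  absolutely continuous integrand converge on every path, not merely in probability.\<close>

lemma ac_rate_by_parts_sum:
  assumes "ac_rate f fd" "0 \<le> a" "a \<le> b" "continuous_on {a..b} w"
  shows "(\<lambda>n. \<Sum>k<n. f (grid a b n k) * (w (grid a b n (Suc k)) - w (grid a b n k)))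
    \<longlonglongrightarrow> f b * w b - f a * w a - (LINT s:{a..b}|lborel. w s * fd s)"
proof -
  have "(\<lambda>n. (f b * w b - f a * w a)
      - (\<Sum>k<n. w (grid a b n (Suc k)) * (f (grid a b n (Suc k)) - f (grid a b n k))))
    \<longlonglongrightarrow> f b * w b - f a * w a - (LINT s:{a..b}|lborel. w s * fd s)"
    by (intro tendsto_intros ac_rate_rs_right assms)
  then show ?thesis
  proof (rule Lim_transform_eventually, intro eventually_sequentiallyI[of 1])
    fix n :: nat assume "n \<ge> 1"
    then have n: "n > 0" by simp
    let ?h = "\<lambda>k. f (grid a b n k) * w (grid a b n k)"
    have "(\<Sum>k<n. ?h (Suc k) - ?h k) = f b * w b - f a * w a"
      using sum_lessThan_telescope[of ?h n] grid_last[OF n] by simp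
    moreover have "(\<Sum>k<n. ?h (Suc k) - ?h k)
        = (\<Sum>k<n. w (grid a b n (Suc k)) * (f (grid a b n (Suc k)) - f (grid a b n k)))
        + (\<Sum>k<n. f (grid a b n k) * (w (grid a b n (Suc k)) - w (grid a b n k)))"
      unfolding sum.distrib[symmetric] by (intro sum.cong) (auto simp: algebra_simps)
    ultimately show "(f b * w b - f a * w a)
      - (\<Sum>k<n. w (grid a b n (Suc k)) * (f (grid a b n (Suc k)) - f (grid a b n k)))
      = (\<Sum>k<n. f (grid a b n k) * (w (grid a b n (Suc k)) - w (grid a b n k)))" by linarith
  qed
qed

text \<open>The same left endpoint sums are evaluated twice, once through the rate of the integrator
  \<open>g\<close> and once by Abel summation.\<close>

lemma ac_rate_ibp:
  assumes "ac_rate f fd" "ac_rate g gd" "0 \<le> a" "a \<le> b"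
  shows "(LINT s:{a..b}|lborel. f s * gd s) + (LINT s:{a..b}|lborel. g s * fd s) = f b * g b - f a * g a"
proof -
  have "(LINT s:{a..b}|lborel. f s * gd s) = f b * g b - f a * g a - (LINT s:{a..b}|lborel. g s * fd s)"
    using ac_rate_rs_left[OF assms(2-4) ac_rate_continuous_Icc[OF assms(1,3)]]
      ac_rate_by_parts_sum[OF assms(1,3,4) ac_rate_continuous_Icc[OF assms(2,3)]]
    by (rule LIMSEQ_unique)
  then show ?thesis by simp
qed

lemma ac_rate_id: "ac_rate (\<lambda>t. t) (\<lambda>t. 1)"
  unfolding ac_rate_def by (auto simp: set_integrable_def set_lebesgue_integral_def)

lemma riemann_sum_limit:
  fixes w :: "real \<Rightarrow> real"
  assumes "0 \<le> a" "a \<le> b" "continuous_on {a..b} w"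
  shows "(\<lambda>n. \<Sum>k<n. w (grid a b n k) * ((b - a) / real n)) \<longlonglongrightarrow> (LINT s:{a..b}|lborel. w s)"
  using ac_rate_rs_left[OF ac_rate_id assms] by (simp add: grid_Suc_diff)

lemma ac_rate_lincomb:
  assumes "ac_rate f fd" "ac_rate g gd"
  shows "ac_rate (\<lambda>t. a * f t + b * g t) (\<lambda>t. a * fd t + b * gd t)"
  unfolding ac_rate_def
proof (intro allI impI conjI)
  fix t :: real assume t: "0 \<le> t"
  have i: "set_integrable lborel {0..t} fd" "set_integrable lborel {0..t} gd"
    using assms ac_rate_integrable by blast+
  show "set_integrable lborel {0..t} (\<lambda>t. a * fd t + b * gd t)"
    using i by (intro set_integral_add set_integrable_mult_right)
  show "a * f t + b * g t = a * f 0 + b * g 0 + (LINT s:{0..t}|lborel. a * fd s + b * gd s)"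
    using ac_rate_diff[OF assms(1) order_refl t] ac_rate_diff[OF assms(2) order_refl t] i
    by (simp add: algebra_simps)
qed

lemma finite_borel_measure_density:
  fixes u :: "real \<Rightarrow> real"
  assumes "integrable lborel u"
  shows "finite_borel_measure (density lborel (\<lambda>x. ennreal (u x)))"
proof (intro finite_borel_measure.intro finite_measureI finite_borel_measure_axioms.intro)
  have [measurable]: "u \<in> borel_measurable borel" using assms by simp
  have "(\<integral>\<^sup>+ x. ennreal (u x) \<partial>lborel) \<le> (\<integral>\<^sup>+ x. ennreal (norm (u x)) \<partial>lborel)"
    by (intro nn_integral_mono ennreal_leI) auto
  also have "\<dots> < \<infinity>" using assms by (simp add: integrable_iff_bounded)
  finally show "emeasure (density lborel (\<lambda>x. ennreal (u x))) (space (density lborel (\<lambda>x. ennreal (u x)))) \<noteq> \<infinity>"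
    by (simp add: emeasure_density)
  show "sets (density lborel (\<lambda>x. ennreal (u x))) = sets borel" by simp
qed

text \<open>All integrals of \<open>f1 - f2\<close> over initial segments vanish. Its positive and
  negative parts are therefore densities of finite measures with the same distribution function,
  hence of the same measure, and densities are unique almost everywhere.\<close>

lemma ac_rate_unique:
  assumes "ac_rate f f1" "ac_rate f f2"
  shows "AE t in lborel. t \<ge> 0 \<longrightarrow> f1 t = f2 t"
proof -
  have main: "AE t in lborel. t \<in> {0..T} \<longrightarrow> f1 t = f2 t" if T: "T \<ge> 0" for T
  proof -
    define u where "u t = indicator {0..T} t *\<^sub>R (f1 t - f2 t)" for t
    have i: "integrable lborel u"
      using set_integral_diff(1)[OF ac_rate_integrable[OF assms(1)] ac_rate_integrable[OF assms(2)], of 0 T]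
      by (simp add: set_integrable_def u_def[abs_def])
    have z: "(LINT t:{..s}|lborel. u t) = 0" for s
    proof -
      \<comment> \<open>\<open>r\<close> clamps \<open>s\<close> to \<open>{0..T}\<close>. The
        integrands compared below can differ only at the point 0, namely for negative
        \<open>s\<close>, where the segment shrinks to \<open>{0..0}\<close>.\<close>
      define r where "r = max 0 (min s T)"
      have r: "0 \<le> r" by (auto simp: r_def)
      have "(LINT t:{..s}|lborel. u t) = (LINT t:{0..r}|lborel. f1 t - f2 t)"
        unfolding set_lebesgue_integral_def
      proof (rule integral_cong_AE)
        show "(\<lambda>x. indicator {..s} x *\<^sub>R u x) \<in> borel_measurable lborel" using i by simp
        have "(\<lambda>x. indicator {0..r} x *\<^sub>R f1 x) \<in> borel_measurable lborel"
          "(\<lambda>x. indicator {0..r} x *\<^sub>R f2 x) \<in> borel_measurable lborel"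
          using ac_rate_integrable[OF assms(1), of 0 r] ac_rate_integrable[OF assms(2), of 0 r]
          unfolding set_integrable_def by (auto dest: borel_measurable_integrable)
        then show "(\<lambda>x. indicator {0..r} x *\<^sub>R (f1 x - f2 x)) \<in> borel_measurable lborel"
          unfolding scaleR_diff_right by (rule borel_measurable_diff)
        show "AE x in lborel. indicator {..s} x *\<^sub>R u x = indicator {0..r} x *\<^sub>R (f1 x - f2 x)"
          using AE_lborel_singleton[of 0] by eventually_elim (auto simp: u_def r_def indicator_def)
      qed
      also have "\<dots> = (f r - f 0) - (f r - f 0)"
        unfolding ac_rate_diff[OF assms(1) order_refl r] ac_rate_diff[OF assms(2) order_refl r, symmetric]
        using ac_rate_diff[OF assms(1) order_refl r] ac_rate_diff[OF assms(2) order_refl r]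
        by (simp add: ac_rate_integrable[OF assms(1)] ac_rate_integrable[OF assms(2)])
      finally show ?thesis by simp
    qed
    define p where "p t = max 0 (u t)" for t
    define q where "q t = max 0 (- u t)" for t
    have pq: "integrable lborel p" "integrable lborel q"
      unfolding p_def q_def using i by auto
    have upq: "u t = p t - q t" for t by (auto simp: p_def q_def)
    have cd: "cdf (density lborel (\<lambda>x. ennreal (p x))) s = (LINT t:{..s}|lborel. p t)"
      if "integrable lborel p" "\<And>t. p t \<ge> 0" for p and s
    proof -
      have [measurable]: "p \<in> borel_measurable borel" using that by simp
      have "emeasure (density lborel (\<lambda>x. ennreal (p x))) {..s} = (\<integral>\<^sup>+ x. ennreal (indicator {..s} x *\<^sub>R p x) \<partial>lborel)"
        by (subst emeasure_density) (auto intro!: nn_integral_cong simp: indicator_def)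
      also have "\<dots> = ennreal (LINT t:{..s}|lborel. p t)"
        unfolding set_lebesgue_integral_def using that
        by (intro nn_integral_eq_integral integrable_mult_indicator) auto
      finally show ?thesis
        unfolding cdf_def measure_def using that
        by (simp add: set_lebesgue_integral_def)
    qed
    have "density lborel (\<lambda>x. ennreal (p x)) = density lborel (\<lambda>x. ennreal (q x))"
    proof (rule cdf_unique'[OF finite_borel_measure_density[OF pq(1)] finite_borel_measure_density[OF pq(2)]])
      have "(LINT t:{..s}|lborel. p t) = (LINT t:{..s}|lborel. q t)" for s
      proof -
        have "set_integrable lborel {..s} p" "set_integrable lborel {..s} q"
          unfolding set_integrable_def by (rule integrable_mult_indicator; simp add: pq)+
        then show ?thesis using z[of s] by (simp add: upq)
      qed
      then show "cdf (density lborel (\<lambda>x. ennreal (p x))) = cdf (density lborel (\<lambda>x. ennreal (q x)))"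
        using cd[OF pq(1)] cd[OF pq(2)] by (auto simp: p_def q_def)
    qed
    then have "AE x in lborel. ennreal (p x) = ennreal (q x)"
      using pq by (intro sigma_finite_measure.density_unique[OF sigma_finite_lborel]) auto
    then show ?thesis
    proof eventually_elim
      fix t assume "ennreal (p t) = ennreal (q t)"
      moreover have "p t \<ge> 0" "q t \<ge> 0" by (auto simp: p_def q_def)
      ultimately have "p t = q t" by simp
      then show "t \<in> {0..T} \<longrightarrow> f1 t = f2 t" using upq[of t] by (auto simp: u_def)
    qed
  qed
  have "AE t in lborel. \<forall>N::nat. t \<in> {0..real N} \<longrightarrow> f1 t = f2 t"
    by (intro AE_all_countable[THEN iffD2] allI main) simp
  then show ?thesis
    by eventually_elim (metis atLeastAtMost_iff real_arch_simple)
qed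

section \<open>Square-integrable functions on the half-line and admissible paths\<close>

text \<open>Measurability of \<open>u\<close> is a separate clause, since integrability of the
  square says nothing about the set where \<open>u\<close> is positive.\<close>

definition sqi :: "(real \<Rightarrow> real) \<Rightarrow> bool" where
  "sqi u \<longleftrightarrow> set_borel_measurable lborel {0..} u \<and> set_integrable lborel {0..} (\<lambda>t. (u t)\<^sup>2)"

definition ip :: "(real \<Rightarrow> real) \<Rightarrow> (real \<Rightarrow> real) \<Rightarrow> real" where
  "ip u v = (LINT t:{0..}|lborel. u t * v t)"

lemma set_borel_measurable_mult:
  fixes u v :: "_ \<Rightarrow> real"
  assumes "set_borel_measurable M A u" "set_borel_measurable M A v"
  shows "set_borel_measurable M A (\<lambda>t. u t * v t)"
proof -
  have "(\<lambda>t. (indicator A t *\<^sub>R u t) * (indicator A t *\<^sub>R v t)) \<in> borel_measurable M"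
    using assms unfolding set_borel_measurable_def by (intro borel_measurable_times)
  then show ?thesis unfolding set_borel_measurable_def
    by (rule measurable_cong[THEN iffD1, rotated]) (auto simp: indicator_def)
qed

lemma set_borel_measurable_lincomb:
  fixes u v :: "_ \<Rightarrow> real"
  assumes "set_borel_measurable M A u" "set_borel_measurable M A v"
  shows "set_borel_measurable M A (\<lambda>t. a * u t + b * v t)"
proof -
  have "(\<lambda>t. a * (indicator A t *\<^sub>R u t) + b * (indicator A t *\<^sub>R v t)) \<in> borel_measurable M"
    using assms unfolding set_borel_measurable_def
    by (intro borel_measurable_add borel_measurable_times borel_measurable_const)
  then show ?thesis unfolding set_borel_measurable_def
    by (rule measurable_cong[THEN iffD1, rotated]) (auto simp: indicator_def)
qed

lemma abs_mult_le_squares: "\<bar>x * y\<bar> \<le> x\<^sup>2 + y\<^sup>2" for x y :: real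
  using sum_squares_bound[of "\<bar>x\<bar>" "\<bar>y\<bar>"] mult_nonneg_nonneg[of "\<bar>x\<bar>" "\<bar>y\<bar>"]
  unfolding abs_mult by (simp del: mult_nonneg_nonneg)

lemma sqi_mult:
  assumes "sqi u" "sqi v"
  shows "set_integrable lborel {0..} (\<lambda>t. u t * v t)"
proof (rule set_integrable_bound)
  show "set_integrable lborel {0..} (\<lambda>t. (u t)\<^sup>2 + (v t)\<^sup>2)"
    using assms by (auto simp: sqi_def)
  show "set_borel_measurable lborel {0..} (\<lambda>t. u t * v t)"
    using assms by (auto simp: sqi_def intro: set_borel_measurable_mult)
  show "AE t in lborel. t \<in> {0..} \<longrightarrow> norm (u t * v t) \<le> norm ((u t)\<^sup>2 + (v t)\<^sup>2)"
    using abs_mult_le_squares by (intro AE_I2) auto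
qed

lemma sqi_lincomb:
  assumes "sqi u" "sqi v"
  shows "sqi (\<lambda>t. a * u t + b * v t)"
proof -
  have "set_integrable lborel {0..} (\<lambda>t. a\<^sup>2 * (u t)\<^sup>2 + (2 * a * b) * (u t * v t) + b\<^sup>2 * (v t)\<^sup>2)"
    using assms sqi_mult[OF assms] by (intro set_integral_add set_integrable_mult_right) (auto simp: sqi_def)
  moreover have "(a * u t + b * v t)\<^sup>2 = a\<^sup>2 * (u t)\<^sup>2 + (2 * a * b) * (u t * v t) + b\<^sup>2 * (v t)\<^sup>2" for t
    by (simp add: power2_eq_square algebra_simps)
  ultimately show ?thesis
    using assms by (simp add: sqi_def set_borel_measurable_lincomb)
qed

lemma sqi_zero: "sqi (\<lambda>t. 0)"
  by (simp add: sqi_def set_borel_measurable_def set_integrable_def)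

lemma sqi_cmult: "sqi u \<Longrightarrow> sqi (\<lambda>t. a * u t)"
  using sqi_lincomb[of u "\<lambda>t. 0" a 0] by (simp add: sqi_zero)

lemma sqi_add: "sqi u \<Longrightarrow> sqi v \<Longrightarrow> sqi (\<lambda>t. u t + v t)"
  using sqi_lincomb[of u v 1 1] by simp

lemma sqi_diff: "sqi u \<Longrightarrow> sqi v \<Longrightarrow> sqi (\<lambda>t. u t - v t)"
  using sqi_lincomb[of u v 1 "-1"] by simp

lemma sqi_sum: "(\<And>j. j \<in> A \<Longrightarrow> sqi (u j)) \<Longrightarrow> sqi (\<lambda>t. \<Sum>j\<in>A. u j t)"
  by (induction A rule: infinite_finite_induct) (auto intro: sqi_add simp: sqi_zero)

lemma ip_commute: "ip u v = ip v u"
  by (simp add: ip_def mult.commute)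

lemma ip_add_left: "sqi u \<Longrightarrow> sqi v \<Longrightarrow> sqi w \<Longrightarrow> ip (\<lambda>t. u t + v t) w = ip u w + ip v w"
  using sqi_mult[of u w] sqi_mult[of v w] by (simp add: ip_def distrib_right)

lemma ip_diff_left: "sqi u \<Longrightarrow> sqi v \<Longrightarrow> sqi w \<Longrightarrow> ip (\<lambda>t. u t - v t) w = ip u w - ip v w"
  using sqi_mult[of u w] sqi_mult[of v w] by (simp add: ip_def left_diff_distrib)

lemma ip_cmult_left: "ip (\<lambda>t. a * u t) w = a * ip u w"
  by (simp add: ip_def mult.assoc)

lemma ip_add_right: "sqi u \<Longrightarrow> sqi v \<Longrightarrow> sqi w \<Longrightarrow> ip w (\<lambda>t. u t + v t) = ip w u + ip w v"
  by (simp add: ip_commute[of w] ip_add_left)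

lemma ip_diff_right: "sqi u \<Longrightarrow> sqi v \<Longrightarrow> sqi w \<Longrightarrow> ip w (\<lambda>t. u t - v t) = ip w u - ip w v"
  by (simp add: ip_commute[of w] ip_diff_left)

lemma ip_cmult_right: "ip w (\<lambda>t. a * u t) = a * ip w u"
  by (simp add: ip_commute[of w] ip_cmult_left)

lemma ip_sum_left:
  assumes "\<And>j. j \<in> A \<Longrightarrow> sqi (u j)" "sqi w"
  shows "ip (\<lambda>t. \<Sum>j\<in>A. u j t) w = (\<Sum>j\<in>A. ip (u j) w)"
  using assms(1)
  by (induction A rule: infinite_finite_induct)
     (auto simp: ip_add_left sqi_sum assms(2) sqi_zero, auto simp: ip_def)

lemma ip_nonneg: "ip u u \<ge> 0"
  unfolding ip_def set_lebesgue_integral_def by (rule integral_nonneg_AE) auto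

lemma ip_cong_AE:
  assumes "sqi u" "sqi v" "sqi u'" "sqi v'"
    and "AE t in lborel. t \<ge> 0 \<longrightarrow> u t = u' t" "AE t in lborel. t \<ge> 0 \<longrightarrow> v t = v' t"
  shows "ip u v = ip u' v'"
  unfolding ip_def set_lebesgue_integral_def
proof (rule integral_cong_AE)
  show "(\<lambda>t. indicator {0..} t *\<^sub>R (u t * v t)) \<in> borel_measurable lborel"
    "(\<lambda>t. indicator {0..} t *\<^sub>R (u' t * v' t)) \<in> borel_measurable lborel"
    using sqi_mult[OF assms(1,2)] sqi_mult[OF assms(3,4)]
    by (auto simp: set_integrable_def dest: borel_measurable_integrable)
  show "AE t in lborel. indicator {0..} t *\<^sub>R (u t * v t) = indicator {0..} t *\<^sub>R (u' t * v' t)"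
    using assms(5,6) by eventually_elim (auto simp: indicator_def)
qed

lemma ip_eq_0_AE:
  assumes "sqi u" "ip u u = 0"
  shows "AE t in lborel. t \<ge> 0 \<longrightarrow> u t = 0"
proof -
  have "integrable lborel (\<lambda>t. indicator {0..} t *\<^sub>R (u t * u t))"
    using sqi_mult[OF assms(1,1)] by (simp add: set_integrable_def)
  then have "AE t in lborel. indicator {0..} t *\<^sub>R (u t * u t) = 0"
    using assms(2) unfolding ip_def set_lebesgue_integral_def
    by (subst (asm) integral_nonneg_eq_0_iff_AE) auto
  then show ?thesis by eventually_elim (auto simp: indicator_def split: if_splits)
qed

lemma ip_tendsto:
  "sqi u \<Longrightarrow> sqi v \<Longrightarrow> ((\<lambda>T. LINT t:{0..T}|lborel. u t * v t) \<longlongrightarrow> ip u v) at_top"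
  unfolding ip_def by (rule tendsto_set_lebesgue_integral_at_top) (auto intro: sqi_mult)

text \<open>The pathwise conditions on an admissible strategy and its rate, except for boundedness, which they imply.\<close>

definition adm :: "(real \<Rightarrow> real) \<Rightarrow> (real \<Rightarrow> real) \<Rightarrow> bool" where
  "adm f fd \<longleftrightarrow> ac_rate f fd \<and> sqi fd \<and> sqi f \<and> ((\<lambda>t. (f t)\<^sup>2 * t * ln (ln t)) \<longlongrightarrow> 0) at_top"

lemma admD: "adm f fd \<Longrightarrow> ac_rate f fd" "adm f fd \<Longrightarrow> sqi fd" "adm f fd \<Longrightarrow> sqi f"
  by (simp_all add: adm_def)

lemma ev_loglog: "eventually (\<lambda>t::real. 1 \<le> t * ln (ln t) \<and> 0 \<le> ln (ln t)) at_top"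
  by (intro eventually_conj; real_asymp)

lemma loglog_decay_tendsto_0:
  fixes f :: "real \<Rightarrow> real"
  assumes "((\<lambda>t. (f t)\<^sup>2 * t * ln (ln t)) \<longlongrightarrow> 0) at_top"
  shows "(f \<longlongrightarrow> 0) at_top"
proof -
  have "((\<lambda>t. (f t)\<^sup>2) \<longlongrightarrow> 0) at_top"
  proof (rule tendsto_sandwich[OF _ _ tendsto_const assms])
    show "eventually (\<lambda>t. 0 \<le> (f t)\<^sup>2) at_top" by simp
    show "eventually (\<lambda>t. (f t)\<^sup>2 \<le> (f t)\<^sup>2 * t * ln (ln t)) at_top"
      using ev_loglog
    proof eventually_elim
      case (elim t)
      then have "(f t)\<^sup>2 * 1 \<le> (f t)\<^sup>2 * (t * ln (ln t))" by (intro mult_left_mono) auto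
      then show ?case by (simp add: mult.assoc)
    qed
  qed
  then have "((\<lambda>t. sqrt ((f t)\<^sup>2)) \<longlongrightarrow> sqrt 0) at_top" by (intro tendsto_intros)
  then show ?thesis by (simp add: tendsto_rabs_zero_iff)
qed

lemma adm_tendsto_0: "adm f fd \<Longrightarrow> (f \<longlongrightarrow> 0) at_top"
  by (auto simp: adm_def intro: loglog_decay_tendsto_0)

text \<open>The decay condition survives because
  \<open>(x + y)\<^sup>2 \<le> 2 * x\<^sup>2 + 2 * y\<^sup>2\<close> and the weight is eventually
  nonnegative. Variations of a strategy thus stay admissible.\<close>

lemma adm_lincomb:
  assumes "adm f fd" "adm g gd"
  shows "adm (\<lambda>t. a * f t + b * g t) (\<lambda>t. a * fd t + b * gd t)"
  unfolding adm_def
proof (intro conjI)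
  show "((\<lambda>t. (a * f t + b * g t)\<^sup>2 * t * ln (ln t)) \<longlongrightarrow> 0) at_top"
  proof (rule tendsto_sandwich[OF _ _ tendsto_const])
    show "eventually (\<lambda>t. 0 \<le> (a * f t + b * g t)\<^sup>2 * t * ln (ln t)) at_top"
      using ev_loglog eventually_ge_at_top[of 0] by eventually_elim simp
    have "((\<lambda>t. 2 * a\<^sup>2 * ((f t)\<^sup>2 * t * ln (ln t)) + 2 * b\<^sup>2 * ((g t)\<^sup>2 * t * ln (ln t)))
        \<longlongrightarrow> 2 * a\<^sup>2 * 0 + 2 * b\<^sup>2 * 0) at_top"
      using assms unfolding adm_def by (intro tendsto_intros) auto
    then show "((\<lambda>t. 2 * a\<^sup>2 * ((f t)\<^sup>2 * t * ln (ln t)) + 2 * b\<^sup>2 * ((g t)\<^sup>2 * t * ln (ln t)))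
        \<longlongrightarrow> 0) at_top" by simp
    show "eventually (\<lambda>t. (a * f t + b * g t)\<^sup>2 * t * ln (ln t)
      \<le> 2 * a\<^sup>2 * ((f t)\<^sup>2 * t * ln (ln t)) + 2 * b\<^sup>2 * ((g t)\<^sup>2 * t * ln (ln t))) at_top"
      using ev_loglog eventually_ge_at_top[of 0]
    proof eventually_elim
      case (elim t)
      have "(a * f t + b * g t)\<^sup>2 \<le> 2 * a\<^sup>2 * (f t)\<^sup>2 + 2 * b\<^sup>2 * (g t)\<^sup>2"
        using zero_le_power2[of "a * f t - b * g t"] by (simp add: power2_eq_square algebra_simps)
      then have "(a * f t + b * g t)\<^sup>2 * (t * ln (ln t)) \<le> (2 * a\<^sup>2 * (f t)\<^sup>2 + 2 * b\<^sup>2 * (g t)\<^sup>2) * (t * ln (ln t))"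
        using elim by (intro mult_right_mono) auto
      then show ?case by (simp add: algebra_simps)
    qed
  qed
qed (use assms in \<open>auto simp: adm_def intro: ac_rate_lincomb sqi_lincomb\<close>)

lemma adm_zero: "adm (\<lambda>t. 0) (\<lambda>t. 0)"
  by (simp add: adm_def ac_rate_def sqi_zero set_integrable_def)

lemma adm_sum: "(\<And>j. j \<in> A \<Longrightarrow> adm (f j) (fd j)) \<Longrightarrow> adm (\<lambda>t. \<Sum>j\<in>A. f j t) (\<lambda>t. \<Sum>j\<in>A. fd j t)"
proof (induction A rule: infinite_finite_induct)
  case (insert x A)
  then show ?case using adm_lincomb[of "f x" "fd x" "\<lambda>t. \<Sum>j\<in>A. f j t" "\<lambda>t. \<Sum>j\<in>A. fd j t" 1 1] by simp
qed (auto simp: adm_zero)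

lemma adm_diff: "adm f fd \<Longrightarrow> adm g gd \<Longrightarrow> adm (\<lambda>t. f t - g t) (\<lambda>t. fd t - gd t)"
  using adm_lincomb[of f fd g gd 1 "-1"] by simp

lemma adm_bounded:
  assumes "adm f fd"
  shows "\<exists>C. \<forall>t\<ge>0. \<bar>f t\<bar> \<le> C"
proof -
  have "eventually (\<lambda>t. \<bar>f t\<bar> < 1) at_top"
    using adm_tendsto_0[OF assms] by (auto simp: tendsto_iff dist_real_def)
  then obtain T where T: "\<And>t. t \<ge> T \<Longrightarrow> \<bar>f t\<bar> < 1" by (auto simp: eventually_at_top_linorder)
  obtain B where B: "\<And>s. s \<in> {0..T} \<Longrightarrow> \<bar>f s\<bar> \<le> B"
    using continuous_on_compact_bound[OF compact_Icc ac_rate_continuous_Icc[OF admD(1)[OF assms] order_refl]]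
    by (metis real_norm_def)
  have "\<bar>f t\<bar> \<le> max B 1" if "t \<ge> 0" for t
    using T[of t] B[of t] that by (cases "t \<ge> T") auto
  then show ?thesis by blast
qed

text \<open>Both functions tend to 0, so the boundary term at infinity drops out. With
  \<open>g = f\<close> and \<open>f 0 = 0\<close> a function is orthogonal to its own rate, which is
  how permanent impact terms vanish later.\<close>

lemma adm_ibp:
  assumes "adm f fd" "adm g gd"
  shows "ip f gd + ip g fd = - (f 0 * g 0)"
proof (rule tendsto_unique)
  show "((\<lambda>T. (LINT s:{0..T}|lborel. f s * gd s) + (LINT s:{0..T}|lborel. g s * fd s)) \<longlongrightarrow> ip f gd + ip g fd) at_top"
    using assms by (intro tendsto_add ip_tendsto) (auto dest: admD)
  have "((\<lambda>T. f T * g T - f 0 * g 0) \<longlongrightarrow> 0 * 0 - f 0 * g 0) at_top"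
    using assms by (intro tendsto_intros) (auto dest: adm_tendsto_0)
  moreover have "eventually (\<lambda>T. f T * g T - f 0 * g 0 = (LINT s:{0..T}|lborel. f s * gd s) + (LINT s:{0..T}|lborel. g s * fd s)) at_top"
    using eventually_ge_at_top[of 0]
    by eventually_elim (simp only: ac_rate_ibp[OF admD(1)[OF assms(1)] admD(1)[OF assms(2)] order_refl])
  ultimately show "((\<lambda>T. (LINT s:{0..T}|lborel. f s * gd s) + (LINT s:{0..T}|lborel. g s * fd s)) \<longlongrightarrow> - (f 0 * g 0)) at_top"
    using Lim_transform_eventually by force
qed simp

lemma adm_rate_zero:
  assumes "adm f fd" "ip fd fd = 0" "t \<ge> 0"
  shows "f t = f 0"
proof -
  have "(LINT s:{0..t}|lborel. fd s) = (LINT s:{0..t}|lborel. 0)"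
    unfolding set_lebesgue_integral_def
  proof (rule integral_cong_AE)
    show "(\<lambda>x. indicator {0..t} x *\<^sub>R fd x) \<in> borel_measurable lborel"
      using ac_rate_integrable[OF admD(1)[OF assms(1)], of 0 t]
      by (auto simp: set_integrable_def dest: borel_measurable_integrable)
    show "AE x in lborel. indicator {0..t} x *\<^sub>R fd x = indicator {0..t} x *\<^sub>R 0"
      using ip_eq_0_AE[OF admD(2)[OF assms(1)] assms(2)] by eventually_elim (auto simp: indicator_def)
  qed simp
  then show ?thesis using ac_rate_eq[OF admD(1)[OF assms(1)] assms(3)] by simp
qed

lemma sqi_exp:
  assumes "\<tau> < 0"
  shows "sqi (\<lambda>t. exp (\<tau> * t))"
proof -
  have "set_integrable lborel {0..} (\<lambda>t. exp (2 * \<tau> * t))"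
  proof -
    \<comment> \<open>Integrability is read off from the total mass 1 of an exponential
      distribution.\<close>
    have "integrable lborel (exponential_density (- 2 * \<tau>))"
    proof (rule integrableI_nonneg)
      have "(\<integral>\<^sup>+ x. ennreal (exponential_density (- 2 * \<tau>) x) \<partial>lborel) = 1"
        using prob_space.emeasure_space_1[OF prob_space_exponential_density[of "- 2 * \<tau>"]] assms
        by (simp add: emeasure_density)
      then show "(\<integral>\<^sup>+ x. ennreal (exponential_density (- 2 * \<tau>) x) \<partial>lborel) < \<infinity>" by simp
    qed (use assms in \<open>auto intro: exponential_density_nonneg\<close>)
    then have "integrable lborel (\<lambda>t. (1 / (- 2 * \<tau>)) * exponential_density (- 2 * \<tau>) t)" by simp
    then show ?thesis unfolding set_integrable_def
      by (rule Bochner_Integration.integrable_cong[THEN iffD1, rotated 2])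
         (use assms in \<open>auto simp: exponential_density_def indicator_def\<close>)
  qed
  moreover have "(exp (\<tau> * t))\<^sup>2 = exp (2 * \<tau> * t)" for t
    by (simp add: power2_eq_square exp_add[symmetric])
  ultimately show ?thesis by (simp add: sqi_def set_borel_measurable_def)
qed

lemma adm_exp:
  assumes "\<tau> < 0"
  shows "adm (\<lambda>t. exp (\<tau> * t)) (\<lambda>t. \<tau> * exp (\<tau> * t))"
  unfolding adm_def
proof (intro conjI)
  show "((\<lambda>t. (exp (\<tau> * t))\<^sup>2 * t * ln (ln t)) \<longlongrightarrow> 0) at_top"
    using assms by real_asymp
  show "ac_rate (\<lambda>t. exp (\<tau> * t)) (\<lambda>t. \<tau> * exp (\<tau> * t))"
    unfolding ac_rate_def
  proof (intro allI impI conjI)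
    fix t :: real assume t: "0 \<le> t"
    have c: "continuous_on {0..t} (\<lambda>t. \<tau> * exp (\<tau> * t))" by (intro continuous_intros)
    show "set_integrable lborel {0..t} (\<lambda>t. \<tau> * exp (\<tau> * t))"
      using borel_integrable_atLeastAtMost'[OF c] by simp
    have "(LINT s:{0..t}|lborel. \<tau> * exp (\<tau> * s)) = exp (\<tau> * t) - exp (\<tau> * 0)"
      unfolding set_lebesgue_integral_def
      by (rule integral_FTC_Icc[OF t _ c])
         (auto intro!: derivative_eq_intros simp: has_real_derivative_iff_has_vector_derivative[symmetric])
    then show "exp (\<tau> * t) = exp (\<tau> * 0) + (LINT s:{0..t}|lborel. \<tau> * exp (\<tau> * s))" by simp
  qed
qed (auto intro: sqi_exp[OF assms] sqi_cmult)

section \<open>Brownian increments and discrete stochastic integrals\<close>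

text \<open>Completing the square: tilting by \<open>exp (c * y)\<close> moves the mean of the
  normal law to \<open>c * v\<close>, up to the moment generating function. It is the one-step form
  of Girsanov's theorem.\<close>

lemma normal_density_exp_shift:
  assumes "v > 0"
  shows "normal_density 0 (sqrt v) y * exp (c * y) = exp (c\<^sup>2 * v / 2) * normal_density (c * v) (sqrt v) y"
proof -
  have "- y\<^sup>2 / (2 * v) + c * y = c\<^sup>2 * v / 2 - (y - c * v)\<^sup>2 / (2 * v)"
    using assms by (simp add: power2_eq_square field_simps)
  then have "exp (- y\<^sup>2 / (2 * v)) * exp (c * y) = exp (c\<^sup>2 * v / 2) * exp (- (y - c * v)\<^sup>2 / (2 * v))"
    by (simp add: exp_add[symmetric])
  then show ?thesis using assms by (simp add: normal_density_def)
qed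

lemma integrable_square_mult:
  fixes f g :: "'a \<Rightarrow> real"
  assumes [measurable]: "f \<in> borel_measurable M" "g \<in> borel_measurable M"
    and "integrable M (\<lambda>x. (f x)\<^sup>2)" "integrable M (\<lambda>x. (g x)\<^sup>2)"
  shows "integrable M (\<lambda>x. f x * g x)"
proof (rule Bochner_Integration.integrable_bound)
  show "integrable M (\<lambda>x. (f x)\<^sup>2 + (g x)\<^sup>2)" using assms by simp
  show "AE x in M. norm (f x * g x) \<le> norm ((f x)\<^sup>2 + (g x)\<^sup>2)"
    using abs_mult_le_squares by (intro AE_I2) auto
qed simp

lemma integrable_square_add:
  fixes f g :: "'a \<Rightarrow> real"
  assumes "f \<in> borel_measurable M" "g \<in> borel_measurable M"
    and "integrable M (\<lambda>x. (f x)\<^sup>2)" "integrable M (\<lambda>x. (g x)\<^sup>2)"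
  shows "integrable M (\<lambda>x. (f x + g x)\<^sup>2)"
  using integrable_square_mult[OF assms] assms
  by (simp add: power2_sum mult.assoc)

lemma integrable_square_diff:
  fixes f g :: "'a \<Rightarrow> real"
  assumes "f \<in> borel_measurable M" "g \<in> borel_measurable M"
    and "integrable M (\<lambda>x. (f x)\<^sup>2)" "integrable M (\<lambda>x. (g x)\<^sup>2)"
  shows "integrable M (\<lambda>x. (f x - g x)\<^sup>2)"
  using integrable_square_mult[OF assms] assms
  by (simp add: power2_diff mult.assoc)

text \<open>Cauchy-Schwarz in weighted form,
  \<open>x * y \<le> d / 2 * x\<^sup>2 + y\<^sup>2 / (2 * d)\<close>: errors that vanish in mean
  square are negligible against factors bounded in mean square.\<close>

lemma tendsto_integral_mult_zero:
  fixes f g :: "nat \<Rightarrow> 'a \<Rightarrow> real"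
  assumes m: "\<And>n. f n \<in> borel_measurable M" "\<And>n. g n \<in> borel_measurable M"
    and i: "\<And>n. integrable M (\<lambda>x. (f n x)\<^sup>2)" "\<And>n. integrable M (\<lambda>x. (g n x)\<^sup>2)"
    and B: "\<And>n. (\<integral>x. (f n x)\<^sup>2 \<partial>M) \<le> B" and z: "(\<lambda>n. \<integral>x. (g n x)\<^sup>2 \<partial>M) \<longlonglongrightarrow> 0"
  shows "(\<lambda>n. \<integral>x. f n x * g n x \<partial>M) \<longlonglongrightarrow> 0"
proof (rule LIMSEQ_I)
  fix e :: real assume e: "e > 0"
  define B' where "B' = max B 0 + 1"
  have B': "B' > 0" "B \<le> B'" by (auto simp: B'_def)
  \<comment> \<open>With this weight either summand contributes at most
    \<open>e / 2\<close>.\<close>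
  define d where "d = e / B'"
  have d: "d > 0" using e B' by (simp add: d_def)
  have "eventually (\<lambda>n. (\<integral>x. (g n x)\<^sup>2 \<partial>M) < d * e) sequentially"
    using z d e by (intro order_tendstoD(2)) auto
  then obtain N where N: "\<And>n. n \<ge> N \<Longrightarrow> (\<integral>x. (g n x)\<^sup>2 \<partial>M) < d * e"
    by (auto simp: eventually_sequentially)
  show "\<exists>no. \<forall>n\<ge>no. norm ((\<integral>x. f n x * g n x \<partial>M) - 0) < e"
  proof (intro exI allI impI)
    fix n assume n: "n \<ge> N"
    have pt: "\<bar>f n x * g n x\<bar> \<le> (d / 2) * (f n x)\<^sup>2 + (1 / (2 * d)) * (g n x)\<^sup>2" for x
    proof -
      have "0 \<le> (d * \<bar>f n x\<bar> - \<bar>g n x\<bar>)\<^sup>2 / (2 * d)" using d by simp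
      also have "\<dots> = (d / 2) * (f n x)\<^sup>2 + (1 / (2 * d)) * (g n x)\<^sup>2 - \<bar>f n x * g n x\<bar>"
        using d by (simp add: power2_diff abs_mult power_mult_distrib field_simps) (simp add: power2_eq_square field_simps)
      finally show ?thesis by simp
    qed
    have fg: "integrable M (\<lambda>x. f n x * g n x)" by (intro integrable_square_mult m i)
    have "\<bar>\<integral>x. f n x * g n x \<partial>M\<bar> \<le> (\<integral>x. \<bar>f n x * g n x\<bar> \<partial>M)" by (rule integral_abs_bound)
    also have "\<dots> \<le> (\<integral>x. (d / 2) * (f n x)\<^sup>2 + (1 / (2 * d)) * (g n x)\<^sup>2 \<partial>M)"
      using fg i pt by (intro integral_mono) auto
    also have "\<dots> = (d / 2) * (\<integral>x. (f n x)\<^sup>2 \<partial>M) + (1 / (2 * d)) * (\<integral>x. (g n x)\<^sup>2 \<partial>M)"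
      using i by simp
    also have "\<dots> < (d / 2) * B' + (1 / (2 * d)) * (d * e)"
      using d N[OF n] B[of n] B' by (intro add_le_less_mono mult_left_mono mult_strict_left_mono) auto
    also have "\<dots> = e" using d B' by (simp add: d_def)
    finally show "norm ((\<integral>x. f n x * g n x \<partial>M) - 0) < e" by simp
  qed
qed

lemma sigma_sets_vimage_borel:
  fixes Y :: "'a \<Rightarrow> real"
  shows "sigma_sets S {Y -` A \<inter> S | A. A \<in> sets borel} = {Y -` A \<inter> S | A. A \<in> sets borel}"
  using sets_vimage_algebra[of S Y borel] sets_vimage_algebra2[of Y S borel] by simp

locale brownian_space = prob_space M for M :: "'a measure" +
  fixes F :: "real \<Rightarrow> 'a measure" and W :: "real \<Rightarrow> 'a \<Rightarrow> real"
  assumes filt: "filtration_on M F" and bm: "brownian_motion M F W"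
begin

lemma F_mono: "0 \<le> s \<Longrightarrow> s \<le> t \<Longrightarrow> Y \<in> borel_measurable (F s) \<Longrightarrow> Y \<in> borel_measurable (F t)"
  using filt by (intro measurable_from_subalg[of "F t" "F s"]) (auto simp: filtration_on_def subalgebra_def)

lemma F_M: "0 \<le> s \<Longrightarrow> Y \<in> borel_measurable (F s) \<Longrightarrow> Y \<in> borel_measurable M"
  using filt by (intro measurable_from_subalg[of M "F s"]) (auto simp: filtration_on_def subalgebra_def)

lemma space_F: "0 \<le> s \<Longrightarrow> space (F s) = space M"
  using filt by (auto simp: filtration_on_def)

lemma sets_F_M: "0 \<le> s \<Longrightarrow> A \<in> sets (F s) \<Longrightarrow> A \<in> sets M"
  using filt by (auto simp: filtration_on_def)

lemma W_F: "0 \<le> t \<Longrightarrow> W t \<in> borel_measurable (F t)"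
  using bm by (auto simp: brownian_motion_def)

lemma W_M: "0 \<le> t \<Longrightarrow> W t \<in> borel_measurable M"
  using W_F F_M by blast

lemma W_continuous: "\<omega> \<in> space M \<Longrightarrow> continuous_on {0..} (\<lambda>t. W t \<omega>)"
  using bm by (auto simp: brownian_motion_def)

lemma W_continuous_Icc: "\<omega> \<in> space M \<Longrightarrow> 0 \<le> a \<Longrightarrow> continuous_on {a..b} (\<lambda>t. W t \<omega>)"
  by (rule continuous_on_subset[OF W_continuous]) auto

lemma W_0: "\<omega> \<in> space M \<Longrightarrow> W 0 \<omega> = 0"
  using bm by (auto simp: brownian_motion_def)

lemma W_distr:
  "0 \<le> s \<Longrightarrow> s < t \<Longrightarrow> distributed M lborel (\<lambda>\<omega>. W t \<omega> - W s \<omega>) (\<lambda>y. ennreal (normal_density 0 (sqrt (t - s)) y))"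
  using bm by (auto simp: brownian_motion_def)

text \<open>\<open>brownian_motion\<close> states independence for events of \<open>F s\<close>, and
  the preimages under an \<open>F s\<close>-measurable \<open>Y\<close> are such events.\<close>

lemma incr_indep:
  assumes "0 \<le> s" "s < t" "Y \<in> borel_measurable (F s)"
  shows "indep_var borel Y borel (\<lambda>\<omega>. W t \<omega> - W s \<omega>)"
proof -
  have m: "Y \<in> borel_measurable M" "(\<lambda>\<omega>. W t \<omega> - W s \<omega>) \<in> borel_measurable M"
    using assms F_M W_M by auto
  show ?thesis
    unfolding indep_var_eq sigma_sets_vimage_borel
  proof (intro conjI indep_setI)
    fix a b assume "a \<in> {Y -` A \<inter> space M | A. A \<in> sets borel}"
      "b \<in> {(\<lambda>\<omega>. W t \<omega> - W s \<omega>) -` A \<inter> space M | A. A \<in> sets borel}"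
    then obtain A B where AB: "A \<in> sets borel" "B \<in> sets borel" "a = Y -` A \<inter> space M"
      "b = {\<omega> \<in> space M. W t \<omega> - W s \<omega> \<in> B}" by auto
    have "a \<in> sets (F s)"
      using measurable_sets[OF assms(3) AB(1)] AB(3) space_F[OF assms(1)] by simp
    then show "prob (a \<inter> b) = prob a * prob b"
      using bm assms AB unfolding brownian_motion_def by blast
  qed (use m in auto)
qed

text \<open>Independence factorises the expectation. The case \<open>s = t\<close>, on which
  \<open>brownian_motion\<close> is silent, is included with increment 0, so that degenerate grids
  are covered as well.\<close>

lemma incr_mult:
  fixes Y :: "'a \<Rightarrow> real" and g :: "real \<Rightarrow> real"
  assumes "0 \<le> s" "s \<le> t" "Y \<in> borel_measurable (F s)" "integrable M Y" "g \<in> borel_measurable borel"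
    and "integrable M (\<lambda>\<omega>. g (W t \<omega> - W s \<omega>))"
  shows "integrable M (\<lambda>\<omega>. Y \<omega> * g (W t \<omega> - W s \<omega>))"
    and "(\<integral>\<omega>. Y \<omega> * g (W t \<omega> - W s \<omega>) \<partial>M) = (\<integral>\<omega>. Y \<omega> \<partial>M) * (\<integral>\<omega>. g (W t \<omega> - W s \<omega>) \<partial>M)"
proof -
  have "integrable M (\<lambda>\<omega>. Y \<omega> * g (W t \<omega> - W s \<omega>)) \<and>
    (\<integral>\<omega>. Y \<omega> * g (W t \<omega> - W s \<omega>) \<partial>M) = (\<integral>\<omega>. Y \<omega> \<partial>M) * (\<integral>\<omega>. g (W t \<omega> - W s \<omega>) \<partial>M)"
  proof (cases "s = t")
    case True
    then show ?thesis using assms(4) by (simp add: prob_space)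
  next
    case False
    have "indep_var borel ((\<lambda>x. x) \<circ> Y) borel (g \<circ> (\<lambda>\<omega>. W t \<omega> - W s \<omega>))"
      using False assms by (intro indep_var_compose[OF incr_indep]) auto
    then show ?thesis
      using indep_var_integrable[of Y "\<lambda>\<omega>. g (W t \<omega> - W s \<omega>)"]
        indep_var_lebesgue_integral[of Y "\<lambda>\<omega>. g (W t \<omega> - W s \<omega>)"] assms by (simp add: comp_def)
  qed
  then show "integrable M (\<lambda>\<omega>. Y \<omega> * g (W t \<omega> - W s \<omega>))"
    "(\<integral>\<omega>. Y \<omega> * g (W t \<omega> - W s \<omega>) \<partial>M) = (\<integral>\<omega>. Y \<omega> \<partial>M) * (\<integral>\<omega>. g (W t \<omega> - W s \<omega>) \<partial>M)"
    by auto
qed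

lemma incr_mult_has_integral:
  fixes Y :: "'a \<Rightarrow> real" and g :: "real \<Rightarrow> real"
  assumes "0 \<le> s" "s \<le> t" "Y \<in> borel_measurable (F s)" "integrable M Y" "g \<in> borel_measurable borel"
    and "has_bochner_integral M (\<lambda>\<omega>. g (W t \<omega> - W s \<omega>)) c"
  shows "has_bochner_integral M (\<lambda>\<omega>. Y \<omega> * g (W t \<omega> - W s \<omega>)) ((\<integral>\<omega>. Y \<omega> \<partial>M) * c)"
  using incr_mult[OF assms(1-5)] assms(6) by (simp add: has_bochner_integral_iff)

lemma incr_has_integral:
  assumes "0 \<le> s" "s < t" "g \<in> borel_measurable borel"
    "has_bochner_integral lborel (\<lambda>y. normal_density 0 (sqrt (t - s)) y * g y) c"
  shows "has_bochner_integral M (\<lambda>\<omega>. g (W t \<omega> - W s \<omega>)) c"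
proof -
  note D = W_distr[OF assms(1,2)]
  have "integrable M (\<lambda>\<omega>. g (W t \<omega> - W s \<omega>))"
    using distributed_integrable[OF D] assms(3,4) by (auto dest: integrable.intros)
  moreover have "(\<integral>\<omega>. g (W t \<omega> - W s \<omega>) \<partial>M) = c"
    using distributed_integral[OF D, of g] assms(3,4) by (auto dest: has_bochner_integral_integral_eq)
  ultimately show ?thesis by (simp add: has_bochner_integral_iff)
qed

lemma incr_mean:
  assumes "0 \<le> s" "s \<le> t"
  shows "has_bochner_integral M (\<lambda>\<omega>. W t \<omega> - W s \<omega>) 0"
proof (cases "s = t")
  case False
  then show ?thesis
    using assms normal_moment_nz_1[of "sqrt (t - s)" 0]
    by (intro incr_has_integral[where g="\<lambda>y. y"]) auto
qed (simp add: has_bochner_integral_zero)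

lemma incr_square:
  assumes "0 \<le> s" "s \<le> t"
  shows "has_bochner_integral M (\<lambda>\<omega>. (W t \<omega> - W s \<omega>)\<^sup>2) (t - s)"
proof (cases "s = t")
  case False
  then show ?thesis
    using assms normal_moment_even[of "sqrt (t - s)" 0 1]
    by (intro incr_has_integral[where g="\<lambda>y. y\<^sup>2"]) (auto simp: power2_eq_square fact_numeral diff_divide_distrib)
qed (simp add: has_bochner_integral_zero)

lemma incr_exp:
  assumes "0 \<le> s" "s \<le> t"
  shows "has_bochner_integral M (\<lambda>\<omega>. exp (c * (W t \<omega> - W s \<omega>))) (exp (c\<^sup>2 * (t - s) / 2))"
proof (cases "s = t")
  case False
  then have p: "t - s > 0" using assms by simp
  have "has_bochner_integral lborel (normal_density (c * (t - s)) (sqrt (t - s))) 1"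
    using p by (auto simp: has_bochner_integral_iff)
  then have "has_bochner_integral lborel (\<lambda>y. exp (c\<^sup>2 * (t - s) / 2) * normal_density (c * (t - s)) (sqrt (t - s)) y)
    (exp (c\<^sup>2 * (t - s) / 2) * 1)" by (intro has_bochner_integral_mult_right)
  then show ?thesis
    using assms p by (intro incr_has_integral[where g="\<lambda>y. exp (c * y)"]) (auto simp: normal_density_exp_shift)
qed (use prob_space in \<open>simp add: has_bochner_integral_iff\<close>)

lemma incr_exp_mult:
  assumes "0 \<le> s" "s \<le> t"
  shows "has_bochner_integral M (\<lambda>\<omega>. exp (c * (W t \<omega> - W s \<omega>)) * (W t \<omega> - W s \<omega>))
    (c * (t - s) * exp (c\<^sup>2 * (t - s) / 2))"
proof (cases "s = t")
  case False
  then have p: "t - s > 0" using assms by simp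
  have "has_bochner_integral lborel (\<lambda>y. exp (c\<^sup>2 * (t - s) / 2) * (normal_density (c * (t - s)) (sqrt (t - s)) y * y))
    (exp (c\<^sup>2 * (t - s) / 2) * (c * (t - s)))"
    using p by (intro has_bochner_integral_mult_right normal_moment_nz_1) auto
  then have "has_bochner_integral lborel (\<lambda>y. normal_density 0 (sqrt (t - s)) y * (exp (c * y) * y))
    (exp (c\<^sup>2 * (t - s) / 2) * (c * (t - s)))"
    unfolding mult.assoc[symmetric] normal_density_exp_shift[OF p] .
  then show ?thesis
    using assms p incr_has_integral[where g="\<lambda>y. exp (c * y) * y" and s=s and t=t] by (simp add: mult_ac)
qed (simp add: has_bochner_integral_zero)

section \<open>Discrete versions of the Ito isometry, the stochastic exponential and Girsanov's
  theorem\<close>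

text \<open>The next increment is centred and independent of the past, so its product with
  \<open>V L * h L\<close> has mean 0, and the induction step adds only the mean of
  \<open>(h L \<omega>)\<^sup>2\<close> times the length of the step.\<close>

lemma discrete_integral:
  assumes s: "\<And>k. 0 \<le> s k" "\<And>k. s k \<le> s (Suc k)"
    and h: "\<And>k. h k \<in> borel_measurable (F (s k))" "\<And>k \<omega>. \<omega> \<in> space M \<Longrightarrow> \<bar>h k \<omega>\<bar> \<le> C"
  defines "V L \<omega> \<equiv> \<Sum>k<L. h k \<omega> * (W (s (Suc k)) \<omega> - W (s k) \<omega>)"
  shows discrete_integral_F: "V L \<in> borel_measurable (F (s L))"
    and discrete_integral_square: "has_bochner_integral M (\<lambda>\<omega>. (V L \<omega>)\<^sup>2) (\<Sum>k<L. (\<integral>\<omega>. (h k \<omega>)\<^sup>2 \<partial>M) * (s (Suc k) - s k))"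
    and discrete_integral_orth: "Y \<in> borel_measurable (F (s 0)) \<Longrightarrow> integrable M (\<lambda>\<omega>. (Y \<omega>)\<^sup>2) \<Longrightarrow>
      has_bochner_integral M (\<lambda>\<omega>. Y \<omega> * V L \<omega>) 0"
proof -
  let ?D = "\<lambda>k \<omega>. W (s (Suc k)) \<omega> - W (s k) \<omega>"
  have sm: "s k \<le> s l" if "k \<le> l" for k l by (rule lift_Suc_mono_le[of s, OF s(2) that])
  have D_F: "?D k \<in> borel_measurable (F (s (Suc k)))" for k
    by (intro borel_measurable_diff W_F F_mono[OF s(1) s(2) W_F[OF s(1)]] s(1))
  show VF: "V L \<in> borel_measurable (F (s L))" for L
    unfolding V_def
    by (intro borel_measurable_sum borel_measurable_times F_mono[OF s(1) sm h(1)] F_mono[OF s(1) sm D_F]) auto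
  have hM: "h k \<in> borel_measurable M" for k using F_M[OF s(1) h(1)] .
  have h2: "integrable M (\<lambda>\<omega>. (h k \<omega>)\<^sup>2)" for k
    by (rule integrable_const_bound[where B="C\<^sup>2"])
       (use h(2) hM in \<open>auto intro!: AE_I2 simp: abs_le_square_iff[symmetric] intro: order_trans[OF _ abs_ge_self]\<close>)
  show V2: "has_bochner_integral M (\<lambda>\<omega>. (V L \<omega>)\<^sup>2) (\<Sum>k<L. (\<integral>\<omega>. (h k \<omega>)\<^sup>2 \<partial>M) * (s (Suc k) - s k))" for L
  proof (induction L)
    case 0
    then show ?case by (simp add: V_def has_bochner_integral_zero)
  next
    case (Suc L)
    have i: "integrable M (\<lambda>\<omega>. V L \<omega> * h L \<omega>)"
      using Suc hM h2 F_M[OF s(1) VF] by (intro integrable_square_mult) (auto dest: integrable.intros)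
    have "(\<lambda>\<omega>. V L \<omega> * h L \<omega>) \<in> borel_measurable (F (s L))" using VF h(1) by simp
    from incr_mult_has_integral[where g="\<lambda>y. y", OF s(1) s(2) this i _ incr_mean[OF s(1) s(2)]]
    have 1: "has_bochner_integral M (\<lambda>\<omega>. V L \<omega> * h L \<omega> * ?D L \<omega>) 0" by simp
    have "(\<lambda>\<omega>. (h L \<omega>)\<^sup>2) \<in> borel_measurable (F (s L))" using h(1) by simp
    from incr_mult_has_integral[where g="\<lambda>y. y\<^sup>2", OF s(1) s(2) this h2 _ incr_square[OF s(1) s(2)]]
    have 2: "has_bochner_integral M (\<lambda>\<omega>. (h L \<omega>)\<^sup>2 * (?D L \<omega>)\<^sup>2) ((\<integral>\<omega>. (h L \<omega>)\<^sup>2 \<partial>M) * (s (Suc L) - s L))"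
      by simp
    have "has_bochner_integral M (\<lambda>\<omega>. (V L \<omega>)\<^sup>2 + (2 * (V L \<omega> * h L \<omega> * ?D L \<omega>) + (h L \<omega>)\<^sup>2 * (?D L \<omega>)\<^sup>2))
      ((\<Sum>k<L. (\<integral>\<omega>. (h k \<omega>)\<^sup>2 \<partial>M) * (s (Suc k) - s k)) + (2 * 0 + (\<integral>\<omega>. (h L \<omega>)\<^sup>2 \<partial>M) * (s (Suc L) - s L)))"
      by (intro has_bochner_integral_add has_bochner_integral_mult_right Suc 1 2)
    moreover have "(V (Suc L) \<omega>)\<^sup>2 = (V L \<omega>)\<^sup>2 + (2 * (V L \<omega> * h L \<omega> * ?D L \<omega>) + (h L \<omega>)\<^sup>2 * (?D L \<omega>)\<^sup>2)" for \<omega>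
      by (simp add: V_def power2_eq_square algebra_simps)
    ultimately show ?case by simp
  qed
  assume Y: "Y \<in> borel_measurable (F (s 0))" "integrable M (\<lambda>\<omega>. (Y \<omega>)\<^sup>2)"
  have "has_bochner_integral M (\<lambda>\<omega>. Y \<omega> * h k \<omega> * ?D k \<omega>) 0" for k
  proof -
    have "integrable M (\<lambda>\<omega>. Y \<omega> * h k \<omega>)"
      using Y hM h2 F_M[OF s(1) Y(1)] by (intro integrable_square_mult) auto
    moreover have "(\<lambda>\<omega>. Y \<omega> * h k \<omega>) \<in> borel_measurable (F (s k))"
      using F_mono[OF s(1) sm Y(1), of k] h(1) by simp
    ultimately show ?thesis
      using incr_mult_has_integral[where g="\<lambda>y. y", OF s(1) s(2) _ _ _ incr_mean[OF s(1) s(2)], of "\<lambda>\<omega>. Y \<omega> * h k \<omega>" k]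
      by simp
  qed
  then have "has_bochner_integral M (\<lambda>\<omega>. \<Sum>k<L. Y \<omega> * h k \<omega> * ?D k \<omega>) (\<Sum>k<L. 0)"
    by (intro has_bochner_integral_sum)
  then show "has_bochner_integral M (\<lambda>\<omega>. Y \<omega> * V L \<omega>) 0"
    by (simp add: V_def sum_distrib_left mult.assoc)
qed

text \<open>The normalised exponential has mean 1 and, used as a density, gives the increment the
  mean \<open>c * (t - s)\<close>; a factor \<open>Y\<close> from the past passes through. These are
  the induction steps of \<open>discrete_exp\<close> and \<open>discrete_girsanov\<close>.\<close>

lemma exp_step:
  assumes "0 \<le> s" "s \<le> t" "Y \<in> borel_measurable (F s)" "integrable M Y"
  shows "has_bochner_integral M (\<lambda>\<omega>. Y \<omega> * exp (c * (W t \<omega> - W s \<omega>) - c\<^sup>2 * (t - s) / 2)) (\<integral>\<omega>. Y \<omega> \<partial>M)"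
    and "has_bochner_integral M (\<lambda>\<omega>. Y \<omega> * (exp (c * (W t \<omega> - W s \<omega>) - c\<^sup>2 * (t - s) / 2) * (W t \<omega> - W s \<omega>)))
      (c * (t - s) * (\<integral>\<omega>. Y \<omega> \<partial>M))"
proof -
  let ?k = "exp (c\<^sup>2 * (t - s) / 2)"
  have "has_bochner_integral M (\<lambda>\<omega>. Y \<omega> * exp (c * (W t \<omega> - W s \<omega>))) ((\<integral>\<omega>. Y \<omega> \<partial>M) * ?k)"
    using incr_mult[OF assms, of "\<lambda>y. exp (c * y)"] incr_exp[OF assms(1,2), of c]
    by (simp add: has_bochner_integral_iff)
  from has_bochner_integral_divide[OF this, of ?k]
  show "has_bochner_integral M (\<lambda>\<omega>. Y \<omega> * exp (c * (W t \<omega> - W s \<omega>) - c\<^sup>2 * (t - s) / 2)) (\<integral>\<omega>. Y \<omega> \<partial>M)"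
    by (simp add: exp_diff)
  have "has_bochner_integral M (\<lambda>\<omega>. Y \<omega> * (exp (c * (W t \<omega> - W s \<omega>)) * (W t \<omega> - W s \<omega>)))
     ((\<integral>\<omega>. Y \<omega> \<partial>M) * (c * (t - s) * ?k))"
    using incr_mult[OF assms, of "\<lambda>y. exp (c * y) * y"] incr_exp_mult[OF assms(1,2), of c]
    by (simp add: has_bochner_integral_iff)
  from has_bochner_integral_divide[OF this, of ?k]
  show "has_bochner_integral M (\<lambda>\<omega>. Y \<omega> * (exp (c * (W t \<omega> - W s \<omega>) - c\<^sup>2 * (t - s) / 2) * (W t \<omega> - W s \<omega>)))
      (c * (t - s) * (\<integral>\<omega>. Y \<omega> \<partial>M))"
    by (simp add: exp_diff mult_ac)
qed

text \<open>\<open>Z \<psi> L\<close> is the stochastic exponential of a deterministic step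
  integrand. Its square is the exponential for the doubled integrand times a constant, which reduces
  the second moment to the mean.\<close>

lemma discrete_exp:
  assumes s: "\<And>k. 0 \<le> s k" "\<And>k. s k \<le> s (Suc k)"
  defines "Z \<psi> L \<omega> \<equiv> exp (\<Sum>k<L. \<psi> k * (W (s (Suc k)) \<omega> - W (s k) \<omega>) - (\<psi> k)\<^sup>2 * (s (Suc k) - s k) / 2)"
  shows discrete_exp_F: "Z \<psi> L \<in> borel_measurable (F (s L))"
    and discrete_exp_mean: "has_bochner_integral M (Z \<psi> L) 1"
    and discrete_exp_square: "has_bochner_integral M (\<lambda>\<omega>. (Z \<psi> L \<omega>)\<^sup>2) (exp (\<Sum>k<L. (\<psi> k)\<^sup>2 * (s (Suc k) - s k)))"
proof -
  let ?D = "\<lambda>k \<omega>. W (s (Suc k)) \<omega> - W (s k) \<omega>"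
  have sm: "s k \<le> s l" if "k \<le> l" for k l by (rule lift_Suc_mono_le[of s, OF s(2) that])
  have D_F: "?D k \<in> borel_measurable (F (s (Suc k)))" for k
    by (intro borel_measurable_diff W_F F_mono[OF s(1) s(2) W_F[OF s(1)]] s(1))
  have D_F': "?D k \<in> borel_measurable (F (s L))" if "k < L" for k L
    by (rule F_mono[OF s(1) sm D_F]) (use that in auto)
  show ZF: "Z \<psi> L \<in> borel_measurable (F (s L))" for \<psi> L
    unfolding Z_def
    by (intro measurable_compose[OF _ borel_measurable_exp] borel_measurable_sum borel_measurable_diff borel_measurable_times borel_measurable_const D_F') auto
  show Z1: "has_bochner_integral M (Z \<psi> L) 1" for \<psi> L
  proof (induction L)
    case 0
    then show ?case using prob_space by (simp add: Z_def[abs_def] has_bochner_integral_iff)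
  next
    case (Suc L)
    have "Z \<psi> (Suc L) = (\<lambda>\<omega>. Z \<psi> L \<omega> * exp (\<psi> L * ?D L \<omega> - (\<psi> L)\<^sup>2 * (s (Suc L) - s L) / 2))"
      by (simp add: Z_def[abs_def] exp_add)
    then show ?case
      using exp_step(1)[OF s(1) s(2) ZF[of \<psi> L], of "\<psi> L"] Suc by (simp add: has_bochner_integral_iff)
  qed
  have "(Z \<psi> L \<omega>)\<^sup>2 = Z (\<lambda>k. 2 * \<psi> k) L \<omega> * exp (\<Sum>k<L. (\<psi> k)\<^sup>2 * (s (Suc k) - s k))" for \<omega>
    unfolding Z_def exp_double[symmetric] exp_add[symmetric] sum_distrib_left sum.distrib[symmetric]
    by (intro arg_cong[where f=exp] sum.cong) (auto simp: power2_eq_square field_simps)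
  then show "has_bochner_integral M (\<lambda>\<omega>. (Z \<psi> L \<omega>)\<^sup>2) (exp (\<Sum>k<L. (\<psi> k)\<^sup>2 * (s (Suc k) - s k)))"
    using has_bochner_integral_mult_left[OF Z1[of "\<lambda>k. 2 * \<psi> k" L], of "exp (\<Sum>k<L. (\<psi> k)\<^sup>2 * (s (Suc k) - s k))"]
    by simp
qed

text \<open>Under the density \<open>Z L\<close> the increment with index \<open>k\<close> acquires
  the drift \<open>\<psi> k * (s (Suc k) - s k)\<close>. As \<open>\<psi>\<close> is deterministic,
  \<open>Z L\<close> has a second moment, so its products with square-integrable factors are
  integrable.\<close>

lemma discrete_girsanov:
  fixes s \<psi> :: "nat \<Rightarrow> real"
  assumes s: "\<And>k. 0 \<le> s k" "\<And>k. s k \<le> s (Suc k)"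
    and h: "\<And>k. h k \<in> borel_measurable (F (s k))" "\<And>k \<omega>. \<omega> \<in> space M \<Longrightarrow> \<bar>h k \<omega>\<bar> \<le> C"
  defines "Z L \<omega> \<equiv> exp (\<Sum>k<L. \<psi> k * (W (s (Suc k)) \<omega> - W (s k) \<omega>) - (\<psi> k)\<^sup>2 * (s (Suc k) - s k) / 2)"
  shows "has_bochner_integral M (\<lambda>\<omega>. Z L \<omega> * (\<Sum>k<L. h k \<omega> * (W (s (Suc k)) \<omega> - W (s k) \<omega>)))
     (\<integral>\<omega>. Z L \<omega> * (\<Sum>k<L. h k \<omega> * (\<psi> k * (s (Suc k) - s k))) \<partial>M)"
proof -
  let ?D = "\<lambda>k \<omega>. W (s (Suc k)) \<omega> - W (s k) \<omega>"
  define V where "V L \<omega> = (\<Sum>k<L. h k \<omega> * ?D k \<omega>)" for L \<omega>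
  have sm: "s k \<le> s l" if "k \<le> l" for k l by (rule lift_Suc_mono_le[of s, OF s(2) that])
  have ZF: "Z L \<in> borel_measurable (F (s L))" and Z2: "integrable M (\<lambda>\<omega>. (Z L \<omega>)\<^sup>2)" for L
    unfolding Z_def using discrete_exp_F[where s=s, OF s] discrete_exp_square[where s=s, OF s, THEN integrable.intros] by blast+
  have VF: "V L \<in> borel_measurable (F (s L))" and V2: "integrable M (\<lambda>\<omega>. (V L \<omega>)\<^sup>2)" for L
    unfolding V_def using discrete_integral_F[where s=s and h=h, OF s h] discrete_integral_square[where s=s and h=h, OF s h, THEN integrable.intros] by blast+
  have hM: "h k \<in> borel_measurable M" for k using F_M[OF s(1) h(1)] .
  have h2: "integrable M (\<lambda>\<omega>. (h k \<omega>)\<^sup>2)" for k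
    by (rule integrable_const_bound[where B="C\<^sup>2"])
       (use h(2) hM in \<open>auto intro!: AE_I2 simp: abs_le_square_iff[symmetric] intro: order_trans[OF _ abs_ge_self]\<close>)
  have Zh: "integrable M (\<lambda>\<omega>. Z L \<omega> * h k \<omega>)" for L k
    by (intro integrable_square_mult F_M[OF s(1) ZF] hM Z2 h2)
  have ZV: "integrable M (\<lambda>\<omega>. Z L \<omega> * V L \<omega>)" for L
    by (intro integrable_square_mult F_M[OF s(1) ZF] F_M[OF s(1) VF] Z2 V2)
  have ZS: "Z (Suc L) \<omega> = Z L \<omega> * exp (\<psi> L * ?D L \<omega> - (\<psi> L)\<^sup>2 * (s (Suc L) - s L) / 2)" for L \<omega>
    by (simp add: Z_def exp_add)
  have Zhs: "(\<integral>\<omega>. Z (Suc L) \<omega> * h k \<omega> \<partial>M) = (\<integral>\<omega>. Z L \<omega> * h k \<omega> \<partial>M)" if "k \<le> L" for k L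
  proof -
    have "(\<lambda>\<omega>. Z L \<omega> * h k \<omega>) \<in> borel_measurable (F (s L))"
      using F_mono[OF s(1) sm[OF that] h(1)] ZF by simp
    from exp_step(1)[OF s(1) s(2) this Zh, of "\<psi> L"] show ?thesis
      by (simp add: ZS has_bochner_integral_iff mult_ac)
  qed
  have "has_bochner_integral M (\<lambda>\<omega>. Z L \<omega> * V L \<omega>) (\<Sum>k<L. \<psi> k * (s (Suc k) - s k) * (\<integral>\<omega>. Z L \<omega> * h k \<omega> \<partial>M))"
  proof (induction L)
    case 0
    then show ?case by (simp add: V_def has_bochner_integral_zero)
  next
    case (Suc L)
    have m: "(\<lambda>\<omega>. Z L \<omega> * V L \<omega>) \<in> borel_measurable (F (s L))"
      "(\<lambda>\<omega>. Z L \<omega> * h L \<omega>) \<in> borel_measurable (F (s L))"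
      using ZF VF h(1) by simp_all
    have "has_bochner_integral M (\<lambda>\<omega>. Z (Suc L) \<omega> * V L \<omega> + Z (Suc L) \<omega> * h L \<omega> * ?D L \<omega>)
      ((\<integral>\<omega>. Z L \<omega> * V L \<omega> \<partial>M) + \<psi> L * (s (Suc L) - s L) * (\<integral>\<omega>. Z L \<omega> * h L \<omega> \<partial>M))"
      using has_bochner_integral_add[OF exp_step(1)[OF s(1) s(2) m(1) ZV, of "\<psi> L"]
        exp_step(2)[OF s(1) s(2) m(2) Zh, of "\<psi> L"]]
      by (simp add: ZS mult_ac)
    moreover have "(\<integral>\<omega>. Z L \<omega> * V L \<omega> \<partial>M) = (\<Sum>k<L. \<psi> k * (s (Suc k) - s k) * (\<integral>\<omega>. Z L \<omega> * h k \<omega> \<partial>M))"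
      using Suc by (simp add: has_bochner_integral_iff)
    ultimately show ?case
      by (simp add: V_def distrib_left mult.assoc Zhs)
  qed
  moreover have "(\<integral>\<omega>. Z L \<omega> * (\<Sum>k<L. h k \<omega> * (\<psi> k * (s (Suc k) - s k))) \<partial>M)
      = (\<Sum>k<L. \<psi> k * (s (Suc k) - s k) * (\<integral>\<omega>. Z L \<omega> * h k \<omega> \<partial>M))"
  proof -
    have "(\<integral>\<omega>. Z L \<omega> * (\<Sum>k<L. h k \<omega> * (\<psi> k * (s (Suc k) - s k))) \<partial>M)
      = (\<integral>\<omega>. (\<Sum>k<L. (Z L \<omega> * h k \<omega>) * (\<psi> k * (s (Suc k) - s k))) \<partial>M)"
      by (simp add: sum_distrib_left mult.assoc)
    also have "\<dots> = (\<Sum>k<L. (\<integral>\<omega>. Z L \<omega> * h k \<omega> \<partial>M) * (\<psi> k * (s (Suc k) - s k)))"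
      using Zh by simp
    finally show ?thesis by (simp add: mult.commute)
  qed
  ultimately show ?thesis by (simp add: V_def)
qed

end

section \<open>Maximal inequalities and the growth of Brownian paths\<close>

lemma grid_refine: "grid a b (2 ^ Suc p) (2 * k) = grid a b (2 ^ p) k"
  by (simp add: grid_def field_simps)

lemma grid_dense:
  assumes "a \<le> t" "t \<le> b" "d > 0"
  shows "\<exists>p k. k \<le> 2 ^ p \<and> grid a b (2 ^ p) k \<in> {a..b} \<and> \<bar>grid a b (2 ^ p) k - t\<bar> < d"
proof (cases "a = b")
  case True
  then show ?thesis using assms by (intro exI[of _ 0]) (auto simp: grid_def)
next
  case False
  then have ab: "a < b" using assms by simp
  obtain p where p: "(b - a) / d < 2 ^ p" using real_arch_pow[of 2 "(b - a) / d"] by auto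
  define m where "m = (b - a) / 2 ^ p"
  have m: "m > 0" "m < d" using ab p assms(3) by (auto simp: m_def field_simps)
  define k where "k = nat \<lfloor>(t - a) / m\<rfloor>"
  have rk: "real k \<le> (t - a) / m" "(t - a) / m < real k + 1"
    using m assms by (auto simp: k_def)
  have "real k * m \<le> t - a" "t - a < (real k + 1) * m"
    using rk m by (auto simp: field_simps)
  then have *: "real k * m \<le> t - a" "t - a - real k * m < d" using m by (auto simp: algebra_simps)
  have "grid a b (2 ^ p) k = a + real k * m" by (simp add: grid_def m_def)
  moreover have "k \<le> 2 ^ p"
  proof -
    have "real k * m \<le> 2 ^ p * m" using * assms by (simp add: m_def)
    then have "real k \<le> 2 ^ p" using m by simp
    then show ?thesis by (metis of_nat_le_iff of_nat_numeral of_nat_power)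
  qed
  moreover have "0 \<le> real k * m" using m by simp
  ultimately show ?thesis using * assms
    by (intro exI[of _ p] exI[of _ k]) auto
qed

context brownian_space
begin

text \<open>Doob's maximal inequality, by splitting according to the first index at which the level
  is exceeded. The submartingale property enters as inequalities between integrals over past events,
  without conditional expectations.\<close>

lemma maximal_discrete:
  assumes s: "\<And>k. 0 \<le> s k" "\<And>k. s k \<le> s (Suc k)"
    and U: "\<And>k. k \<le> N \<Longrightarrow> U k \<in> borel_measurable (F (s k))" "\<And>k \<omega>. k \<le> N \<Longrightarrow> \<omega> \<in> space M \<Longrightarrow> 0 \<le> U k \<omega>"
      "\<And>k. k \<le> N \<Longrightarrow> integrable M (U k)"
    and sub: "\<And>k A. k \<le> N \<Longrightarrow> A \<in> sets (F (s k)) \<Longrightarrow>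
      (\<integral>\<omega>. indicator A \<omega> * U k \<omega> \<partial>M) \<le> (\<integral>\<omega>. indicator A \<omega> * U N \<omega> \<partial>M)"
    and a: "a > (0::real)"
  shows "a * prob {\<omega>\<in>space M. \<exists>k\<le>N. a < U k \<omega>} \<le> (\<integral>\<omega>. U N \<omega> \<partial>M)"
proof -
  have sm: "s k \<le> s l" if "k \<le> l" for k l by (rule lift_Suc_mono_le[of s, OF s(2) that])
  define A where "A k = {\<omega>\<in>space M. a < U k \<omega> \<and> (\<forall>j<k. U j \<omega> \<le> a)}" for k
  have AF: "A k \<in> sets (F (s k))" if k: "k \<le> N" for k
  proof -
    have Uj: "U j \<in> borel_measurable (F (s k))" if "j \<le> k" for j
      using F_mono[OF s(1) sm[OF that] U(1)] that k by simp
    have "{\<omega>\<in>space (F (s k)). a < U k \<omega> \<and> (\<forall>j\<in>{..<k}. U j \<omega> \<le> a)} \<in> sets (F (s k))"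
      by (intro sets.sets_Collect_conj sets.sets_Collect_finite_All borel_measurable_less borel_measurable_le
          borel_measurable_const Uj) auto
    then show ?thesis by (simp add: A_def space_F[OF s(1)] Ball_def)
  qed
  have AM: "A k \<in> sets M" if "k \<le> N" for k using sets_F_M[OF s(1) AF[OF that]] .
  have disj: "disjoint_family_on A {..N}"
    unfolding disjoint_family_on_def A_def by (auto, metis linorder_neqE_nat not_less)
  have un: "{\<omega>\<in>space M. \<exists>k\<le>N. a < U k \<omega>} = (\<Union>k\<in>{..N}. A k)"
  proof (intro equalityI subsetI)
    fix \<omega> assume w: "\<omega> \<in> {\<omega>\<in>space M. \<exists>k\<le>N. a < U k \<omega>}"
    define k where "k = (LEAST k. a < U k \<omega>)"
    obtain k0 where k0: "k0 \<le> N" "a < U k0 \<omega>" using w by auto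
    have "a < U k \<omega>" unfolding k_def using k0(2) by (rule LeastI)
    moreover have "k \<le> k0" unfolding k_def using k0(2) by (rule Least_le)
    moreover have "U j \<omega> \<le> a" if "j < k" for j
      using not_less_Least[of j "\<lambda>k. a < U k \<omega>"] that unfolding k_def by auto
    ultimately show "\<omega> \<in> (\<Union>k\<in>{..N}. A k)" using w k0(1) by (auto simp: A_def intro!: bexI[of _ k])
  qed (auto simp: A_def)
  have step: "a * prob (A k) \<le> (\<integral>\<omega>. indicator (A k) \<omega> * U N \<omega> \<partial>M)" if k: "k \<le> N" for k
  proof -
    have "a * prob (A k) = (\<integral>\<omega>. indicator (A k) \<omega> * a \<partial>M)" using AM[OF k] by simp
    also have "\<dots> \<le> (\<integral>\<omega>. indicator (A k) \<omega> * U k \<omega> \<partial>M)"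
    proof (rule integral_mono)
      show "integrable M (\<lambda>\<omega>. indicator (A k) \<omega> * a)" using AM[OF k] by (simp add: less_top[symmetric])
      show "integrable M (\<lambda>\<omega>. indicator (A k) \<omega> * U k \<omega>)"
        using integrable_mult_indicator[OF AM[OF k] U(3)[OF k]] by simp
    qed (auto simp: A_def indicator_def)
    also have "\<dots> \<le> (\<integral>\<omega>. indicator (A k) \<omega> * U N \<omega> \<partial>M)" by (rule sub[OF k AF[OF k]])
    finally show ?thesis .
  qed
  have i: "integrable M (\<lambda>\<omega>. indicator (A k) \<omega> * U N \<omega>)" if "k \<le> N" for k
    using integrable_mult_indicator[OF AM[OF that] U(3)[of N]] by simp
  have "a * prob {\<omega>\<in>space M. \<exists>k\<le>N. a < U k \<omega>} = (\<Sum>k\<le>N. a * prob (A k))"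
    unfolding un sum_distrib_left[symmetric]
    by (subst finite_measure_finite_Union[OF _ _ disj]) (use AM in auto)
  also have "\<dots> \<le> (\<Sum>k\<le>N. (\<integral>\<omega>. indicator (A k) \<omega> * U N \<omega> \<partial>M))"
    by (intro sum_mono step) auto
  also have "\<dots> = (\<integral>\<omega>. (\<Sum>k\<le>N. indicator (A k) \<omega> * U N \<omega>) \<partial>M)"
    using i by (intro Bochner_Integration.integral_sum[symmetric]) auto
  also have "\<dots> \<le> (\<integral>\<omega>. U N \<omega> \<partial>M)"
  proof (rule integral_mono)
    show "integrable M (\<lambda>\<omega>. \<Sum>k\<le>N. indicator (A k) \<omega> * U N \<omega>)"
      by (intro Bochner_Integration.integrable_sum i) simp
    fix \<omega> assume w: "\<omega> \<in> space M"
    have "(\<Sum>k\<le>N. indicator (A k) \<omega> :: real) = indicator (\<Union>k\<in>{..N}. A k) \<omega>"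
      using indicator_UN_disjoint[OF finite_atMost disj] by metis
    then have "(\<Sum>k\<le>N. indicator (A k) \<omega> * U N \<omega>) = indicator (\<Union>k\<in>{..N}. A k) \<omega> * U N \<omega>"
      by (simp only: sum_distrib_right[symmetric])
    moreover have "indicator (\<Union>k\<in>{..N}. A k) \<omega> * U N \<omega> \<le> U N \<omega>"
      using U(2)[OF order_refl w] by (cases "\<omega> \<in> (\<Union>k\<in>{..N}. A k)") auto
    ultimately show "(\<Sum>k\<le>N. indicator (A k) \<omega> * U N \<omega>) \<le> U N \<omega>" by linarith
  qed (use U in auto)
  finally show ?thesis .
qed

text \<open>Dyadic grids are nested and dense, and by path continuity a strict exceedance persists
  on a neighbourhood, hence is seen on some grid. The event is thus an increasing union of discrete
  ones, which gives its measurability and the limit of the discrete bounds.\<close>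

lemma maximal_continuous:
  assumes ST: "0 \<le> S" "S \<le> T"
    and U: "\<And>t. S \<le> t \<Longrightarrow> t \<le> T \<Longrightarrow> U t \<in> borel_measurable (F t)"
      "\<And>t \<omega>. S \<le> t \<Longrightarrow> t \<le> T \<Longrightarrow> \<omega> \<in> space M \<Longrightarrow> 0 \<le> U t \<omega>"
      "\<And>t. S \<le> t \<Longrightarrow> t \<le> T \<Longrightarrow> integrable M (U t)"
      "\<And>\<omega>. \<omega> \<in> space M \<Longrightarrow> continuous_on {S..T} (\<lambda>t. U t \<omega>)"
    and sub: "\<And>t A. S \<le> t \<Longrightarrow> t \<le> T \<Longrightarrow> A \<in> sets (F t) \<Longrightarrow>
      (\<integral>\<omega>. indicator A \<omega> * U t \<omega> \<partial>M) \<le> (\<integral>\<omega>. indicator A \<omega> * U T \<omega> \<partial>M)"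
    and a: "a > (0::real)"
  shows "{\<omega>\<in>space M. \<exists>t\<in>{S..T}. a < U t \<omega>} \<in> sets M"
    and "a * prob {\<omega>\<in>space M. \<exists>t\<in>{S..T}. a < U t \<omega>} \<le> (\<integral>\<omega>. U T \<omega> \<partial>M)"
proof -
  let ?g = "\<lambda>p k. grid S T (2 ^ p) k"
  define B where "B p = {\<omega>\<in>space M. \<exists>k\<le>2 ^ p. a < U (?g p k) \<omega>}" for p
  have gr: "S \<le> ?g p k" "?g p k \<le> T" if "k \<le> 2 ^ p" for p k
    using grid_ge[OF ST(2)] grid_le[OF ST(2) that] by auto
  have UM: "U t \<in> borel_measurable M" if "S \<le> t" "t \<le> T" for t
    using F_M[OF _ U(1)[OF that]] ST that by simp
  have BM: "B p \<in> sets M" for p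
  proof -
    have "{\<omega>\<in>space M. \<exists>k\<in>{..2^p}. a < U (?g p k) \<omega>} \<in> sets M"
    proof (rule sets.sets_Collect_finite_Ex)
      fix k :: nat assume "k \<in> {..2 ^ p}"
      then show "{\<omega>\<in>space M. a < U (?g p k) \<omega>} \<in> sets M"
        by (intro borel_measurable_less borel_measurable_const UM gr) simp_all
    qed simp
    then show ?thesis by (simp only: B_def Bex_def atMost_iff)
  qed
  have inc: "incseq B"
  proof (rule incseq_SucI, rule subsetI)
    fix p \<omega> assume "\<omega> \<in> B p"
    then obtain k where k: "\<omega> \<in> space M" "k \<le> 2 ^ p" "a < U (?g p k) \<omega>" by (auto simp: B_def)
    then show "\<omega> \<in> B (Suc p)"
      unfolding B_def using grid_refine[of S T p k] by (auto intro!: exI[of _ "2 * k"])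
  qed
  have un: "{\<omega>\<in>space M. \<exists>t\<in>{S..T}. a < U t \<omega>} = (\<Union>p. B p)"
  proof (intro equalityI subsetI)
    fix \<omega> assume "\<omega> \<in> {\<omega>\<in>space M. \<exists>t\<in>{S..T}. a < U t \<omega>}"
    then obtain t where t: "\<omega> \<in> space M" "S \<le> t" "t \<le> T" "a < U t \<omega>" by auto
    have "\<exists>d>0. \<forall>t'\<in>{S..T}. dist t' t < d \<longrightarrow> dist (U t' \<omega>) (U t \<omega>) < U t \<omega> - a"
      using U(4)[OF t(1)] t unfolding continuous_on_iff by (metis atLeastAtMost_iff diff_gt_0_iff_gt)
    then obtain d where d: "d > 0" "\<And>t'. t' \<in> {S..T} \<Longrightarrow> \<bar>t' - t\<bar> < d \<Longrightarrow> \<bar>U t' \<omega> - U t \<omega>\<bar> < U t \<omega> - a"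
      by (auto simp: dist_real_def)
    obtain p k where pk: "k \<le> 2 ^ p" "?g p k \<in> {S..T}" "\<bar>?g p k - t\<bar> < d"
      using grid_dense[OF t(2,3) d(1)] by blast
    have "a < U (?g p k) \<omega>" using d(2)[OF pk(2,3)] by linarith
    then show "\<omega> \<in> (\<Union>p. B p)" using t pk by (auto simp: B_def)
  next
    fix \<omega> assume "\<omega> \<in> (\<Union>p. B p)"
    then obtain p k where "\<omega> \<in> space M" "k \<le> 2 ^ p" "a < U (?g p k) \<omega>" by (auto simp: B_def)
    then show "\<omega> \<in> {\<omega>\<in>space M. \<exists>t\<in>{S..T}. a < U t \<omega>}" using gr[of k p] by auto
  qed
  show "{\<omega>\<in>space M. \<exists>t\<in>{S..T}. a < U t \<omega>} \<in> sets M"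
    unfolding un using BM by auto
  have "a * prob (B p) \<le> (\<integral>\<omega>. U T \<omega> \<partial>M)" for p
  proof -
    have last: "?g p (2 ^ p) = T" by (rule grid_last) simp
    have "a * prob {\<omega>\<in>space M. \<exists>k\<le>2 ^ p. a < U (?g p k) \<omega>} \<le> (\<integral>\<omega>. U (?g p (2 ^ p)) \<omega> \<partial>M)"
    proof (rule maximal_discrete[where s="?g p" and U="\<lambda>k. U (?g p k)"])
      show "0 \<le> ?g p k" for k using grid_ge[OF ST(2), of "2 ^ p" k] ST by linarith
      show "?g p k \<le> ?g p (Suc k)" for k by (rule grid_mono[OF ST(2)]) simp
    qed (use gr U(1-3) sub a last in auto)
    then show ?thesis by (simp add: B_def last)
  qed
  moreover have "(\<lambda>p. a * prob (B p)) \<longlonglongrightarrow> a * prob (\<Union>p. B p)"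
    using BM inc by (intro tendsto_intros finite_Lim_measure_incseq) auto
  ultimately show "a * prob {\<omega>\<in>space M. \<exists>t\<in>{S..T}. a < U t \<omega>} \<le> (\<integral>\<omega>. U T \<omega> \<partial>M)"
    unfolding un by (intro LIMSEQ_le_const2) auto
qed

lemma exp_W_integrable:
  assumes "0 \<le> t"
  shows "has_bochner_integral M (\<lambda>\<omega>. exp (c * W t \<omega>)) (exp (c\<^sup>2 * t / 2))"
proof -
  have "has_bochner_integral M (\<lambda>\<omega>. exp (c * (W t \<omega> - W 0 \<omega>))) (exp (c\<^sup>2 * (t - 0) / 2))"
    using assms by (intro incr_exp) auto
  then show ?thesis
    by (rule has_bochner_integral_cong[THEN iffD1, rotated -1]) (auto simp: W_0)
qed

text \<open>Doob's inequality for the submartingale \<open>exp (c * e * W t \<omega>)\<close>; the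
  sign \<open>e\<close> treats both tails at once.\<close>

lemma W_maximal_one_sided:
  assumes T: "T > 0" and a: "a > 0" and e: "e = 1 \<or> e = - (1::real)"
  shows "{\<omega>\<in>space M. \<exists>t\<in>{0..T}. a < e * W t \<omega>} \<in> sets M"
    and "prob {\<omega>\<in>space M. \<exists>t\<in>{0..T}. a < e * W t \<omega>} \<le> exp (- a\<^sup>2 / (2 * T))"
proof -
  \<comment> \<open>The minimiser of the exponent \<open>c\<^sup>2 * T / 2 - c * a\<close> in the
    resulting bound.\<close>
  define c where "c = a / T"
  have c: "c > 0" using T a by (simp add: c_def)
  let ?U = "\<lambda>t \<omega>. exp (c * e * W t \<omega>)"
  have eq: "{\<omega>\<in>space M. \<exists>t\<in>{0..T}. a < e * W t \<omega>} = {\<omega>\<in>space M. \<exists>t\<in>{0..T}. exp (c * a) < ?U t \<omega>}"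
    using c by (simp add: mult.assoc)
  have sub: "(\<integral>\<omega>. indicator A \<omega> * ?U t \<omega> \<partial>M) \<le> (\<integral>\<omega>. indicator A \<omega> * ?U T \<omega> \<partial>M)"
    if t: "0 \<le> t" "t \<le> T" and A: "A \<in> sets (F t)" for t A
  proof -
    let ?Y = "\<lambda>\<omega>. indicator A \<omega> * ?U t \<omega>"
    have Ym: "?Y \<in> borel_measurable (F t)" using A W_F[OF t(1)] by simp
    have Yi: "integrable M ?Y"
      using integrable_mult_indicator[OF sets_F_M[OF t(1) A] integrable.intros[OF exp_W_integrable[OF t(1), of "c * e"]]]
      by simp
    have "has_bochner_integral M (\<lambda>\<omega>. ?Y \<omega> * exp (c * e * (W T \<omega> - W t \<omega>))) ((\<integral>\<omega>. ?Y \<omega> \<partial>M) * exp ((c * e)\<^sup>2 * (T - t) / 2))"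
      by (rule incr_mult_has_integral[OF t Ym Yi _ incr_exp[OF t]]) simp
    moreover have "?Y \<omega> * exp (c * e * (W T \<omega> - W t \<omega>)) = indicator A \<omega> * ?U T \<omega>" for \<omega>
      by (simp add: mult.assoc exp_add[symmetric] algebra_simps)
    ultimately have "(\<integral>\<omega>. indicator A \<omega> * ?U T \<omega> \<partial>M) = (\<integral>\<omega>. ?Y \<omega> \<partial>M) * exp ((c * e)\<^sup>2 * (T - t) / 2)"
      by (simp add: has_bochner_integral_iff)
    moreover have "(\<integral>\<omega>. ?Y \<omega> \<partial>M) * 1 \<le> (\<integral>\<omega>. ?Y \<omega> \<partial>M) * exp ((c * e)\<^sup>2 * (T - t) / 2)"
      using t by (intro mult_left_mono integral_nonneg_AE) auto
    ultimately show ?thesis by simp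
  qed
  have cont: "continuous_on {0..T} (\<lambda>t. ?U t \<omega>)" if "\<omega> \<in> space M" for \<omega>
    using W_continuous_Icc[OF that order_refl] by (intro continuous_intros)
  note mx = maximal_continuous[where U="?U" and S=0 and T=T and a="exp (c * a)", OF order_refl _ _ _ _ cont sub]
  have UF: "?U t \<in> borel_measurable (F t)" if "0 \<le> t" for t using W_F[OF that] by simp
  have Ui: "integrable M (?U t)" if "0 \<le> t" for t using exp_W_integrable[OF that] by (auto dest: integrable.intros)
  show "{\<omega>\<in>space M. \<exists>t\<in>{0..T}. a < e * W t \<omega>} \<in> sets M"
    unfolding eq using T UF Ui by (intro mx(1)) auto
  have "exp (c * a) * prob {\<omega>\<in>space M. \<exists>t\<in>{0..T}. a < e * W t \<omega>} \<le> (\<integral>\<omega>. ?U T \<omega> \<partial>M)"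
    unfolding eq using T UF Ui by (intro mx(2)) auto
  also have "\<dots> = exp (c\<^sup>2 * T / 2)"
    using exp_W_integrable[of T "c * e"] T e by (auto simp: has_bochner_integral_iff)
  finally have "prob {\<omega>\<in>space M. \<exists>t\<in>{0..T}. a < e * W t \<omega>} \<le> exp (c\<^sup>2 * T / 2) / exp (c * a)"
    by (simp add: field_simps)
  also have "\<dots> = exp (c\<^sup>2 * T / 2 - c * a)" by (simp add: exp_diff)
  also have "c\<^sup>2 * T / 2 - c * a = - a\<^sup>2 / (2 * T)"
    using T by (simp add: c_def power2_eq_square field_simps)
  finally show "prob {\<omega>\<in>space M. \<exists>t\<in>{0..T}. a < e * W t \<omega>} \<le> exp (- a\<^sup>2 / (2 * T))" .
qed

lemma W_maximal:
  assumes T: "T > 0" and a: "a > 0"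
  shows "{\<omega>\<in>space M. \<exists>t\<in>{0..T}. a < \<bar>W t \<omega>\<bar>} \<in> sets M"
    and "prob {\<omega>\<in>space M. \<exists>t\<in>{0..T}. a < \<bar>W t \<omega>\<bar>} \<le> 2 * exp (- a\<^sup>2 / (2 * T))"
proof -
  let ?A = "\<lambda>e. {\<omega>\<in>space M. \<exists>t\<in>{0..T}. a < e * W t \<omega>}"
  have eq: "{\<omega>\<in>space M. \<exists>t\<in>{0..T}. a < \<bar>W t \<omega>\<bar>} = ?A 1 \<union> ?A (- 1)"
    using a by (auto simp: abs_if split: if_splits) force+
  have m: "?A 1 \<in> sets M" "?A (- 1) \<in> sets M"
    by (rule W_maximal_one_sided[OF T a]; simp)+
  have p: "prob (?A 1) \<le> exp (- a\<^sup>2 / (2 * T))" "prob (?A (- 1)) \<le> exp (- a\<^sup>2 / (2 * T))"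
    by (rule W_maximal_one_sided[OF T a]; simp)+
  show "{\<omega>\<in>space M. \<exists>t\<in>{0..T}. a < \<bar>W t \<omega>\<bar>} \<in> sets M" unfolding eq using m by blast
  show "prob {\<omega>\<in>space M. \<exists>t\<in>{0..T}. a < \<bar>W t \<omega>\<bar>} \<le> 2 * exp (- a\<^sup>2 / (2 * T))"
    unfolding eq using measure_Un_le[OF m] p by linarith
qed

text \<open>Upper half of the law of the iterated logarithm with a crude constant: maximal bounds on
  \<open>{0..2 ^ k}\<close>, Borel-Cantelli, and interpolation between powers of 2.\<close>

lemma W_loglog_bound: "AE \<omega> in M. eventually (\<lambda>t. (W t \<omega>)\<^sup>2 \<le> 16 * (t * ln (ln t))) at_top"
proof -
  \<comment> \<open>Chosen so that \<open>(a k)\<^sup>2 / (2 * 2 ^ k)\<close> is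
    \<open>2 * ln (real k)\<close>, which makes the tail bound 2 over the square of
    \<open>k\<close>, a summable sequence. Indices start at 2 because
    \<open>a 1 = 0\<close>.\<close>
  define a where "a k = 2 * sqrt (2 ^ k * ln (real k))" for k :: nat
  define E where "E k = {\<omega>\<in>space M. \<exists>t\<in>{0..2 ^ k}. a k < \<bar>W t \<omega>\<bar>}" for k :: nat
  have ap: "a k > 0" if "k \<ge> 2" for k using that by (simp add: a_def)
  have EM: "E (k + 2) \<in> sets M" for k unfolding E_def by (rule W_maximal(1)) (auto intro: ap)
  have Ep: "prob (E (k + 2)) \<le> 2 * inverse (real (k + 2) ^ 2)" for k
  proof -
    let ?k = "k + 2"
    have "prob (E ?k) \<le> 2 * exp (- (a ?k)\<^sup>2 / (2 * 2 ^ ?k))"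
      unfolding E_def by (rule W_maximal(2)) (auto intro: ap)
    also have "- (a ?k)\<^sup>2 / (2 * 2 ^ ?k) = - (2 * ln (real ?k))"
      by (simp add: a_def power_mult_distrib)
    also have "exp (- (2 * ln (real ?k))) = inverse (real ?k ^ 2)"
      by (simp add: exp_minus exp_double)
    finally show ?thesis .
  qed
  have "summable (\<lambda>k. prob (E (k + 2)))"
  proof (rule summable_comparison_test')
    have "summable (\<lambda>k. inverse (real (k + 2) ^ 2))"
      using inverse_power_summable[of 2, where 'a=real] by (rule summable_ignore_initial_segment) simp
    then show "summable (\<lambda>k. 2 * inverse (real (k + 2) ^ 2))" by (rule summable_mult)
  qed (use Ep in auto)
  then have "AE \<omega> in M. eventually (\<lambda>k. \<omega> \<in> space M - E (k + 2)) sequentially"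
    using EM by (intro borel_cantelli_AE1) (auto simp: emeasure_eq_measure)
  then show ?thesis
  proof eventually_elim
    case (elim \<omega>)
    then obtain K where K: "\<And>k. k \<ge> K \<Longrightarrow> \<omega> \<in> space M - E (k + 2)"
      by (auto simp: eventually_sequentially)
    have "eventually (\<lambda>t::real. ln (log 2 t + 1) \<le> 2 * ln (ln t)) at_top" by real_asymp
    moreover have "eventually (\<lambda>t::real. t \<ge> 2 ^ (K + 2)) at_top" by (rule eventually_ge_at_top)
    ultimately show ?case
    proof eventually_elim
      case (elim t)
      have t: "t > 0" by (rule less_le_trans[OF _ elim(2)]) simp
      have lt: "real (K + 2) \<le> log 2 t"
      proof -
        have "2 powr real (K + 2) \<le> t" using elim(2) by (subst powr_realpow) auto
        then show ?thesis using t le_log_iff[of 2 t "real (K + 2)"] by simp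
      qed
      \<comment> \<open>Then \<open>2 ^ k\<close> lies between \<open>t\<close> and
        \<open>2 * t\<close>, and \<open>ln (real k) \<le> 2 * ln (ln t)\<close>. Together with the
        factor 4 in \<open>(a k)\<^sup>2\<close> this produces the constant 16.\<close>
      define k where "k = nat \<lceil>log 2 t\<rceil>"
      have rk: "log 2 t \<le> real k" "real k < log 2 t + 1"
        using lt by (auto simp: k_def) linarith+
      have kK: "k \<ge> K + 2" using lt rk by linarith
      have "log 2 t \<le> log 2 (2 ^ k)" using rk by simp
      then have t2: "t \<le> 2 ^ k" using t by (subst (asm) log_le_cancel_iff) auto
      have "log 2 (2 ^ k) < log 2 (2 * t)" using rk t by (simp add: log_mult)
      then have t3: "2 ^ k < 2 * t" using t by (subst (asm) log_less_cancel_iff) auto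
      have "k - 2 + 2 = k" "k - 2 \<ge> K" using kK by auto
      then have "\<omega> \<in> space M - E k" using K[of "k - 2"] by metis
      then have "\<bar>W t \<omega>\<bar> \<le> a k" using t t2 by (auto simp: E_def not_less)
      then have "(W t \<omega>)\<^sup>2 \<le> (a k)\<^sup>2" by (simp add: abs_le_square_iff[symmetric])
      also have "\<dots> = 4 * (2 ^ k * ln (real k))" using kK by (simp add: a_def power_mult_distrib)
      also have "\<dots> \<le> 4 * ((2 * t) * (2 * ln (ln t)))"
      proof (intro mult_left_mono mult_mono)
        have "ln (real k) \<le> ln (log 2 t + 1)" using rk kK by (subst ln_le_cancel_iff) auto
        then show "ln (real k) \<le> 2 * ln (ln t)" using elim(1) by linarith
      qed (use t3 t kK in auto)
      finally show ?case by simp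
    qed
  qed
qed

text \<open>Here the decay demanded of strategies meets the growth of Brownian paths: the squared
  product is eventually at most 16 times a quantity that tends to 0.\<close>

lemma mult_W_tendsto_0:
  assumes "((\<lambda>t. (f t)\<^sup>2 * t * ln (ln t)) \<longlongrightarrow> 0) at_top"
    and "eventually (\<lambda>t. (W t \<omega>)\<^sup>2 \<le> 16 * (t * ln (ln t))) at_top"
  shows "((\<lambda>t. f t * W t \<omega>) \<longlongrightarrow> 0) at_top"
proof -
  have "((\<lambda>t. (f t * W t \<omega>)\<^sup>2) \<longlongrightarrow> 0) at_top"
  proof (rule tendsto_sandwich[OF _ _ tendsto_const])
    show "eventually (\<lambda>t. 0 \<le> (f t * W t \<omega>)\<^sup>2) at_top" by simp
    show "((\<lambda>t. 16 * ((f t)\<^sup>2 * t * ln (ln t))) \<longlongrightarrow> 0) at_top"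
      using tendsto_mult_left[OF assms(1), of 16] by simp
    show "eventually (\<lambda>t. (f t * W t \<omega>)\<^sup>2 \<le> 16 * ((f t)\<^sup>2 * t * ln (ln t))) at_top"
      using assms(2)
    proof eventually_elim
      case (elim t)
      then have "(f t)\<^sup>2 * (W t \<omega>)\<^sup>2 \<le> (f t)\<^sup>2 * (16 * (t * ln (ln t)))" by (intro mult_left_mono) auto
      then show ?case by (simp add: power_mult_distrib mult_ac)
    qed
  qed
  then have "((\<lambda>t. sqrt ((f t * W t \<omega>)\<^sup>2)) \<longlongrightarrow> sqrt 0) at_top" by (intro tendsto_intros)
  then show ?thesis by (simp add: tendsto_rabs_zero_iff)
qed

end

section \<open>The pathwise stochastic integral\<close>

lemma fatou_square:
  fixes f :: "nat \<Rightarrow> 'a \<Rightarrow> real"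
  assumes m: "\<And>n. f n \<in> borel_measurable M" "g \<in> borel_measurable M"
    and lim: "AE x in M. (\<lambda>n. f n x) \<longlonglongrightarrow> g x"
    and i: "\<And>n. integrable M (\<lambda>x. (f n x)\<^sup>2)" and B: "\<And>n. (\<integral>x. (f n x)\<^sup>2 \<partial>M) \<le> B"
  shows "integrable M (\<lambda>x. (g x)\<^sup>2)" "(\<integral>x. (g x)\<^sup>2 \<partial>M) \<le> B"
proof -
  have B0: "0 \<le> B" by (rule order_trans[OF _ B[of 0]]) (rule integral_nonneg_AE, simp)
  have "(\<integral>\<^sup>+ x. ennreal ((g x)\<^sup>2) \<partial>M) = (\<integral>\<^sup>+ x. liminf (\<lambda>n. ennreal ((f n x)\<^sup>2)) \<partial>M)"
  proof (rule nn_integral_cong_AE)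
    show "AE x in M. ennreal ((g x)\<^sup>2) = liminf (\<lambda>n. ennreal ((f n x)\<^sup>2))"
      using lim
    proof eventually_elim
      case (elim x)
      then have "(\<lambda>n. ennreal ((f n x)\<^sup>2)) \<longlonglongrightarrow> ennreal ((g x)\<^sup>2)"
        by (intro tendsto_ennrealI tendsto_intros)
      then show ?case by (intro lim_imp_Liminf[symmetric]) simp
    qed
  qed
  also have "\<dots> \<le> liminf (\<lambda>n. \<integral>\<^sup>+ x. ennreal ((f n x)\<^sup>2) \<partial>M)"
    using m by (intro nn_integral_liminf) simp
  also have "\<dots> \<le> liminf (\<lambda>n. ennreal B)"
  proof (intro Liminf_mono always_eventually allI)
    fix n
    have "(\<integral>\<^sup>+ x. ennreal ((f n x)\<^sup>2) \<partial>M) = ennreal (\<integral>x. (f n x)\<^sup>2 \<partial>M)"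
      using i by (intro nn_integral_eq_integral) auto
    then show "(\<integral>\<^sup>+ x. ennreal ((f n x)\<^sup>2) \<partial>M) \<le> ennreal B" using B by (simp add: ennreal_leI)
  qed
  also have "\<dots> = ennreal B" by (simp add: Liminf_const)
  finally have *: "(\<integral>\<^sup>+ x. ennreal ((g x)\<^sup>2) \<partial>M) \<le> ennreal B" .
  show gi: "integrable M (\<lambda>x. (g x)\<^sup>2)"
    using m * by (intro integrableI_nonneg) (auto intro: le_less_trans)
  then have "(\<integral>\<^sup>+ x. ennreal ((g x)\<^sup>2) \<partial>M) = ennreal (\<integral>x. (g x)\<^sup>2 \<partial>M)"
    by (intro nn_integral_eq_integral) auto
  then show "(\<integral>x. (g x)\<^sup>2 \<partial>M) \<le> B" using * B0 by (simp add: ennreal_le_iff)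
qed

lemma tendsto_integral_square:
  fixes f :: "nat \<Rightarrow> 'a \<Rightarrow> real"
  assumes m: "\<And>n. f n \<in> borel_measurable M" "g \<in> borel_measurable M"
    and i: "\<And>n. integrable M (\<lambda>x. (f n x)\<^sup>2)" "integrable M (\<lambda>x. (g x)\<^sup>2)"
    and z: "(\<lambda>n. \<integral>x. (f n x - g x)\<^sup>2 \<partial>M) \<longlonglongrightarrow> 0"
  shows "(\<lambda>n. \<integral>x. (f n x)\<^sup>2 \<partial>M) \<longlonglongrightarrow> (\<integral>x. (g x)\<^sup>2 \<partial>M)"
proof -
  have di: "integrable M (\<lambda>x. (f n x - g x)\<^sup>2)" for n by (intro integrable_square_diff m i)
  have mi: "integrable M (\<lambda>x. g x * (f n x - g x))" for n
    using m i di by (intro integrable_square_mult) auto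
  have "(\<lambda>n. \<integral>x. g x * (f n x - g x) \<partial>M) \<longlonglongrightarrow> 0"
    using m i di z by (intro tendsto_integral_mult_zero[where B="\<integral>x. (g x)\<^sup>2 \<partial>M"]) auto
  then have "(\<lambda>n. (\<integral>x. (g x)\<^sup>2 \<partial>M) + 2 * (\<integral>x. g x * (f n x - g x) \<partial>M) + (\<integral>x. (f n x - g x)\<^sup>2 \<partial>M))
    \<longlonglongrightarrow> (\<integral>x. (g x)\<^sup>2 \<partial>M) + 2 * 0 + 0"
    using z by (intro tendsto_intros)
  moreover have "(\<integral>x. (g x)\<^sup>2 \<partial>M) + 2 * (\<integral>x. g x * (f n x - g x) \<partial>M) + (\<integral>x. (f n x - g x)\<^sup>2 \<partial>M)
      = (\<integral>x. (f n x)\<^sup>2 \<partial>M)" for n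
  proof -
    have "(\<integral>x. (f n x)\<^sup>2 \<partial>M) = (\<integral>x. (g x)\<^sup>2 + 2 * (g x * (f n x - g x)) + (f n x - g x)\<^sup>2 \<partial>M)"
      by (intro Bochner_Integration.integral_cong) (auto simp: power2_eq_square algebra_simps)
    then show ?thesis using i mi di by simp
  qed
  ultimately show ?thesis by simp
qed

section \<open>Ito integrals on finite horizons\<close>

locale trading_process = brownian_space M F W
  for M :: "'a measure" and F and W :: "real \<Rightarrow> 'a \<Rightarrow> real" +
  fixes X Xd :: "real \<Rightarrow> 'a \<Rightarrow> real" and C :: real
  assumes adapted: "\<And>t. 0 \<le> t \<Longrightarrow> X t \<in> borel_measurable (F t)"
    and ac: "\<And>\<omega>. \<omega> \<in> space M \<Longrightarrow> ac_rate (\<lambda>t. X t \<omega>) (\<lambda>t. Xd t \<omega>)"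
    and bdd: "\<And>t \<omega>. 0 \<le> t \<Longrightarrow> \<omega> \<in> space M \<Longrightarrow> \<bar>X t \<omega>\<bar> \<le> C"
begin

text \<open>The stochastic integral of \<open>X\<close> against \<open>W\<close>, defined pathwise through integration by parts.\<close>

definition I :: "real \<Rightarrow> 'a \<Rightarrow> real" where
  "I t \<omega> = X t \<omega> * W t \<omega> - (LINT s:{0..t}|lborel. W s \<omega> * Xd s \<omega>)"

definition J :: "real \<Rightarrow> real \<Rightarrow> nat \<Rightarrow> 'a \<Rightarrow> real" where
  "J a b n \<omega> = (\<Sum>k<n. X (grid a b n k) \<omega> * (W (grid a b n (Suc k)) \<omega> - W (grid a b n k) \<omega>))"

lemma C_nonneg: "0 \<le> C"
proof -
  obtain \<omega> where "\<omega> \<in> space M" using not_empty by auto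
  then show ?thesis using bdd[of 0 \<omega>] by auto
qed

lemma X_continuous: "\<omega> \<in> space M \<Longrightarrow> 0 \<le> a \<Longrightarrow> continuous_on {a..b} (\<lambda>t. X t \<omega>)"
  using ac_rate_continuous_Icc[OF ac] .

lemma X_M: "0 \<le> t \<Longrightarrow> X t \<in> borel_measurable M"
  using F_M[OF _ adapted] by simp

lemma W_Xd_integrable: "\<omega> \<in> space M \<Longrightarrow> set_integrable lborel {0..b} (\<lambda>s. W s \<omega> * Xd s \<omega>)"
  by (intro set_integrable_continuous_mult W_continuous_Icc ac_rate_integrable[OF ac]) auto

lemma I_diff:
  assumes "\<omega> \<in> space M" "0 \<le> a" "a \<le> b"
  shows "I b \<omega> - I a \<omega> = X b \<omega> * W b \<omega> - X a \<omega> * W a \<omega> - (LINT s:{a..b}|lborel. W s \<omega> * Xd s \<omega>)"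
  unfolding I_def set_integral_Icc_split[OF assms(2,3) W_Xd_integrable[OF assms(1)]] by simp

lemma I_0: "\<omega> \<in> space M \<Longrightarrow> I 0 \<omega> = 0"
  by (simp add: I_def set_integral_singleton W_0)

lemma J_lim:
  assumes "\<omega> \<in> space M" "0 \<le> a" "a \<le> b"
  shows "(\<lambda>n. J a b n \<omega>) \<longlonglongrightarrow> I b \<omega> - I a \<omega>"
  unfolding I_diff[OF assms] J_def
  by (intro ac_rate_by_parts_sum[OF ac] W_continuous_Icc assms)

lemma grid_nonneg: "0 \<le> a \<Longrightarrow> a \<le> b \<Longrightarrow> 0 \<le> grid a b n k"
  using grid_ge[of a b n k] by linarith

lemma J_F:
  assumes "0 \<le> a" "a \<le> b"
  shows "J a b n \<in> borel_measurable (F b)"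
proof (cases "n = 0")
  case True
  then show ?thesis by (simp add: J_def[abs_def])
next
  case False
  have "(\<lambda>\<omega>. \<Sum>k<n. X (grid a b n k) \<omega> * (W (grid a b n (Suc k)) \<omega> - W (grid a b n k) \<omega>))
      \<in> borel_measurable (F (grid a b n n))"
    by (rule discrete_integral_F[where s="grid a b n" and C=C])
       (use assms grid_nonneg grid_mono adapted bdd in auto)
  then show ?thesis using False by (simp add: J_def[abs_def] grid_last)
qed

lemma J_square:
  assumes "0 \<le> a" "a \<le> b"
  shows "has_bochner_integral M (\<lambda>\<omega>. (J a b n \<omega>)\<^sup>2) (\<Sum>k<n. (\<integral>\<omega>. (X (grid a b n k) \<omega>)\<^sup>2 \<partial>M) * ((b - a) / real n))"
proof -
  have "has_bochner_integral M (\<lambda>\<omega>. (J a b n \<omega>)\<^sup>2)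
    (\<Sum>k<n. (\<integral>\<omega>. (X (grid a b n k) \<omega>)\<^sup>2 \<partial>M) * (grid a b n (Suc k) - grid a b n k))"
    unfolding J_def
    by (rule discrete_integral_square[where s="grid a b n" and C=C])
       (use assms grid_nonneg grid_mono adapted bdd in auto)
  then show ?thesis by (simp add: grid_Suc_diff)
qed

lemma J_orth:
  assumes "0 \<le> a" "a \<le> b" "Y \<in> borel_measurable (F a)" "integrable M (\<lambda>\<omega>. (Y \<omega>)\<^sup>2)"
  shows "has_bochner_integral M (\<lambda>\<omega>. Y \<omega> * J a b n \<omega>) 0"
  unfolding J_def
  by (rule discrete_integral_orth[where s="grid a b n" and C=C])
     (use assms grid_nonneg grid_mono adapted bdd in auto)

lemma I_F:
  assumes "0 \<le> t"
  shows "I t \<in> borel_measurable (F t)"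
proof (rule borel_measurable_LIMSEQ_real[where u="J 0 t"])
  show "J 0 t n \<in> borel_measurable (F t)" for n using assms by (intro J_F) auto
  fix \<omega> assume "\<omega> \<in> space (F t)"
  then have "\<omega> \<in> space M" using space_F[OF assms] by simp
  then show "(\<lambda>n. J 0 t n \<omega>) \<longlonglongrightarrow> I t \<omega>" using J_lim[of \<omega> 0 t] assms I_0 by simp
qed

lemma I_M: "0 \<le> t \<Longrightarrow> I t \<in> borel_measurable M"
  using F_M[OF _ I_F] by simp

lemma I_continuous:
  assumes "\<omega> \<in> space M"
  shows "continuous_on {0..} (\<lambda>t. I t \<omega>)"
  unfolding I_def
  using ac_rate_continuous[OF ac[OF assms]] W_continuous[OF assms]
    continuous_indefinite_integral[OF W_Xd_integrable[OF assms]]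
  by (intro continuous_intros)

text \<open>Squared distance in time between two step interpolations of \<open>X\<close>, on the
  grid with \<open>n\<close> cells and on its refinement with \<open>n * m\<close> cells;
  \<open>l div m\<close> is the coarse cell containing the fine index \<open>l\<close>. Its mean is
  the mean square distance of the two sums \<open>J\<close>.\<close>

definition q :: "real \<Rightarrow> real \<Rightarrow> nat \<Rightarrow> nat \<Rightarrow> 'a \<Rightarrow> real" where
  "q a b n m \<omega> = (\<Sum>l<n * m. (X (grid a b n (l div m)) \<omega> - X (grid a b (n * m) l) \<omega>)\<^sup>2 * ((b - a) / real (n * m)))"

lemma grid_coarse:
  assumes "m > 0"
  shows "grid a b (n * m) (k * m) = grid a b n k"
  using assms by (simp add: grid_def)

lemma grid_div_le:
  assumes "a \<le> b" "m > 0"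
  shows "grid a b n (l div m) \<le> grid a b (n * m) l"
proof -
  have "grid a b (n * m) (l div m * m) \<le> grid a b (n * m) l"
    by (rule grid_mono[OF assms(1)]) simp
  then show ?thesis unfolding grid_coarse[OF assms(2)] .
qed

lemma grid_div_dist:
  assumes "a \<le> b" "m > 0"
  shows "grid a b (n * m) l - grid a b n (l div m) \<le> (b - a) / real n"
proof -
  have "l \<le> Suc (l div m) * m" using assms(2) by (metis dividend_less_div_times less_or_eq_imp_le mult_Suc add.commute)
  then have "grid a b (n * m) l \<le> grid a b (n * m) (Suc (l div m) * m)"
    by (rule grid_mono[OF assms(1)])
  then show ?thesis unfolding grid_coarse[OF assms(2)] using grid_Suc_diff[of a b n "l div m"] by linarith
qed

text \<open>On the fine grid the coarse integrand is constant along each block of \<open>m\<close>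
  cells, where the increments of \<open>W\<close> telescope.\<close>

lemma J_refine:
  assumes "m > 0"
  shows "J a b n \<omega> = (\<Sum>l<n * m. X (grid a b n (l div m)) \<omega> * (W (grid a b (n * m) (Suc l)) \<omega> - W (grid a b (n * m) l) \<omega>))"
proof -
  let ?w = "\<lambda>l. W (grid a b (n * m) l) \<omega>"
  have "(\<Sum>l<n * m. X (grid a b n (l div m)) \<omega> * (?w (Suc l) - ?w l))
     = (\<Sum>k<n. \<Sum>l=k*m..<k*m+m. X (grid a b n (l div m)) \<omega> * (?w (Suc l) - ?w l))"
    by (rule sum.nat_group[symmetric])
  also have "\<dots> = (\<Sum>k<n. X (grid a b n k) \<omega> * (W (grid a b n (Suc k)) \<omega> - W (grid a b n k) \<omega>))"
  proof (rule sum.cong)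
    fix k
    have "(\<Sum>l=k*m..<k*m+m. X (grid a b n (l div m)) \<omega> * (?w (Suc l) - ?w l))
      = (\<Sum>l=k*m..<k*m+m. X (grid a b n k) \<omega> * (?w (Suc l) - ?w l))"
      by (intro sum.cong refl) (metis assms atLeastLessThan_iff div_nat_eqI mult_Suc add.commute mult.commute)
    also have "\<dots> = X (grid a b n k) \<omega> * (?w (k*m+m) - ?w (k*m))"
      unfolding sum_distrib_left[symmetric] using sum_Suc_diff'[of "k*m" "k*m+m" ?w] by simp
    also have "?w (k*m+m) = W (grid a b n (Suc k)) \<omega>"
      using grid_coarse[OF assms, of a b n "Suc k"] by (simp add: add.commute)
    finally show "(\<Sum>l=k*m..<k*m+m. X (grid a b n (l div m)) \<omega> * (?w (Suc l) - ?w l))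
       = X (grid a b n k) \<omega> * (W (grid a b n (Suc k)) \<omega> - W (grid a b n k) \<omega>)"
      by (simp add: grid_coarse[OF assms])
  qed simp
  finally show ?thesis by (simp add: J_def)
qed

lemma J_diff_square:
  assumes "0 \<le> a" "a \<le> b" "m > 0"
  shows "has_bochner_integral M (\<lambda>\<omega>. (J a b n \<omega> - J a b (n * m) \<omega>)\<^sup>2) (\<integral>\<omega>. q a b n m \<omega> \<partial>M)"
proof -
  let ?h = "\<lambda>l \<omega>. X (grid a b n (l div m)) \<omega> - X (grid a b (n * m) l) \<omega>"
  have hF: "?h l \<in> borel_measurable (F (grid a b (n * m) l))" for l
    using F_mono[OF _ grid_div_le[OF assms(2,3)] adapted] adapted grid_nonneg assms by simp
  have hb: "\<bar>?h l \<omega>\<bar> \<le> 2 * C" if "\<omega> \<in> space M" for l \<omega>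
    using bdd[OF grid_nonneg[OF assms(1,2)] that, of n "l div m"] bdd[OF grid_nonneg[OF assms(1,2)] that, of "n * m" l] by linarith
  have hi: "integrable M (\<lambda>\<omega>. (?h l \<omega>)\<^sup>2)" for l
  proof (rule integrable_const_bound[where B="(2 * C)\<^sup>2"])
    show "AE \<omega> in M. norm ((?h l \<omega>)\<^sup>2) \<le> (2 * C)\<^sup>2"
    proof (intro AE_I2)
      fix \<omega> assume "\<omega> \<in> space M"
      then show "norm ((?h l \<omega>)\<^sup>2) \<le> (2 * C)\<^sup>2"
        using power_mono[OF hb abs_ge_zero, of \<omega> l 2] by (simp del: power_mult_distrib)
    qed
    show "(\<lambda>\<omega>. (?h l \<omega>)\<^sup>2) \<in> borel_measurable M" using F_M[OF _ hF] grid_nonneg assms by simp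
  qed
  have "has_bochner_integral M (\<lambda>\<omega>. (\<Sum>l<n * m. ?h l \<omega> * (W (grid a b (n * m) (Suc l)) \<omega> - W (grid a b (n * m) l) \<omega>))\<^sup>2)
    (\<Sum>l<n * m. (\<integral>\<omega>. (?h l \<omega>)\<^sup>2 \<partial>M) * (grid a b (n * m) (Suc l) - grid a b (n * m) l))"
    by (rule discrete_integral_square[where s="grid a b (n * m)" and C="2 * C" and h="?h"])
       (use assms grid_nonneg grid_mono hF hb in auto)
  moreover have "(\<Sum>l<n * m. ?h l \<omega> * (W (grid a b (n * m) (Suc l)) \<omega> - W (grid a b (n * m) l) \<omega>)) = J a b n \<omega> - J a b (n * m) \<omega>" for \<omega>
    unfolding J_refine[OF assms(3), of a b n \<omega>] by (simp add: J_def left_diff_distrib sum_subtractf)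
  moreover have "(\<Sum>l<n * m. (\<integral>\<omega>. (?h l \<omega>)\<^sup>2 \<partial>M) * (grid a b (n * m) (Suc l) - grid a b (n * m) l)) = (\<integral>\<omega>. q a b n m \<omega> \<partial>M)"
    unfolding q_def grid_Suc_diff using hi by simp
  ultimately show ?thesis by simp
qed

lemma q_bounds:
  assumes "0 \<le> a" "a \<le> b" "\<omega> \<in> space M"
    and "\<And>l. l < n * m \<Longrightarrow> \<bar>X (grid a b n (l div m)) \<omega> - X (grid a b (n * m) l) \<omega>\<bar> \<le> e" "e \<ge> 0"
  shows "0 \<le> q a b n m \<omega>" "q a b n m \<omega> \<le> e\<^sup>2 * (b - a)"
proof -
  show "0 \<le> q a b n m \<omega>" using assms(2) unfolding q_def by (intro sum_nonneg) simp
  have "q a b n m \<omega> \<le> (\<Sum>l<n * m. e\<^sup>2 * ((b - a) / real (n * m)))"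
    unfolding q_def
  proof (intro sum_mono mult_right_mono)
    fix l assume "l \<in> {..<n * m}"
    then show "(X (grid a b n (l div m)) \<omega> - X (grid a b (n * m) l) \<omega>)\<^sup>2 \<le> e\<^sup>2"
      using assms(4)[of l] assms(5) by (simp add: abs_le_square_iff[symmetric])
  qed (use assms in simp)
  also have "\<dots> \<le> e\<^sup>2 * (b - a)" using assms(2) by simp
  finally show "q a b n m \<omega> \<le> e\<^sup>2 * (b - a)" .
qed

lemma q_le:
  assumes "0 \<le> a" "a \<le> b" "\<omega> \<in> space M"
  shows "0 \<le> q a b n m \<omega>" "q a b n m \<omega> \<le> (2 * C)\<^sup>2 * (b - a)"
proof -
  have "\<bar>X (grid a b n (l div m)) \<omega> - X (grid a b (n * m) l) \<omega>\<bar> \<le> 2 * C" for l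
    using bdd[OF grid_nonneg[OF assms(1,2)] assms(3), of n "l div m"]
      bdd[OF grid_nonneg[OF assms(1,2)] assms(3), of "n * m" l] by linarith
  then show "0 \<le> q a b n m \<omega>" "q a b n m \<omega> \<le> (2 * C)\<^sup>2 * (b - a)"
    using q_bounds[OF assms, of n m "2 * C"] C_nonneg by auto
qed

lemma q_M: "0 \<le> a \<Longrightarrow> a \<le> b \<Longrightarrow> q a b n m \<in> borel_measurable M"
  unfolding q_def[abs_def]
  by (intro borel_measurable_sum borel_measurable_times borel_measurable_power borel_measurable_diff
      borel_measurable_const X_M grid_nonneg)

text \<open>The modulus of continuity at the coarse mesh bounds \<open>q\<close> whatever the
  refinement, so \<open>m\<close> may depend on \<open>n\<close> in any way.\<close>

lemma q_tendsto:
  assumes "0 \<le> a" "a \<le> b" "\<omega> \<in> space M"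
  shows "(\<lambda>n. q a b n (m n) \<omega>) \<longlonglongrightarrow> 0"
proof (rule LIMSEQ_I)
  fix e :: real assume e: "e > 0"
  \<comment> \<open>Solves \<open>e'\<^sup>2 * (b - a + 1) = e / 2\<close>; the summand 1 covers
    \<open>a = b\<close>.\<close>
  define e' where "e' = sqrt (e / (2 * (b - a + 1)))"
  have e': "e' > 0" "e'\<^sup>2 * (b - a) < e"
  proof -
    show "e' > 0" using e assms(2) by (simp add: e'_def)
    have "e'\<^sup>2 = e / (2 * (b - a + 1))" using e assms(2) by (simp add: e'_def)
    then show "e'\<^sup>2 * (b - a) < e"
    proof -
      assume *: "e'\<^sup>2 = e / (2 * (b - a + 1))"
      have "(b - a) / (2 * (b - a + 1)) < 1" using assms(2) by (simp add: divide_less_eq)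
      then have "e * ((b - a) / (2 * (b - a + 1))) < e * 1" using e by (intro mult_strict_left_mono)
      then show ?thesis using * by simp
    qed
  qed
  have "uniformly_continuous_on {a..b} (\<lambda>t. X t \<omega>)"
    using X_continuous[OF assms(3,1)] by (simp add: compact_uniformly_continuous)
  then obtain d where d: "d > 0"
    "\<And>x y. x \<in> {a..b} \<Longrightarrow> y \<in> {a..b} \<Longrightarrow> dist x y < d \<Longrightarrow> dist (X x \<omega>) (X y \<omega>) < e'"
    unfolding uniformly_continuous_on_def using e' by metis
  obtain N :: nat where N: "(b - a) / d < real N" using reals_Archimedean2 by blast
  show "\<exists>no. \<forall>n\<ge>no. norm (q a b n (m n) \<omega> - 0) < e"
  proof (intro exI allI impI)
    fix n assume n: "n \<ge> Suc N"
    have mesh: "(b - a) / real n < d"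
    proof -
      have "(b - a) / d < real n" using N n by linarith
      then show ?thesis using d(1) n by (simp add: field_simps)
    qed
    have "\<bar>X (grid a b n (l div m n)) \<omega> - X (grid a b (n * m n) l) \<omega>\<bar> \<le> e'" if l: "l < n * m n" for l
    proof -
      have m: "m n > 0" using l by (cases "m n") auto
      have "l div m n < n" using l by (simp add: less_mult_imp_div_less)
      then have "dist (X (grid a b n (l div m n)) \<omega>) (X (grid a b (n * m n) l) \<omega>) < e'"
        using grid_ge[OF assms(2)] grid_le[OF assms(2), of "l div m n" n] grid_le[OF assms(2), of l "n * m n"] l mesh
          grid_div_le[OF assms(2) m, of n l] grid_div_dist[OF assms(2) m, of n l]
        by (intro d(2)) (auto simp: dist_real_def)
      then show ?thesis by (simp add: dist_real_def)
    qed
    then have "0 \<le> q a b n (m n) \<omega>" "q a b n (m n) \<omega> \<le> e'\<^sup>2 * (b - a)"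
      using q_bounds[OF assms, of n "m n" e'] e'(1) by auto
    then show "norm (q a b n (m n) \<omega> - 0) < e" using e'(2) by simp
  qed
qed

lemma q_E_bound:
  assumes "0 \<le> a" "a \<le> b"
  shows "(\<integral>\<omega>. q a b n m \<omega> \<partial>M) \<le> (2 * C)\<^sup>2 * (b - a)"
proof -
  have "(\<integral>\<omega>. q a b n m \<omega> \<partial>M) \<le> (\<integral>\<omega>. (2 * C)\<^sup>2 * (b - a) \<partial>M)"
  proof (rule integral_mono)
    show "integrable M (q a b n m)"
      using q_le[OF assms] q_M[OF assms] by (intro integrable_const_bound[where B="(2 * C)\<^sup>2 * (b - a)"]) (auto intro!: AE_I2)
  qed (use q_le[OF assms] in auto)
  then show ?thesis by (simp add: prob_space)
qed

text \<open>Letting \<open>m\<close> tend to infinity, Fatou's lemma bounds the \<open>L\<^sup>2\<close> error of \<open>J a b n\<close> by \<open>S n\<close>, the supremum over all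
  refinements \<open>m\<close>. As \<open>S n\<close> is almost attained by some \<open>m n\<close>, dominated convergence along \<open>m n\<close> gives \<open>S n \<longlonglongrightarrow> 0\<close>.\<close>

lemma J_I_square:
  assumes ab: "0 \<le> a" "a \<le> b"
  shows "integrable M (\<lambda>\<omega>. (I b \<omega> - I a \<omega>)\<^sup>2)"
    and "integrable M (\<lambda>\<omega>. (J a b n \<omega> - (I b \<omega> - I a \<omega>))\<^sup>2)"
    and "(\<lambda>n. \<integral>\<omega>. (J a b n \<omega> - (I b \<omega> - I a \<omega>))\<^sup>2 \<partial>M) \<longlonglongrightarrow> 0"
proof -
  have JM: "J a b n \<in> borel_measurable M" for n using F_M[OF _ J_F[OF ab]] ab by simp
  have IM: "(\<lambda>\<omega>. I b \<omega> - I a \<omega>) \<in> borel_measurable M" using I_M ab by simp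
  define S where "S n = (SUP m. \<integral>\<omega>. q a b n m \<omega> \<partial>M)" for n
  have bd: "bdd_above (range (\<lambda>m. \<integral>\<omega>. q a b n m \<omega> \<partial>M))" for n
    using q_E_bound[OF ab] by (auto intro!: bdd_aboveI)
  have *: "integrable M (\<lambda>\<omega>. (J a b n \<omega> - (I b \<omega> - I a \<omega>))\<^sup>2)"
     "(\<integral>\<omega>. (J a b n \<omega> - (I b \<omega> - I a \<omega>))\<^sup>2 \<partial>M) \<le> S n" if n: "n > 0" for n
  proof -
    have lim: "AE \<omega> in M. (\<lambda>m. J a b n \<omega> - J a b (n * Suc m) \<omega>) \<longlonglongrightarrow> J a b n \<omega> - (I b \<omega> - I a \<omega>)"
    proof (intro AE_I2 tendsto_diff tendsto_const)
      fix \<omega> assume "\<omega> \<in> space M"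
      moreover have "strict_mono (\<lambda>m. n * Suc m)" using n by (auto simp: strict_mono_def)
      ultimately show "(\<lambda>m. J a b (n * Suc m) \<omega>) \<longlonglongrightarrow> I b \<omega> - I a \<omega>"
        using LIMSEQ_subseq_LIMSEQ[OF J_lim[OF _ ab]] by (auto simp: comp_def)
    qed
    have i: "integrable M (\<lambda>\<omega>. (J a b n \<omega> - J a b (n * Suc m) \<omega>)\<^sup>2)" for m
      using J_diff_square[OF ab, of "Suc m" n] by (auto dest: integrable.intros)
    have B: "(\<integral>\<omega>. (J a b n \<omega> - J a b (n * Suc m) \<omega>)\<^sup>2 \<partial>M) \<le> S n" for m
      using J_diff_square[OF ab, of "Suc m" n] cSUP_upper[OF UNIV_I bd, of n "Suc m"]
      by (simp add: has_bochner_integral_iff S_def)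
    show "integrable M (\<lambda>\<omega>. (J a b n \<omega> - (I b \<omega> - I a \<omega>))\<^sup>2)"
     "(\<integral>\<omega>. (J a b n \<omega> - (I b \<omega> - I a \<omega>))\<^sup>2 \<partial>M) \<le> S n"
      by (rule fatou_square[OF _ _ lim i B]; use JM IM in simp)+
  qed
  have S0: "S \<longlonglongrightarrow> 0"
  proof -
    have "\<exists>m. S n - 1 / real (Suc n) < (\<integral>\<omega>. q a b n m \<omega> \<partial>M)" for n
    proof -
      have "S n - 1 / real (Suc n) < (SUP m. \<integral>\<omega>. q a b n m \<omega> \<partial>M)" by (simp add: S_def)
      then show ?thesis using less_cSUP_iff[OF UNIV_not_empty bd] by blast
    qed
    then obtain m where m: "\<And>n. S n - 1 / real (Suc n) < (\<integral>\<omega>. q a b n (m n) \<omega> \<partial>M)" by metis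
    have "(\<lambda>n. \<integral>\<omega>. q a b n (m n) \<omega> \<partial>M) \<longlonglongrightarrow> (\<integral>\<omega>. 0 \<partial>M)"
      using q_M[OF ab] q_tendsto[OF ab] q_le[OF ab]
      by (intro integral_dominated_convergence[where w="\<lambda>\<omega>. (2 * C)\<^sup>2 * (b - a)"]) (auto intro!: AE_I2)
    then have "(\<lambda>n. (\<integral>\<omega>. q a b n (m n) \<omega> \<partial>M) + 1 / real (Suc n)) \<longlonglongrightarrow> 0 + 0"
      by (intro tendsto_add LIMSEQ_Suc[OF lim_1_over_n]) simp
    then have up: "(\<lambda>n. (\<integral>\<omega>. q a b n (m n) \<omega> \<partial>M) + 1 / real (Suc n)) \<longlonglongrightarrow> 0" by simp
    have nn: "0 \<le> S n" for n
    proof -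
      have "0 \<le> (\<integral>\<omega>. q a b n 0 \<omega> \<partial>M)" using q_le[OF ab] by (intro integral_nonneg_AE AE_I2)
      also have "\<dots> \<le> S n" unfolding S_def by (rule cSUP_upper[OF UNIV_I bd])
      finally show ?thesis .
    qed
    show ?thesis
      using nn m by (intro tendsto_sandwich[OF _ _ tendsto_const up] always_eventually allI) (auto simp: less_imp_le algebra_simps)
  qed
  have J2: "integrable M (\<lambda>\<omega>. (J a b n \<omega>)\<^sup>2)" for n using J_square[OF ab] by (auto dest: integrable.intros)
  \<comment> \<open>The increment of \<open>I\<close> is \<open>J a b 1\<close> minus its error, and
    both are square integrable.\<close>
  have "integrable M (\<lambda>\<omega>. (J a b 1 \<omega> - (J a b 1 \<omega> - (I b \<omega> - I a \<omega>)))\<^sup>2)"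
    by (intro integrable_square_diff JM borel_measurable_diff IM J2 *(1)) auto
  then show I2: "integrable M (\<lambda>\<omega>. (I b \<omega> - I a \<omega>)\<^sup>2)" by simp
  show "integrable M (\<lambda>\<omega>. (J a b n \<omega> - (I b \<omega> - I a \<omega>))\<^sup>2)"
    by (intro integrable_square_diff JM IM J2 I2)
  show "(\<lambda>n. \<integral>\<omega>. (J a b n \<omega> - (I b \<omega> - I a \<omega>))\<^sup>2 \<partial>M) \<longlonglongrightarrow> 0"
    using *(2) by (intro tendsto_sandwich[OF _ _ tendsto_const S0] always_eventually allI
        eventually_sequentiallyI[of 1]) auto
qed

text \<open>The martingale property of \<open>I\<close>, tested against square-integrable variables
  known at time \<open>a\<close>. It passes from \<open>J_orth\<close> to the limit in mean
  square.\<close>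

lemma I_orth:
  assumes ab: "0 \<le> a" "a \<le> b" and Y: "Y \<in> borel_measurable (F a)" "integrable M (\<lambda>\<omega>. (Y \<omega>)\<^sup>2)"
  shows "integrable M (\<lambda>\<omega>. Y \<omega> * (I b \<omega> - I a \<omega>))" "(\<integral>\<omega>. Y \<omega> * (I b \<omega> - I a \<omega>) \<partial>M) = 0"
proof -
  have JM: "J a b n \<in> borel_measurable M" for n using F_M[OF _ J_F[OF ab]] ab by simp
  have IM: "(\<lambda>\<omega>. I b \<omega> - I a \<omega>) \<in> borel_measurable M" using I_M ab by simp
  have YM: "Y \<in> borel_measurable M" using F_M[OF ab(1) Y(1)] .
  show i: "integrable M (\<lambda>\<omega>. Y \<omega> * (I b \<omega> - I a \<omega>))"
    by (intro integrable_square_mult YM IM Y J_I_square ab)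
  have "(\<lambda>n. \<integral>\<omega>. Y \<omega> * (J a b n \<omega> - (I b \<omega> - I a \<omega>)) \<partial>M) \<longlonglongrightarrow> 0"
    using YM JM IM Y J_I_square[OF ab]
    by (intro tendsto_integral_mult_zero[where B="\<integral>\<omega>. (Y \<omega>)\<^sup>2 \<partial>M"]) auto
  moreover have "(\<integral>\<omega>. Y \<omega> * (J a b n \<omega> - (I b \<omega> - I a \<omega>)) \<partial>M) = - (\<integral>\<omega>. Y \<omega> * (I b \<omega> - I a \<omega>) \<partial>M)" for n
    using J_orth[OF ab Y, of n] i by (simp add: right_diff_distrib[of "Y _" "J a b n _"] has_bochner_integral_iff)
  ultimately show "(\<integral>\<omega>. Y \<omega> * (I b \<omega> - I a \<omega>) \<partial>M) = 0"
    by (simp add: LIMSEQ_const_iff)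
qed

text \<open>The mean of the quadratic variation; \<open>I_isometry\<close> identifies its increments
  with second moments of increments of \<open>I\<close>.\<close>

definition V :: "real \<Rightarrow> real" where
  "V t = (\<integral>\<omega>. (LINT s:{0..t}|lborel. (X s \<omega>)\<^sup>2) \<partial>M)"

lemma X2_integrable: "\<omega> \<in> space M \<Longrightarrow> 0 \<le> a \<Longrightarrow> set_integrable lborel {a..b} (\<lambda>s. (X s \<omega>)\<^sup>2)"
  by (intro borel_integrable_atLeastAtMost' continuous_intros X_continuous)

lemma riemann_sum_square_bound:
  assumes "0 \<le> a" "a \<le> b" "\<omega> \<in> space M"
  shows "0 \<le> (\<Sum>k<n. (X (grid a b n k) \<omega>)\<^sup>2 * ((b - a) / real n))"
    "(\<Sum>k<n. (X (grid a b n k) \<omega>)\<^sup>2 * ((b - a) / real n)) \<le> C\<^sup>2 * (b - a)"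
proof -
  show "0 \<le> (\<Sum>k<n. (X (grid a b n k) \<omega>)\<^sup>2 * ((b - a) / real n))"
    using assms by (intro sum_nonneg) simp
  have "(\<Sum>k<n. (X (grid a b n k) \<omega>)\<^sup>2 * ((b - a) / real n)) \<le> (\<Sum>k<n. C\<^sup>2 * ((b - a) / real n))"
    using bdd[OF grid_nonneg[OF assms(1,2)] assms(3)] C_nonneg assms(2)
    by (intro sum_mono mult_right_mono) (auto simp: abs_le_square_iff[symmetric])
  also have "\<dots> \<le> C\<^sup>2 * (b - a)" using assms by simp
  finally show "(\<Sum>k<n. (X (grid a b n k) \<omega>)\<^sup>2 * ((b - a) / real n)) \<le> C\<^sup>2 * (b - a)" .
qed

text \<open>For the sums \<open>J\<close> the discrete isometry gives the mean of a Riemann sum of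
  the squared path. Bounded convergence yields the limit of these means, mean square convergence
  that of the second moments of \<open>J\<close>, and the two must agree.\<close>

lemma integral_X2:
  assumes ab: "0 \<le> a" "a \<le> b"
  shows "integrable M (\<lambda>\<omega>. LINT s:{a..b}|lborel. (X s \<omega>)\<^sup>2)"
    and "(\<integral>\<omega>. (I b \<omega> - I a \<omega>)\<^sup>2 \<partial>M) = (\<integral>\<omega>. (LINT s:{a..b}|lborel. (X s \<omega>)\<^sup>2) \<partial>M)"
proof -
  let ?R = "\<lambda>n \<omega>. \<Sum>k<n. (X (grid a b n k) \<omega>)\<^sup>2 * ((b - a) / real n)"
  have RM: "?R n \<in> borel_measurable M" for n using X_M grid_nonneg[OF ab] by simp
  have lim: "(\<lambda>n. ?R n \<omega>) \<longlonglongrightarrow> (LINT s:{a..b}|lborel. (X s \<omega>)\<^sup>2)" if "\<omega> \<in> space M" for \<omega>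
    using riemann_sum_limit[OF ab, of "\<lambda>t. (X t \<omega>)\<^sup>2"] X_continuous[OF that ab(1)] by (simp add: continuous_on_power)
  have m: "(\<lambda>\<omega>. LINT s:{a..b}|lborel. (X s \<omega>)\<^sup>2) \<in> borel_measurable M"
    by (rule borel_measurable_LIMSEQ_real[OF lim RM])
  have bd: "AE \<omega> in M. norm (?R n \<omega>) \<le> C\<^sup>2 * (b - a)" for n
    using riemann_sum_square_bound[OF ab] by (intro AE_I2) (simp add: abs_of_nonneg)
  show "integrable M (\<lambda>\<omega>. LINT s:{a..b}|lborel. (X s \<omega>)\<^sup>2)"
    by (rule integrable_dominated_convergence[where s="?R", OF m RM _ _ bd]) (use lim in auto)
  have "(\<lambda>n. \<integral>\<omega>. ?R n \<omega> \<partial>M) \<longlonglongrightarrow> (\<integral>\<omega>. (LINT s:{a..b}|lborel. (X s \<omega>)\<^sup>2) \<partial>M)"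
    by (rule integral_dominated_convergence[where s="?R", OF m RM _ _ bd]) (use lim in auto)
  moreover have "(\<integral>\<omega>. ?R n \<omega> \<partial>M) = (\<integral>\<omega>. (J a b n \<omega>)\<^sup>2 \<partial>M)" for n
  proof -
    have "integrable M (\<lambda>\<omega>. (X (grid a b n k) \<omega>)\<^sup>2)" for k
      using bdd[OF grid_nonneg[OF ab]] C_nonneg X_M[OF grid_nonneg[OF ab]]
      by (intro integrable_const_bound[where B="C\<^sup>2"]) (auto intro!: AE_I2 simp: abs_le_square_iff[symmetric])
    then show ?thesis using J_square[OF ab, of n] by (simp add: has_bochner_integral_iff)
  qed
  ultimately have 1: "(\<lambda>n. \<integral>\<omega>. (J a b n \<omega>)\<^sup>2 \<partial>M) \<longlonglongrightarrow> (\<integral>\<omega>. (LINT s:{a..b}|lborel. (X s \<omega>)\<^sup>2) \<partial>M)" by simp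
  have "(\<lambda>n. \<integral>\<omega>. (J a b n \<omega>)\<^sup>2 \<partial>M) \<longlonglongrightarrow> (\<integral>\<omega>. (I b \<omega> - I a \<omega>)\<^sup>2 \<partial>M)"
    using J_I_square[OF ab] J_square[OF ab] F_M[OF _ J_F[OF ab]] I_M ab
    by (intro tendsto_integral_square) (auto dest: integrable.intros)
  from LIMSEQ_unique[OF this 1]
  show "(\<integral>\<omega>. (I b \<omega> - I a \<omega>)\<^sup>2 \<partial>M) = (\<integral>\<omega>. (LINT s:{a..b}|lborel. (X s \<omega>)\<^sup>2) \<partial>M)" .
qed

lemma I_isometry:
  assumes ab: "0 \<le> a" "a \<le> b"
  shows "(\<integral>\<omega>. (I b \<omega> - I a \<omega>)\<^sup>2 \<partial>M) = V b - V a"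
proof -
  have "V b = (\<integral>\<omega>. (LINT s:{0..a}|lborel. (X s \<omega>)\<^sup>2) + (LINT s:{a..b}|lborel. (X s \<omega>)\<^sup>2) \<partial>M)"
    unfolding V_def using X2_integrable ab
    by (intro Bochner_Integration.integral_cong set_integral_Icc_split) auto
  also have "\<dots> = V a + (\<integral>\<omega>. (LINT s:{a..b}|lborel. (X s \<omega>)\<^sup>2) \<partial>M)"
    unfolding V_def using integral_X2(1) ab by simp
  finally show ?thesis using integral_X2(2)[OF ab] by simp
qed

text \<open>Squared increments of a martingale form a submartingale: the cross term vanishes by
  \<open>I_orth\<close>, applied to the increment up to \<open>t\<close> restricted to the event
  \<open>A\<close>.\<close>

lemma I_square_mult_indicator:
  assumes "0 \<le> S" "S \<le> t" "t \<le> T" and A: "A \<in> sets (F t)"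
  shows "(\<integral>\<omega>. indicator A \<omega> * (I t \<omega> - I S \<omega>)\<^sup>2 \<partial>M) \<le> (\<integral>\<omega>. indicator A \<omega> * (I T \<omega> - I S \<omega>)\<^sup>2 \<partial>M)"
proof -
  have t0: "0 \<le> t" "0 \<le> T" using assms by auto
  have AM: "A \<in> sets M" using sets_F_M[OF t0(1) A] .
  let ?Y = "\<lambda>\<omega>. indicator A \<omega> * (I t \<omega> - I S \<omega>)"
  have YF: "?Y \<in> borel_measurable (F t)"
    using A I_F[OF t0(1)] F_mono[OF assms(1,2) I_F[OF assms(1)]] by simp
  have Y2: "integrable M (\<lambda>\<omega>. (?Y \<omega>)\<^sup>2)"
  proof -
    have "integrable M (\<lambda>\<omega>. indicator A \<omega> *\<^sub>R (I t \<omega> - I S \<omega>)\<^sup>2)"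
      by (intro integrable_mult_indicator AM J_I_square assms)
    moreover have "indicator A \<omega> *\<^sub>R (I t \<omega> - I S \<omega>)\<^sup>2 = (?Y \<omega>)\<^sup>2" for \<omega>
      by (auto simp: indicator_def)
    ultimately show ?thesis by simp
  qed
  note o = I_orth[OF t0(1) assms(3) YF Y2]
  have i1: "integrable M (\<lambda>\<omega>. indicator A \<omega> * (I t \<omega> - I S \<omega>)\<^sup>2)"
    using integrable_mult_indicator[OF AM J_I_square(1)[OF assms(1,2)]] by simp
  have i2: "integrable M (\<lambda>\<omega>. indicator A \<omega> * (I T \<omega> - I t \<omega>)\<^sup>2)"
    using integrable_mult_indicator[OF AM J_I_square(1)[OF t0(1) assms(3)]] by simp
  have "(\<integral>\<omega>. indicator A \<omega> * (I T \<omega> - I S \<omega>)\<^sup>2 \<partial>M)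
    = (\<integral>\<omega>. indicator A \<omega> * (I t \<omega> - I S \<omega>)\<^sup>2 + 2 * (?Y \<omega> * (I T \<omega> - I t \<omega>)) + indicator A \<omega> * (I T \<omega> - I t \<omega>)\<^sup>2 \<partial>M)"
    by (intro Bochner_Integration.integral_cong refl) (simp add: power2_eq_square algebra_simps)
  also have "\<dots> = (\<integral>\<omega>. indicator A \<omega> * (I t \<omega> - I S \<omega>)\<^sup>2 \<partial>M) + 2 * 0 + (\<integral>\<omega>. indicator A \<omega> * (I T \<omega> - I t \<omega>)\<^sup>2 \<partial>M)"
    using i1 i2 o by simp
  finally show ?thesis
    using integral_nonneg_AE[of "\<lambda>\<omega>. indicator A \<omega> * (I T \<omega> - I t \<omega>)\<^sup>2" M] by simp
qed

lemma I_maximal: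
  assumes ST: "0 \<le> S" "S \<le> T" and a: "a > 0"
  shows "{\<omega>\<in>space M. \<exists>t\<in>{S..T}. a < (I t \<omega> - I S \<omega>)\<^sup>2} \<in> sets M"
    and "a * prob {\<omega>\<in>space M. \<exists>t\<in>{S..T}. a < (I t \<omega> - I S \<omega>)\<^sup>2} \<le> V T - V S"
proof -
  let ?U = "\<lambda>t \<omega>. (I t \<omega> - I S \<omega>)\<^sup>2"
  have U: "?U t \<in> borel_measurable (F t)" "integrable M (?U t)" if "S \<le> t" for t
    using that ST I_F[of t] F_mono[OF ST(1) that I_F[OF ST(1)]] J_I_square(1)[OF ST(1) that] by simp_all
  have c: "continuous_on {S..T} (\<lambda>t. ?U t \<omega>)" if "\<omega> \<in> space M" for \<omega>
    using continuous_on_subset[OF I_continuous[OF that], of "{S..T}"] ST by (intro continuous_intros) auto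
  show "{\<omega>\<in>space M. \<exists>t\<in>{S..T}. a < ?U t \<omega>} \<in> sets M"
    by (rule maximal_continuous(1)[where U="?U", OF ST U(1) _ U(2) c I_square_mult_indicator a]) (use ST in auto)
  have "a * prob {\<omega>\<in>space M. \<exists>t\<in>{S..T}. a < ?U t \<omega>} \<le> (\<integral>\<omega>. ?U T \<omega> \<partial>M)"
    by (rule maximal_continuous(2)[where U="?U", OF ST U(1) _ U(2) c I_square_mult_indicator a]) (use ST in auto)
  then show "a * prob {\<omega>\<in>space M. \<exists>t\<in>{S..T}. a < ?U t \<omega>} \<le> V T - V S"
    using I_isometry[OF ST] by simp
qed

lemma V_mono: "0 \<le> a \<Longrightarrow> a \<le> b \<Longrightarrow> V a \<le> V b"
proof -
  assume ab: "0 \<le> a" "a \<le> b"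
  have "0 \<le> (\<integral>\<omega>. (I b \<omega> - I a \<omega>)\<^sup>2 \<partial>M)" by (rule integral_nonneg_AE) simp
  then show ?thesis using I_isometry[OF ab] by simp
qed

end

section \<open>Passage to the infinite horizon\<close>

locale l2_trading_process = trading_process +
  assumes fin: "(\<integral>\<^sup>+ \<omega>. (\<integral>\<^sup>+ t\<in>{0..}. ennreal ((X t \<omega>)\<^sup>2) \<partial>lborel) \<partial>M) < \<infinity>"
begin

text \<open>Taken along the integers, so that measurability is immediate;
  \<open>I_tendsto_Iinf\<close> shows it to be almost surely the limit along real times.\<close>

definition Iinf :: "'a \<Rightarrow> real" where "Iinf \<omega> = lim (\<lambda>n. I (real n) \<omega>)"

definition Vinf :: real where "Vinf = (SUP n. V (real n))"

lemma V_bounded: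
  assumes t: "0 \<le> t"
  shows "V t \<le> enn2real (\<integral>\<^sup>+ \<omega>. (\<integral>\<^sup>+ t\<in>{0..}. ennreal ((X t \<omega>)\<^sup>2) \<partial>lborel) \<partial>M)"
proof -
  have "ennreal (V t) = (\<integral>\<^sup>+ \<omega>. ennreal (LINT s:{0..t}|lborel. (X s \<omega>)\<^sup>2) \<partial>M)"
    unfolding V_def using integral_X2(1)[OF order_refl t]
    by (intro nn_integral_eq_integral[symmetric]) (auto simp: set_lebesgue_integral_def intro!: AE_I2 integral_nonneg_AE)
  also have "\<dots> \<le> (\<integral>\<^sup>+ \<omega>. (\<integral>\<^sup>+ t\<in>{0..}. ennreal ((X t \<omega>)\<^sup>2) \<partial>lborel) \<partial>M)"
  proof (rule nn_integral_mono)
    fix \<omega> assume w: "\<omega> \<in> space M"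
    have "ennreal (LINT s:{0..t}|lborel. (X s \<omega>)\<^sup>2) = (\<integral>\<^sup>+ s. ennreal (indicator {0..t} s *\<^sub>R (X s \<omega>)\<^sup>2) \<partial>lborel)"
      using X2_integrable[OF w order_refl, of t] unfolding set_lebesgue_integral_def set_integrable_def
      by (intro nn_integral_eq_integral[symmetric]) auto
    also have "\<dots> \<le> (\<integral>\<^sup>+ t\<in>{0..}. ennreal ((X t \<omega>)\<^sup>2) \<partial>lborel)"
      by (intro nn_integral_mono) (auto simp: indicator_def)
    finally show "ennreal (LINT s:{0..t}|lborel. (X s \<omega>)\<^sup>2) \<le> (\<integral>\<^sup>+ t\<in>{0..}. ennreal ((X t \<omega>)\<^sup>2) \<partial>lborel)" .
  qed
  finally have "ennreal (V t) \<le> (\<integral>\<^sup>+ \<omega>. (\<integral>\<^sup>+ t\<in>{0..}. ennreal ((X t \<omega>)\<^sup>2) \<partial>lborel) \<partial>M)" .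
  from enn2real_mono[OF this] show ?thesis
    using fin by (simp add: V_def set_lebesgue_integral_def)
qed

lemma V_le_Vinf: "0 \<le> t \<Longrightarrow> V t \<le> Vinf"
proof -
  assume t: "0 \<le> t"
  obtain n where n: "t \<le> real n" using real_arch_simple by blast
  have "V t \<le> V (real n)" using V_mono[OF t n] .
  also have "\<dots> \<le> Vinf" unfolding Vinf_def
    by (rule cSUP_upper) (auto intro!: bdd_aboveI V_bounded)
  finally show ?thesis .
qed

lemma V_tendsto: "(\<lambda>n. V (real n)) \<longlonglongrightarrow> Vinf"
  unfolding Vinf_def
  by (rule LIMSEQ_incseq_SUP) (auto intro!: bdd_aboveI V_bounded V_mono simp: incseq_def)

lemma I_tail:
  assumes S: "0 \<le> S" and a: "a > 0"
  shows "{\<omega>\<in>space M. \<exists>t\<ge>S. a < (I t \<omega> - I S \<omega>)\<^sup>2} \<in> sets M"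
    and "a * prob {\<omega>\<in>space M. \<exists>t\<ge>S. a < (I t \<omega> - I S \<omega>)\<^sup>2} \<le> Vinf - V S"
proof -
  define B where "B n = {\<omega>\<in>space M. \<exists>t\<in>{S..S + real n}. a < (I t \<omega> - I S \<omega>)\<^sup>2}" for n
  have BM: "B n \<in> sets M" for n unfolding B_def using S a by (intro I_maximal(1)) auto
  have un: "{\<omega>\<in>space M. \<exists>t\<ge>S. a < (I t \<omega> - I S \<omega>)\<^sup>2} = (\<Union>n. B n)"
  proof (intro equalityI subsetI)
    fix \<omega> assume "\<omega> \<in> {\<omega>\<in>space M. \<exists>t\<ge>S. a < (I t \<omega> - I S \<omega>)\<^sup>2}"
    then obtain t where t: "\<omega> \<in> space M" "t \<ge> S" "a < (I t \<omega> - I S \<omega>)\<^sup>2" by auto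
    obtain n where "t - S \<le> real n" using real_arch_simple by blast
    then have "\<omega> \<in> B n" using t by (auto simp: B_def intro!: bexI[of _ t])
    then show "\<omega> \<in> (\<Union>n. B n)" by auto
  qed (auto simp: B_def)
  show "{\<omega>\<in>space M. \<exists>t\<ge>S. a < (I t \<omega> - I S \<omega>)\<^sup>2} \<in> sets M"
    unfolding un using BM by auto
  have "incseq B" unfolding incseq_def B_def by (auto intro!: bexI)
  then have "(\<lambda>n. a * prob (B n)) \<longlonglongrightarrow> a * prob (\<Union>n. B n)"
    using BM by (intro tendsto_intros finite_Lim_measure_incseq) auto
  moreover have "a * prob (B n) \<le> Vinf - V S" for n
  proof -
    have "a * prob (B n) \<le> V (S + real n) - V S" unfolding B_def using S a by (intro I_maximal(2)) auto
    then show ?thesis using V_le_Vinf[of "S + real n"] S by simp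
  qed
  ultimately show "a * prob {\<omega>\<in>space M. \<exists>t\<ge>S. a < (I t \<omega> - I S \<omega>)\<^sup>2} \<le> Vinf - V S"
    unfolding un by (intro LIMSEQ_le_const2) auto
qed

text \<open>Martingale convergence by hand: \<open>I_tail\<close> bounds the probability of a large
  oscillation after \<open>S\<close> through the remaining variance \<open>Vinf - V S\<close>, and
  Borel-Cantelli along suitable times gives the Cauchy property.\<close>

lemma I_tendsto_Iinf: "AE \<omega> in M. ((\<lambda>t. I t \<omega>) \<longlongrightarrow> Iinf \<omega>) at_top"
proof -
  have "\<exists>n::nat. Vinf - V (real n) < (1 / 8) ^ k" for k :: nat
  proof -
    have "(\<lambda>n. Vinf - V (real n)) \<longlonglongrightarrow> Vinf - Vinf" by (intro tendsto_intros V_tendsto)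
    then have "eventually (\<lambda>n. Vinf - V (real n) < (1 / 8) ^ k) sequentially"
      by (intro order_tendstoD(2)[where y="Vinf - Vinf"]) auto
    then show ?thesis by (auto simp: eventually_sequentially)
  qed
  \<comment> \<open>At level \<open>(1 / 4) ^ k\<close> for the squared oscillation this rate leaves
    exceptional events of probability at most \<open>(1 / 2) ^ k\<close>, off which the oscillation
    is at most \<open>(1 / 2) ^ k\<close>.\<close>
  then obtain N where N: "\<And>k. Vinf - V (real (N k)) < (1 / 8) ^ k" by metis
  define S where "S k = real (N k)" for k
  define A where "A k = {\<omega>\<in>space M. \<exists>t\<ge>S k. (1 / 4) ^ k < (I t \<omega> - I (S k) \<omega>)\<^sup>2}" for k :: nat
  have AM: "A k \<in> sets M" for k unfolding A_def by (intro I_tail(1)) (auto simp: S_def)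
  have "prob (A k) \<le> (1 / 2) ^ k" for k
  proof -
    have "(1 / 4) ^ k * prob (A k) \<le> Vinf - V (S k)" unfolding A_def by (intro I_tail(2)) (auto simp: S_def)
    also have "\<dots> \<le> (1 / 8) ^ k" using N[of k] by (simp add: S_def)
    also have "(1 / 8 :: real) ^ k = (1 / 4) ^ k * (1 / 2) ^ k" by (simp add: power_mult_distrib[symmetric])
    finally show ?thesis by simp
  qed
  then have Ap: "norm (prob (A k)) \<le> (1 / 2) ^ k" for k by simp
  have "summable (\<lambda>k. (1 / 2 :: real) ^ k)" by (rule summable_geometric) simp
  then have "summable (\<lambda>k. prob (A k))" by (rule summable_comparison_test'[where N=0]) (rule Ap)
  then have "AE \<omega> in M. eventually (\<lambda>k. \<omega> \<in> space M - A k) sequentially"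
    using AM by (intro borel_cantelli_AE1) (auto simp: emeasure_eq_measure)
  then show ?thesis
  proof eventually_elim
    case (elim \<omega>)
    then obtain K where K: "\<And>k. k \<ge> K \<Longrightarrow> \<omega> \<in> space M - A k" by (auto simp: eventually_sequentially)
    have osc: "\<bar>I t \<omega> - I (S k) \<omega>\<bar> \<le> (1 / 2) ^ k" if "k \<ge> K" "t \<ge> S k" for k t
    proof -
      have "(I t \<omega> - I (S k) \<omega>)\<^sup>2 \<le> (1 / 4) ^ k" using K[OF that(1)] that(2) by (auto simp: A_def not_less)
      also have "(1 / 4 :: real) ^ k = ((1 / 2) ^ k)\<^sup>2" by (simp add: power_divide power2_eq_square power_mult_distrib[symmetric])
      finally show ?thesis by (simp add: abs_le_square_iff[symmetric])
    qed
    have small: "\<exists>k\<ge>K. (1 / 2 :: real) ^ k < e" if e: "e > 0" for e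
    proof -
      have "(\<lambda>k. (1 / 2 :: real) ^ k) \<longlonglongrightarrow> 0" by (intro LIMSEQ_power_zero) simp
      then have "eventually (\<lambda>k. (1 / 2 :: real) ^ k < e) sequentially" using e by (rule order_tendstoD(2))
      then obtain k0 where "\<And>k. k \<ge> k0 \<Longrightarrow> (1 / 2 :: real) ^ k < e" by (auto simp: eventually_sequentially)
      then show ?thesis by (intro exI[of _ "max K k0"]) auto
    qed
    have "Cauchy (\<lambda>n. I (real n) \<omega>)"
    proof (rule metric_CauchyI)
      fix e :: real assume e: "e > 0"
      obtain k where k: "k \<ge> K" "(1 / 2 :: real) ^ k < e / 2" using small[of "e / 2"] e by auto
      have "dist (I (real m) \<omega>) (I (real n) \<omega>) < e" if "m \<ge> N k" "n \<ge> N k" for m n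
        using osc[OF k(1), of "real m"] osc[OF k(1), of "real n"] that k(2)
        by (auto simp: S_def dist_real_def abs_if split: if_splits)
      then show "\<exists>M. \<forall>m\<ge>M. \<forall>n\<ge>M. dist (I (real m) \<omega>) (I (real n) \<omega>) < e" by blast
    qed
    then have lim: "(\<lambda>n. I (real n) \<omega>) \<longlonglongrightarrow> Iinf \<omega>"
      unfolding Iinf_def by (simp add: Cauchy_convergent_iff convergent_LIMSEQ_iff)
    show ?case
    proof (rule tendstoI)
      fix e :: real assume e: "e > 0"
      obtain k where k: "k \<ge> K" "(1 / 2 :: real) ^ k < e / 2" using small[of "e / 2"] e by auto
      have l: "\<bar>Iinf \<omega> - I (S k) \<omega>\<bar> \<le> (1 / 2) ^ k"
      proof (rule LIMSEQ_le_const2)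
        show "(\<lambda>n. \<bar>I (real n) \<omega> - I (S k) \<omega>\<bar>) \<longlonglongrightarrow> \<bar>Iinf \<omega> - I (S k) \<omega>\<bar>"
          by (intro tendsto_intros lim)
        show "\<exists>N. \<forall>n\<ge>N. \<bar>I (real n) \<omega> - I (S k) \<omega>\<bar> \<le> (1 / 2) ^ k"
          using osc[OF k(1)] by (auto simp: S_def intro!: exI[of _ "N k"])
      qed
      show "eventually (\<lambda>t. dist (I t \<omega>) (Iinf \<omega>) < e) at_top"
        using eventually_ge_at_top[of "S k"]
      proof eventually_elim
        case (elim t)
        show ?case using osc[OF k(1) elim] l k(2) by (auto simp: dist_real_def abs_if split: if_splits)
      qed
    qed
  qed
qed

lemma Iinf_M: "Iinf \<in> borel_measurable M"
  unfolding Iinf_def[abs_def] by (intro borel_measurable_lim_metric I_M) simp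

lemma Iinf_tail_square:
  assumes T: "0 \<le> T"
  shows "integrable M (\<lambda>\<omega>. (Iinf \<omega> - I T \<omega>)\<^sup>2)" "(\<integral>\<omega>. (Iinf \<omega> - I T \<omega>)\<^sup>2 \<partial>M) \<le> Vinf - V T"
proof -
  let ?f = "\<lambda>n \<omega>. I (T + real n) \<omega> - I T \<omega>"
  have m: "?f n \<in> borel_measurable M" "(\<lambda>\<omega>. Iinf \<omega> - I T \<omega>) \<in> borel_measurable M" for n
    using I_M Iinf_M T by simp_all
  have fl: "filterlim (\<lambda>n. T + real n) at_top sequentially"
    by (intro filterlim_tendsto_add_at_top[OF tendsto_const] filterlim_real_sequentially)
  have lim: "AE \<omega> in M. (\<lambda>n. ?f n \<omega>) \<longlonglongrightarrow> Iinf \<omega> - I T \<omega>"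
    using I_tendsto_Iinf
  proof eventually_elim
    case (elim \<omega>)
    then show ?case by (intro tendsto_diff tendsto_const filterlim_compose[OF elim fl])
  qed
  have i: "integrable M (\<lambda>\<omega>. (?f n \<omega>)\<^sup>2)" for n using T by (intro J_I_square(1)) auto
  have B: "(\<integral>\<omega>. (?f n \<omega>)\<^sup>2 \<partial>M) \<le> Vinf - V T" for n
    using I_isometry[of T "T + real n"] V_le_Vinf[of "T + real n"] T by simp
  show "integrable M (\<lambda>\<omega>. (Iinf \<omega> - I T \<omega>)\<^sup>2)" "(\<integral>\<omega>. (Iinf \<omega> - I T \<omega>)\<^sup>2 \<partial>M) \<le> Vinf - V T"
    by (rule fatou_square[OF m(1) m(2) lim i B])+
qed

lemma I_square: "0 \<le> T \<Longrightarrow> integrable M (\<lambda>\<omega>. (I T \<omega>)\<^sup>2)"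
  using J_I_square(1)[of 0 T] I_0
  by (subst Bochner_Integration.integrable_cong[where g="\<lambda>\<omega>. (I T \<omega> - I 0 \<omega>)\<^sup>2"]) auto

lemma Iinf_square_integrable: "integrable M (\<lambda>\<omega>. (Iinf \<omega>)\<^sup>2)"
proof -
  have "integrable M (\<lambda>\<omega>. ((Iinf \<omega> - I 0 \<omega>) + I 0 \<omega>)\<^sup>2)"
    using Iinf_tail_square(1)[of 0] I_square[of 0] I_M[of 0] Iinf_M
    by (intro integrable_square_add) auto
  then show ?thesis by simp
qed

lemma V_0: "V 0 = 0"
  by (simp add: V_def set_integral_singleton)

lemma I_tendsto_square: "(\<lambda>n. \<integral>\<omega>. (I (real n) \<omega> - Iinf \<omega>)\<^sup>2 \<partial>M) \<longlonglongrightarrow> 0"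
proof (rule tendsto_sandwich[OF _ _ tendsto_const])
  have "(\<lambda>n. Vinf - V (real n)) \<longlonglongrightarrow> Vinf - Vinf" by (intro tendsto_intros V_tendsto)
  then show "(\<lambda>n. Vinf - V (real n)) \<longlonglongrightarrow> 0" by simp
  show "eventually (\<lambda>n. (\<integral>\<omega>. (I (real n) \<omega> - Iinf \<omega>)\<^sup>2 \<partial>M) \<le> Vinf - V (real n)) sequentially"
    using Iinf_tail_square(2) by (intro always_eventually allI) (simp add: power2_commute)
qed (auto intro!: always_eventually)

lemma Iinf_square: "(\<integral>\<omega>. (Iinf \<omega>)\<^sup>2 \<partial>M) = Vinf"
proof (rule LIMSEQ_unique)
  show "(\<lambda>n. \<integral>\<omega>. (I (real n) \<omega>)\<^sup>2 \<partial>M) \<longlonglongrightarrow> (\<integral>\<omega>. (Iinf \<omega>)\<^sup>2 \<partial>M)"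
    using I_M Iinf_M I_square Iinf_square_integrable I_tendsto_square
    by (intro tendsto_integral_square) auto
  have "(\<integral>\<omega>. (I (real n) \<omega>)\<^sup>2 \<partial>M) = V (real n)" for n
  proof -
    have "(\<integral>\<omega>. (I (real n) \<omega>)\<^sup>2 \<partial>M) = (\<integral>\<omega>. (I (real n) \<omega> - I 0 \<omega>)\<^sup>2 \<partial>M)"
      by (intro Bochner_Integration.integral_cong) (auto simp: I_0)
    then show ?thesis using I_isometry[of 0 "real n"] V_0 by simp
  qed
  then show "(\<lambda>n. \<integral>\<omega>. (I (real n) \<omega>)\<^sup>2 \<partial>M) \<longlonglongrightarrow> Vinf" using V_tendsto by simp
qed

text \<open>Lets a density known at time \<open>T\<close> ignore whatever the stochastic integral
  collects after \<open>T\<close>.\<close>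

lemma Iinf_orth:
  assumes T: "0 \<le> T" and Y: "Y \<in> borel_measurable (F T)" "integrable M (\<lambda>\<omega>. (Y \<omega>)\<^sup>2)"
  shows "integrable M (\<lambda>\<omega>. Y \<omega> * (Iinf \<omega> - I T \<omega>))" "(\<integral>\<omega>. Y \<omega> * (Iinf \<omega> - I T \<omega>) \<partial>M) = 0"
proof -
  have YM: "Y \<in> borel_measurable M" using F_M[OF T Y(1)] .
  have IM: "I T \<in> borel_measurable M" using I_M[OF T] .
  show i: "integrable M (\<lambda>\<omega>. Y \<omega> * (Iinf \<omega> - I T \<omega>))"
    using YM IM Iinf_M Y Iinf_tail_square[OF T] by (intro integrable_square_mult) auto
  have d2: "integrable M (\<lambda>\<omega>. (I (real n) \<omega> - Iinf \<omega>)\<^sup>2)" for n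
    using I_M Iinf_M I_square Iinf_square_integrable by (intro integrable_square_diff) auto
  have "(\<lambda>n. \<integral>\<omega>. Y \<omega> * (I (real n) \<omega> - Iinf \<omega>) \<partial>M) \<longlonglongrightarrow> 0"
    using YM Y I_M Iinf_M d2 I_tendsto_square
    by (intro tendsto_integral_mult_zero[where B="\<integral>\<omega>. (Y \<omega>)\<^sup>2 \<partial>M"]) auto
  moreover have "eventually (\<lambda>n. (\<integral>\<omega>. Y \<omega> * (I (real n) \<omega> - Iinf \<omega>) \<partial>M) = - (\<integral>\<omega>. Y \<omega> * (Iinf \<omega> - I T \<omega>) \<partial>M)) sequentially"
  proof (rule eventually_sequentiallyI)
    fix n assume n: "n \<ge> nat \<lceil>T\<rceil>"
    then have Tn: "T \<le> real n" by linarith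
    have "(\<integral>\<omega>. Y \<omega> * (I (real n) \<omega> - Iinf \<omega>) \<partial>M) = (\<integral>\<omega>. Y \<omega> * (I (real n) \<omega> - I T \<omega>) - Y \<omega> * (Iinf \<omega> - I T \<omega>) \<partial>M)"
      by (intro Bochner_Integration.integral_cong) (auto simp: algebra_simps)
    also have "\<dots> = - (\<integral>\<omega>. Y \<omega> * (Iinf \<omega> - I T \<omega>) \<partial>M)"
      using I_orth[OF T Tn Y] i by simp
    finally show "(\<integral>\<omega>. Y \<omega> * (I (real n) \<omega> - Iinf \<omega>) \<partial>M) = - (\<integral>\<omega>. Y \<omega> * (Iinf \<omega> - I T \<omega>) \<partial>M)" .
  qed
  ultimately have "(\<lambda>n::nat. - (\<integral>\<omega>. Y \<omega> * (Iinf \<omega> - I T \<omega>) \<partial>M)) \<longlonglongrightarrow> 0"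
    by (rule Lim_transform_eventually)
  then show "(\<integral>\<omega>. Y \<omega> * (Iinf \<omega> - I T \<omega>) \<partial>M) = 0" by (simp add: LIMSEQ_const_iff)
qed

lemma Iinf_mean: "has_bochner_integral M Iinf 0"
proof -
  have "has_bochner_integral M (\<lambda>\<omega>. 1 * (Iinf \<omega> - I 0 \<omega>)) 0"
    using Iinf_orth[of 0 "\<lambda>_. 1"] by (simp add: has_bochner_integral_iff)
  then show ?thesis by (rule has_bochner_integral_cong[THEN iffD1, rotated -1]) (auto simp: I_0)
qed

end

section \<open>Exponential moments\<close>

text \<open>This is \<open>1 + s \<le> exp s\<close> at \<open>s = y - ln z\<close>, multiplied by
  \<open>z\<close>. Equality holds at \<open>z = exp y\<close>, so a good guess of the density loses
  nothing.\<close>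

lemma exp_ge_entropy:
  fixes y z :: real
  assumes "z > 0"
  shows "z * (1 + y - ln z) \<le> exp y"
proof -
  have "1 + (y - ln z) \<le> exp (y - ln z)" by (rule exp_ge_add_one_self)
  then have "z * (1 + (y - ln z)) \<le> z * exp (y - ln z)" using assms by (intro mult_left_mono) auto
  also have "\<dots> = exp y" using assms by (simp add: exp_diff)
  finally show ?thesis by (simp add: algebra_simps)
qed

lemma ennreal_integral_le_nn_integral:
  fixes u :: "'a \<Rightarrow> real"
  assumes "integrable M u"
  shows "ennreal (\<integral>x. u x \<partial>M) \<le> (\<integral>\<^sup>+ x. ennreal (u x) \<partial>M)"
proof -
  have "ennreal (\<integral>x. u x \<partial>M) \<le> ennreal (\<integral>x. max 0 (u x) \<partial>M)"
    using assms by (intro ennreal_leI integral_mono) auto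
  also have "\<dots> = (\<integral>\<^sup>+ x. ennreal (max 0 (u x)) \<partial>M)"
    using assms by (intro nn_integral_eq_integral[symmetric]) auto
  also have "\<dots> = (\<integral>\<^sup>+ x. ennreal (u x) \<partial>M)"
    by (intro nn_integral_cong) (simp add: max_def ennreal_neg)
  finally show ?thesis .
qed

context l2_trading_process
begin

text \<open>For a deterministic integrand the exponential moment of \<open>J\<close> is explicit by
  \<open>discrete_exp_mean\<close>. Fatou's lemma is applied first to the mesh, then to the horizon;
  it yields an upper bound, the direction the comparison asks of the candidate.\<close>

lemma exp_Iinf_le:
  assumes det: "\<And>t \<omega>. 0 \<le> t \<Longrightarrow> \<omega> \<in> space M \<Longrightarrow> X t \<omega> = g t"
  shows "(\<integral>\<^sup>+ \<omega>. ennreal (exp (c * Iinf \<omega>)) \<partial>M) \<le> ennreal (exp (c\<^sup>2 / 2 * Vinf))"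
proof -
  have VT: "V T = (LINT s:{0..T}|lborel. (g s)\<^sup>2)" if "0 \<le> T" for T
  proof -
    have "V T = (\<integral>\<omega>. (LINT s:{0..T}|lborel. (g s)\<^sup>2) \<partial>M)"
      unfolding V_def by (intro Bochner_Integration.integral_cong set_lebesgue_integral_cong) (auto simp: det)
    then show ?thesis by (simp add: prob_space)
  qed
  obtain \<omega>0 where w0: "\<omega>0 \<in> space M" using not_empty by auto
  have step: "(\<integral>\<^sup>+ \<omega>. ennreal (exp (c * I T \<omega>)) \<partial>M) \<le> ennreal (exp (c\<^sup>2 / 2 * Vinf))" if T: "0 \<le> T" for T
  proof -
    let ?G = "\<lambda>n. \<Sum>k<n. (g (grid 0 T n k))\<^sup>2 * ((T - 0) / real n)"
    have G: "?G \<longlonglongrightarrow> V T"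
    proof -
      have "continuous_on {0..T} (\<lambda>t. (g t)\<^sup>2)"
        by (intro continuous_intros continuous_on_eq[OF X_continuous[OF w0 order_refl]]) (simp add: det w0)
      then show ?thesis unfolding VT[OF T] by (rule riemann_sum_limit[OF order_refl T])
    qed
    have EJ: "(\<integral>\<^sup>+ \<omega>. ennreal (exp (c * J 0 T n \<omega>)) \<partial>M) = ennreal (exp (c\<^sup>2 / 2 * ?G n))" for n
    proof -
      let ?s = "grid 0 T n"
      let ?Z = "\<lambda>\<omega>. exp (\<Sum>k<n. (c * g (?s k)) * (W (?s (Suc k)) \<omega> - W (?s k) \<omega>) - (c * g (?s k))\<^sup>2 * (?s (Suc k) - ?s k) / 2)"
      have hz: "has_bochner_integral M ?Z 1"
        by (rule discrete_exp_mean[where s="?s" and \<psi>="\<lambda>k. c * g (?s k)"])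
           (use T grid_nonneg grid_mono in auto)
      have eq: "exp (c * J 0 T n \<omega>) = ?Z \<omega> * exp (c\<^sup>2 / 2 * ?G n)" if "\<omega> \<in> space M" for \<omega>
        unfolding exp_add[symmetric] J_def grid_Suc_diff sum_distrib_left sum.distrib[symmetric]
        using det[OF grid_nonneg[OF order_refl T] that]
        by (intro arg_cong[where f=exp] sum.cong) (auto simp: power_mult_distrib)
      have "(\<integral>\<^sup>+ \<omega>. ennreal (exp (c * J 0 T n \<omega>)) \<partial>M) = (\<integral>\<^sup>+ \<omega>. ennreal (?Z \<omega> * exp (c\<^sup>2 / 2 * ?G n)) \<partial>M)"
        by (intro nn_integral_cong) (simp add: eq)
      also have "\<dots> = ennreal (\<integral>\<omega>. ?Z \<omega> * exp (c\<^sup>2 / 2 * ?G n) \<partial>M)"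
        using hz by (intro nn_integral_eq_integral integrable_mult_left) (auto simp: has_bochner_integral_iff)
      also have "(\<integral>\<omega>. ?Z \<omega> * exp (c\<^sup>2 / 2 * ?G n) \<partial>M) = 1 * exp (c\<^sup>2 / 2 * ?G n)"
        using has_bochner_integral_mult_left[OF hz, of "exp (c\<^sup>2 / 2 * ?G n)"] by (simp add: has_bochner_integral_iff)
      finally show ?thesis by simp
    qed
    have "(\<integral>\<^sup>+ \<omega>. ennreal (exp (c * I T \<omega>)) \<partial>M) = (\<integral>\<^sup>+ \<omega>. liminf (\<lambda>n. ennreal (exp (c * J 0 T n \<omega>))) \<partial>M)"
    proof (rule nn_integral_cong)
      fix \<omega> assume w: "\<omega> \<in> space M"
      have "(\<lambda>n. ennreal (exp (c * J 0 T n \<omega>))) \<longlonglongrightarrow> ennreal (exp (c * (I T \<omega> - I 0 \<omega>)))"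
        by (intro tendsto_ennrealI tendsto_intros J_lim[OF w order_refl T])
      then show "ennreal (exp (c * I T \<omega>)) = liminf (\<lambda>n. ennreal (exp (c * J 0 T n \<omega>)))"
        using I_0[OF w] by (intro lim_imp_Liminf[symmetric]) auto
    qed
    also have "\<dots> \<le> liminf (\<lambda>n. \<integral>\<^sup>+ \<omega>. ennreal (exp (c * J 0 T n \<omega>)) \<partial>M)"
      using F_M[OF T J_F[OF order_refl T]] by (intro nn_integral_liminf) simp
    also have "\<dots> = ennreal (exp (c\<^sup>2 / 2 * V T))"
      unfolding EJ by (intro lim_imp_Liminf tendsto_ennrealI tendsto_intros G) simp
    also have "\<dots> \<le> ennreal (exp (c\<^sup>2 / 2 * Vinf))"
      using V_le_Vinf[OF T] by (intro ennreal_leI) (simp add: mult_left_mono)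
    finally show ?thesis .
  qed
  have "(\<integral>\<^sup>+ \<omega>. ennreal (exp (c * Iinf \<omega>)) \<partial>M) = (\<integral>\<^sup>+ \<omega>. liminf (\<lambda>n. ennreal (exp (c * I (real n) \<omega>))) \<partial>M)"
  proof (rule nn_integral_cong_AE)
    show "AE \<omega> in M. ennreal (exp (c * Iinf \<omega>)) = liminf (\<lambda>n. ennreal (exp (c * I (real n) \<omega>)))"
      using I_tendsto_Iinf
    proof eventually_elim
      case (elim \<omega>)
      have "(\<lambda>n. ennreal (exp (c * I (real n) \<omega>))) \<longlonglongrightarrow> ennreal (exp (c * Iinf \<omega>))"
        by (intro tendsto_ennrealI tendsto_intros filterlim_compose[OF elim filterlim_real_sequentially])
      then show ?case by (intro lim_imp_Liminf[symmetric]) auto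
    qed
  qed
  also have "\<dots> \<le> liminf (\<lambda>n. \<integral>\<^sup>+ \<omega>. ennreal (exp (c * I (real n) \<omega>)) \<partial>M)"
    using I_M by (intro nn_integral_liminf) simp
  also have "\<dots> \<le> liminf (\<lambda>n::nat. ennreal (exp (c\<^sup>2 / 2 * Vinf)))"
    by (intro Liminf_mono always_eventually allI step) simp
  also have "\<dots> = ennreal (exp (c\<^sup>2 / 2 * Vinf))" by (simp add: Liminf_const)
  finally show ?thesis .
qed

text \<open>Entropy form of Girsanov's theorem: \<open>exp y \<ge> z (1 + y - ln z)\<close> is applied with \<open>z\<close> a discretised
  stochastic exponential of \<open>\<beta> g\<close> up to a finite time, so that no integrability beyond \<open>L\<^sup>2\<close> is needed of the
  stochastic integral of \<open>X\<close>.\<close>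

lemma
  fixes \<beta> :: real
  assumes gc: "continuous_on {0..} g" and gi: "set_integrable lborel {0..} g"
    and g2: "set_integrable lborel {0..} (\<lambda>t. (g t)\<^sup>2)" and gb: "\<And>t. 0 \<le> t \<Longrightarrow> \<bar>g t\<bar> \<le> D"
  shows ip_measurable: "(\<lambda>\<omega>. ip g (\<lambda>t. X t \<omega>)) \<in> borel_measurable M"
    and exp_Iinf_ge: "1 \<le> (\<integral>\<^sup>+ \<omega>. ennreal (exp (\<beta>\<^sup>2 / 2 * ip g g + \<beta> * Iinf \<omega> - \<beta>\<^sup>2 * ip g (\<lambda>t. X t \<omega>))) \<partial>M)" (is "1 \<le> ?E")
proof -
  have gcI: "continuous_on {0..T} g" for T by (rule continuous_on_subset[OF gc]) auto
  define L where "L = (LINT t:{0..}|lborel. \<bar>g t\<bar>)"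
  have gai: "set_integrable lborel {0..} (\<lambda>t. \<bar>g t\<bar>)" using gi by (rule set_integrable_abs)
  define P where "P T \<omega> = (LINT t:{0..T}|lborel. g t * X t \<omega>)" for T \<omega>
  define Pinf where "Pinf \<omega> = ip g (\<lambda>t. X t \<omega>)" for \<omega>
  have Xm: "set_borel_measurable lborel {0..} (\<lambda>t. X t \<omega>)" if "\<omega> \<in> space M" for \<omega>
    unfolding set_borel_measurable_def
    using borel_measurable_continuous_on_indicator[OF _ ac_rate_continuous[OF ac[OF that]]] by simp
  have gX: "set_integrable lborel {0..} (\<lambda>t. g t * X t \<omega>)" if w: "\<omega> \<in> space M" for \<omega>
  proof (rule set_integrable_bound)
    show "set_integrable lborel {0..} (\<lambda>t. C * g t)" using gi by simp
    show "set_borel_measurable lborel {0..} (\<lambda>t. g t * X t \<omega>)"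
      using gi Xm[OF w]
      by (intro set_borel_measurable_mult) (auto simp: set_integrable_def set_borel_measurable_def)
    show "AE t in lborel. t \<in> {0..} \<longrightarrow> norm (g t * X t \<omega>) \<le> norm (C * g t)"
      using bdd[OF _ w] C_nonneg by (intro AE_I2) (auto simp: abs_mult mult.commute[of "\<bar>g _\<bar>"] intro!: mult_right_mono)
  qed
  have P_lim: "((\<lambda>T. P T \<omega>) \<longlongrightarrow> Pinf \<omega>) at_top" if "\<omega> \<in> space M" for \<omega>
    unfolding P_def Pinf_def ip_def by (rule tendsto_set_lebesgue_integral_at_top) (use gX[OF that] in auto)
  let ?Q = "\<lambda>T n \<omega>. \<Sum>k<n. X (grid 0 T n k) \<omega> * g (grid 0 T n k) * ((T - 0) / real n)"
  have Q_lim: "(\<lambda>n. ?Q T n \<omega>) \<longlonglongrightarrow> P T \<omega>" if "\<omega> \<in> space M" "0 \<le> T" for T \<omega>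
    using riemann_sum_limit[of 0 T "\<lambda>t. X t \<omega> * g t"] X_continuous[OF that(1) order_refl, of T] gcI[of T] that
    by (simp add: P_def continuous_on_mult mult.commute)
  have D0: "0 \<le> D" using gb[of 0] by linarith
  have Q_bd: "\<bar>?Q T n \<omega>\<bar> \<le> C * D * T" if "\<omega> \<in> space M" "0 \<le> T" for T n \<omega>
  proof -
    have "\<bar>?Q T n \<omega>\<bar> \<le> (\<Sum>k<n. \<bar>X (grid 0 T n k) \<omega> * g (grid 0 T n k) * ((T - 0) / real n)\<bar>)" by (rule sum_abs)
    also have "\<dots> \<le> (\<Sum>k<n. C * D * (T / real n))"
      using bdd[OF grid_nonneg[OF order_refl that(2)] that(1)] gb[OF grid_nonneg[OF order_refl that(2)]] that C_nonneg
      by (intro sum_mono) (auto simp: abs_mult intro!: mult_right_mono mult_mono divide_right_mono)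
    also have "\<dots> \<le> C * D * T" using that C_nonneg D0 by simp
    finally show ?thesis .
  qed
  have QM: "?Q T n \<in> borel_measurable M" if "0 \<le> T" for T n
    using X_M[OF grid_nonneg[OF order_refl that]] by simp
  have PM: "P T \<in> borel_measurable M" if "0 \<le> T" for T
    by (rule borel_measurable_LIMSEQ_real[OF Q_lim[OF _ that] QM[OF that]])
  have PinfM: "Pinf \<in> borel_measurable M"
    by (rule borel_measurable_LIMSEQ_real[OF filterlim_compose[OF P_lim filterlim_real_sequentially] PM]) simp_all
  then show "(\<lambda>\<omega>. ip g (\<lambda>t. X t \<omega>)) \<in> borel_measurable M" by (simp add: Pinf_def[abs_def])
  have P_bd: "\<bar>P T \<omega>\<bar> \<le> C * D * T" if "\<omega> \<in> space M" "0 \<le> T" for T \<omega>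
    by (rule LIMSEQ_le_const2[OF tendsto_rabs[OF Q_lim[OF that]]]) (use Q_bd[OF that] in auto)
  \<comment> \<open>The mass of \<open>\<bar>g t\<bar>\<close> after \<open>T\<close>. With the
    bound \<open>C\<close> on \<open>X\<close> it controls the tail of the pairing of
    \<open>g\<close> and \<open>X\<close> uniformly in the sample point; this is the use made of
    integrability of \<open>g\<close>.\<close>
  define L' where "L' T = L - (LINT t:{0..T}|lborel. \<bar>g t\<bar>)" for T
  have L'_lim: "(\<lambda>N. L' (real N)) \<longlonglongrightarrow> 0"
  proof -
    have "((\<lambda>T. LINT t:{0..T}|lborel. \<bar>g t\<bar>) \<longlongrightarrow> L) at_top"
      unfolding L_def by (rule tendsto_set_lebesgue_integral_at_top) (use gai in auto)
    then have "(\<lambda>N. L - (LINT t:{0..real N}|lborel. \<bar>g t\<bar>)) \<longlonglongrightarrow> L - L"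
      by (intro tendsto_intros filterlim_compose[OF _ filterlim_real_sequentially])
    then show ?thesis by (simp add: L'_def)
  qed
  have tail: "\<bar>P T \<omega> - Pinf \<omega>\<bar> \<le> C * L' T" if w: "\<omega> \<in> space M" and T: "0 \<le> T" for T \<omega>
  proof -
    have un: "{0..} = {0..T} \<union> {T<..}" "{0..T} \<inter> {T<..} = {}" using T by auto
    have i1: "set_integrable lborel {0..T} u" "set_integrable lborel {T<..} u"
      if "set_integrable lborel {0..} u" for u :: "real \<Rightarrow> real"
      by (rule set_integrable_subset[OF that]; use T in auto)+
    have split: "(LINT t:{0..}|lborel. u t) = (LINT t:{0..T}|lborel. u t) + (LINT t:{T<..}|lborel. u t)"
      if "set_integrable lborel {0..} u" for u :: "real \<Rightarrow> real"
      unfolding un(1) by (rule set_integral_Un[OF un(2) i1[OF that]])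
    have "P T \<omega> - Pinf \<omega> = - (LINT t:{T<..}|lborel. g t * X t \<omega>)"
      unfolding P_def Pinf_def ip_def split[OF gX[OF w]] by simp
    also have "\<bar>\<dots>\<bar> \<le> (LINT t:{T<..}|lborel. \<bar>g t * X t \<omega>\<bar>)"
      using integral_abs_bound[of lborel "\<lambda>t. indicator {T<..} t *\<^sub>R (g t * X t \<omega>)"]
      unfolding set_lebesgue_integral_def by (simp add: abs_mult)
    also have "\<dots> \<le> (LINT t:{T<..}|lborel. C * \<bar>g t\<bar>)"
      using bdd[OF _ w] T i1(2)[OF gi] i1(2)[OF gX[OF w]]
      by (intro set_integral_mono set_integrable_abs set_integrable_mult_right)
         (auto simp: abs_mult mult.commute[of "\<bar>g _\<bar>"] intro!: mult_right_mono)
    also have "\<dots> = C * L' T" unfolding L'_def L_def split[OF gai] by simp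
    finally show ?thesis .
  qed
  \<comment> \<open>The entropy inequality at a fixed horizon: the mesh tends to 0 inside this step,
    \<open>T\<close> to infinity at the very end.\<close>
  have main: "ennreal (1 + (\<beta>\<^sup>2 / 2 * (ip g g - (LINT t:{0..T}|lborel. (g t)\<^sup>2)) - \<beta>\<^sup>2 * (C * L' T))) \<le> ?E"
    if T: "0 \<le> T" for T
  proof -
    let ?G = "\<lambda>n. \<Sum>k<n. (g (grid 0 T n k))\<^sup>2 * ((T - 0) / real n)"
    have G_lim: "?G \<longlonglongrightarrow> (LINT t:{0..T}|lborel. (g t)\<^sup>2)"
      using riemann_sum_limit[of 0 T "\<lambda>t. (g t)\<^sup>2"] T gcI[of T] by (simp add: continuous_on_power)
    have G_bd: "?G n \<le> D\<^sup>2 * T" for n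
    proof -
      have "?G n \<le> (\<Sum>k<n. D\<^sup>2 * (T / real n))"
        using gb[OF grid_nonneg[OF order_refl T]] T D0
        by (intro sum_mono) (auto simp: abs_le_square_iff[symmetric] intro!: mult_right_mono divide_right_mono)
      also have "\<dots> \<le> D\<^sup>2 * T" using T by simp
      finally show ?thesis .
    qed
    define Z where "Z n \<omega> = exp (\<Sum>k<n. (\<beta> * g (grid 0 T n k)) * (W (grid 0 T n (Suc k)) \<omega> - W (grid 0 T n k) \<omega>)
      - (\<beta> * g (grid 0 T n k))\<^sup>2 * (grid 0 T n (Suc k) - grid 0 T n k) / 2)" for n \<omega>
    define Jg where "Jg n \<omega> = (\<Sum>k<n. g (grid 0 T n k) * (W (grid 0 T n (Suc k)) \<omega> - W (grid 0 T n k) \<omega>))" for n \<omega>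
    have s: "0 \<le> grid 0 T n k" "grid 0 T n k \<le> grid 0 T n (Suc k)" for n k
      using T grid_nonneg grid_mono by auto
    have lnZ: "ln (Z n \<omega>) = \<beta> * Jg n \<omega> - \<beta>\<^sup>2 / 2 * ?G n" for n \<omega>
      unfolding Z_def ln_exp Jg_def grid_Suc_diff sum_distrib_left sum_subtractf[symmetric]
      by (intro sum.cong) (auto simp: power_mult_distrib)
    have Zp: "Z n \<omega> > 0" for n \<omega> by (simp add: Z_def)
    have ZF: "Z n \<in> borel_measurable (F T)" if "n > 0" for n
      using discrete_exp_F[where s="grid 0 T n" and \<psi>="\<lambda>k. \<beta> * g (grid 0 T n k)" and L=n, OF s] grid_last[OF that, of 0 T]
      by (simp add: Z_def[abs_def])
    have ZM: "Z n \<in> borel_measurable M" for n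
      using F_M[OF T ZF[of n]] by (cases "n = 0") (auto simp: Z_def[abs_def])
    have Z1: "has_bochner_integral M (Z n) 1" for n
      using discrete_exp_mean[where s="grid 0 T n" and \<psi>="\<lambda>k. \<beta> * g (grid 0 T n k)" and L=n, OF s] by (simp add: Z_def[abs_def])
    have Z2: "integrable M (\<lambda>\<omega>. (Z n \<omega>)\<^sup>2)" "(\<integral>\<omega>. (Z n \<omega>)\<^sup>2 \<partial>M) \<le> exp (\<beta>\<^sup>2 * (D\<^sup>2 * T))" for n
    proof -
      have h: "has_bochner_integral M (\<lambda>\<omega>. (Z n \<omega>)\<^sup>2) (exp (\<Sum>k<n. (\<beta> * g (grid 0 T n k))\<^sup>2 * (grid 0 T n (Suc k) - grid 0 T n k)))"
        using discrete_exp_square[where s="grid 0 T n" and \<psi>="\<lambda>k. \<beta> * g (grid 0 T n k)" and L=n, OF s] by (simp add: Z_def[abs_def])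
      then show "integrable M (\<lambda>\<omega>. (Z n \<omega>)\<^sup>2)" by (rule integrable.intros)
      have "(\<Sum>k<n. (\<beta> * g (grid 0 T n k))\<^sup>2 * (grid 0 T n (Suc k) - grid 0 T n k)) = \<beta>\<^sup>2 * ?G n"
        unfolding grid_Suc_diff sum_distrib_left by (intro sum.cong) (auto simp: power_mult_distrib)
      then show "(\<integral>\<omega>. (Z n \<omega>)\<^sup>2 \<partial>M) \<le> exp (\<beta>\<^sup>2 * (D\<^sup>2 * T))"
        using h G_bd[of n] by (simp add: has_bochner_integral_iff mult_left_mono)
    qed
    have girsX: "has_bochner_integral M (\<lambda>\<omega>. Z n \<omega> * J 0 T n \<omega>) (\<beta> * (\<integral>\<omega>. Z n \<omega> * ?Q T n \<omega> \<partial>M))" for n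
    proof -
      have "has_bochner_integral M (\<lambda>\<omega>. Z n \<omega> * J 0 T n \<omega>)
        (\<integral>\<omega>. Z n \<omega> * (\<Sum>k<n. X (grid 0 T n k) \<omega> * ((\<beta> * g (grid 0 T n k)) * (grid 0 T n (Suc k) - grid 0 T n k))) \<partial>M)"
        unfolding Z_def J_def
        by (rule discrete_girsanov[where s="grid 0 T n" and C=C]) (use s adapted bdd in auto)
      moreover have "(\<Sum>k<n. X (grid 0 T n k) \<omega> * ((\<beta> * g (grid 0 T n k)) * (grid 0 T n (Suc k) - grid 0 T n k))) = \<beta> * ?Q T n \<omega>" for \<omega>
        unfolding grid_Suc_diff sum_distrib_left by (intro sum.cong) auto
      ultimately show ?thesis by (simp add: mult.left_commute[of "Z n _" \<beta>])
    qed
    have girsg: "has_bochner_integral M (\<lambda>\<omega>. Z n \<omega> * Jg n \<omega>) (\<beta> * ?G n)" for n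
    proof -
      have "has_bochner_integral M (\<lambda>\<omega>. Z n \<omega> * Jg n \<omega>)
        (\<integral>\<omega>. Z n \<omega> * (\<Sum>k<n. g (grid 0 T n k) * ((\<beta> * g (grid 0 T n k)) * (grid 0 T n (Suc k) - grid 0 T n k))) \<partial>M)"
        unfolding Z_def Jg_def
        by (rule discrete_girsanov[where s="grid 0 T n" and C=D and h="\<lambda>k \<omega>. g (grid 0 T n k)"]) (use s gb in auto)
      moreover have "(\<Sum>k<n. g (grid 0 T n k) * ((\<beta> * g (grid 0 T n k)) * (grid 0 T n (Suc k) - grid 0 T n k))) = \<beta> * ?G n"
        unfolding grid_Suc_diff sum_distrib_left by (intro sum.cong) (auto simp: power2_eq_square)
      ultimately show ?thesis using Z1[of n] by (simp add: has_bochner_integral_iff)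
    qed
    have J2: "integrable M (\<lambda>\<omega>. (J 0 T n \<omega>)\<^sup>2)" and JM: "J 0 T n \<in> borel_measurable M" for n
      using J_square[OF order_refl T, of n] F_M[OF T J_F[OF order_refl T]] by (auto dest: integrable.intros)
    have I2: "integrable M (\<lambda>\<omega>. (I T \<omega>)\<^sup>2)" "I T \<in> borel_measurable M" using I_square[OF T] I_M[OF T] by auto
    have ID2: "integrable M (\<lambda>\<omega>. (I T \<omega> - J 0 T n \<omega>)\<^sup>2)" for n
      by (intro integrable_square_diff I2 J2 JM)
    have e1: "(\<lambda>n. \<integral>\<omega>. Z n \<omega> * (I T \<omega> - J 0 T n \<omega>) \<partial>M) \<longlonglongrightarrow> 0"
    proof (rule tendsto_integral_mult_zero[OF ZM _ Z2(1) ID2 Z2(2)])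
      have "(\<integral>\<omega>. (J 0 T n \<omega> - (I T \<omega> - I 0 \<omega>))\<^sup>2 \<partial>M) = (\<integral>\<omega>. (I T \<omega> - J 0 T n \<omega>)\<^sup>2 \<partial>M)" for n
        by (intro Bochner_Integration.integral_cong) (auto simp: I_0 power2_commute)
      then show "(\<lambda>n. \<integral>\<omega>. (I T \<omega> - J 0 T n \<omega>)\<^sup>2 \<partial>M) \<longlonglongrightarrow> 0"
        using J_I_square(3)[OF order_refl T] by simp
    qed (use I2 JM in simp)
    let ?B = "C * D * T"
    have QP_bd: "\<bar>?Q T n \<omega> - P T \<omega>\<bar> \<le> 2 * ?B" if "\<omega> \<in> space M" for n \<omega>
      using Q_bd[OF that T, of n] P_bd[OF that T] by linarith
    have QP2_bd: "(?Q T n \<omega> - P T \<omega>)\<^sup>2 \<le> (2 * ?B)\<^sup>2" if "\<omega> \<in> space M" for n \<omega>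
      using power_mono[OF QP_bd[OF that, of n] abs_ge_zero, of 2] by (simp only: power2_abs)
    have QP2: "integrable M (\<lambda>\<omega>. (?Q T n \<omega> - P T \<omega>)\<^sup>2)" for n
      by (rule integrable_const_bound[where B="(2 * ?B)\<^sup>2"])
         (use QP2_bd QM[OF T] PM[OF T] in \<open>auto intro!: AE_I2 simp del: power_mult_distrib\<close>)
    have e2: "(\<lambda>n. \<integral>\<omega>. Z n \<omega> * (?Q T n \<omega> - P T \<omega>) \<partial>M) \<longlonglongrightarrow> 0"
    proof (rule tendsto_integral_mult_zero[OF ZM _ Z2(1) QP2 Z2(2)])
      have "(\<lambda>n. \<integral>\<omega>. (?Q T n \<omega> - P T \<omega>)\<^sup>2 \<partial>M) \<longlonglongrightarrow> (\<integral>\<omega>. 0 \<partial>M)"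
      proof (rule integral_dominated_convergence[where w="\<lambda>_. (2 * ?B)\<^sup>2"])
        show "AE \<omega> in M. (\<lambda>n. (?Q T n \<omega> - P T \<omega>)\<^sup>2) \<longlonglongrightarrow> 0"
        proof (rule AE_I2)
          fix \<omega> assume "\<omega> \<in> space M"
          then have "(\<lambda>n. (?Q T n \<omega> - P T \<omega>)\<^sup>2) \<longlonglongrightarrow> (P T \<omega> - P T \<omega>)\<^sup>2"
            by (intro tendsto_intros Q_lim T)
          then show "(\<lambda>n. (?Q T n \<omega> - P T \<omega>)\<^sup>2) \<longlonglongrightarrow> 0" by simp
        qed
        show "AE \<omega> in M. norm ((?Q T n \<omega> - P T \<omega>)\<^sup>2) \<le> (2 * ?B)\<^sup>2" for n
          using QP2_bd by (intro AE_I2) (simp del: power_mult_distrib)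
      qed (use QM[OF T] PM[OF T] in simp_all)
      then show "(\<lambda>n. \<integral>\<omega>. (?Q T n \<omega> - P T \<omega>)\<^sup>2 \<partial>M) \<longlonglongrightarrow> 0" by simp
    qed (use QM[OF T] PM[OF T] in simp)
    have low: "ennreal (1 + (\<beta>\<^sup>2 / 2 * (ip g g - ?G n) + \<beta> * (\<integral>\<omega>. Z n \<omega> * (I T \<omega> - J 0 T n \<omega>) \<partial>M)
        + \<beta>\<^sup>2 * (\<integral>\<omega>. Z n \<omega> * (?Q T n \<omega> - P T \<omega>) \<partial>M) - \<beta>\<^sup>2 * (C * L' T))) \<le> ?E" if n: "n > 0" for n
    proof -
      let ?y = "\<lambda>\<omega>. \<beta>\<^sup>2 / 2 * ip g g + \<beta> * Iinf \<omega> - \<beta>\<^sup>2 * Pinf \<omega>"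
      let ?u = "\<lambda>\<omega>. Z n \<omega> * (1 + ?y \<omega> - ln (Z n \<omega>))"
      have Zi: "integrable M (Z n)" "(\<integral>\<omega>. Z n \<omega> \<partial>M) = 1" using Z1[of n] by (auto simp: has_bochner_integral_iff)
      note or = Iinf_orth[OF T ZF[OF n] Z2(1)[of n]]
      have ZIJ: "integrable M (\<lambda>\<omega>. Z n \<omega> * (I T \<omega> - J 0 T n \<omega>))"
        by (intro integrable_square_mult ZM Z2 ID2 borel_measurable_diff I2 JM)
      have ZJ: "integrable M (\<lambda>\<omega>. Z n \<omega> * J 0 T n \<omega>)" using girsX[of n] by (rule integrable.intros)
      have ZQP: "integrable M (\<lambda>\<omega>. Z n \<omega> * (?Q T n \<omega> - P T \<omega>))"
        by (intro integrable_square_mult ZM Z2 QP2 borel_measurable_diff QM PM T)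
      have Zbd: "integrable M (\<lambda>\<omega>. Z n \<omega> * v \<omega>)" if "v \<in> borel_measurable M" "\<And>\<omega>. \<omega> \<in> space M \<Longrightarrow> \<bar>v \<omega>\<bar> \<le> B" for v B
      proof (rule Bochner_Integration.integrable_bound[OF integrable_mult_right[OF Zi(1), of B]])
        show "(\<lambda>\<omega>. Z n \<omega> * v \<omega>) \<in> borel_measurable M" using that ZM by simp
        show "AE \<omega> in M. norm (Z n \<omega> * v \<omega>) \<le> norm (B * Z n \<omega>)"
        proof (rule AE_I2)
          fix \<omega> assume "\<omega> \<in> space M"
          then have "\<bar>v \<omega>\<bar> \<le> \<bar>B\<bar>" using that(2)[of \<omega>] by linarith
          then show "norm (Z n \<omega> * v \<omega>) \<le> norm (B * Z n \<omega>)" using Zp[of n \<omega>] by (simp add: abs_mult mult.commute)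
        qed
      qed
      have ZQ: "integrable M (\<lambda>\<omega>. Z n \<omega> * ?Q T n \<omega>)" by (rule Zbd[OF QM[OF T] Q_bd[OF _ T]])
      have ZPP: "integrable M (\<lambda>\<omega>. Z n \<omega> * (P T \<omega> - Pinf \<omega>))"
        by (rule Zbd[of "\<lambda>\<omega>. P T \<omega> - Pinf \<omega>" "C * L' T"]) (use PM[OF T] PinfM tail[OF _ T] in simp_all)
      have ZJg: "integrable M (\<lambda>\<omega>. Z n \<omega> * Jg n \<omega>)" using girsg[of n] by (rule integrable.intros)
      have ZPP_bd: "- (C * L' T) \<le> (\<integral>\<omega>. Z n \<omega> * (P T \<omega> - Pinf \<omega>) \<partial>M)"
      proof -
        have "(\<integral>\<omega>. Z n \<omega> * (- (C * L' T)) \<partial>M) \<le> (\<integral>\<omega>. Z n \<omega> * (P T \<omega> - Pinf \<omega>) \<partial>M)"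
        proof (rule integral_mono)
          fix \<omega> assume "\<omega> \<in> space M"
          then have "- (C * L' T) \<le> P T \<omega> - Pinf \<omega>" using tail[OF _ T, of \<omega>] by linarith
          then show "Z n \<omega> * (- (C * L' T)) \<le> Z n \<omega> * (P T \<omega> - Pinf \<omega>)" using Zp[of n \<omega>] by (intro mult_left_mono) auto
        qed (use ZPP Zi(1) in auto)
        then show ?thesis using Zi(2) by simp
      qed
      \<comment> \<open>\<open>?u\<close> is split into terms of controlled mean: what
        \<open>Iinf\<close> collects after \<open>T\<close> is orthogonal to \<open>Z n\<close>, the
        discretisation errors vanish as \<open>n\<close> grows, and by
        \<open>discrete_girsanov\<close> the means of the \<open>J\<close> term and of the
        \<open>?Q\<close> term cancel.\<close>
      let ?v = "\<lambda>\<omega>. (1 + \<beta>\<^sup>2 / 2 * (ip g g + ?G n)) * Z n \<omega> + \<beta> * (Z n \<omega> * (Iinf \<omega> - I T \<omega>))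
          + \<beta> * (Z n \<omega> * (I T \<omega> - J 0 T n \<omega>)) + \<beta> * (Z n \<omega> * J 0 T n \<omega>)
          + \<beta>\<^sup>2 * (Z n \<omega> * (?Q T n \<omega> - P T \<omega>)) + \<beta>\<^sup>2 * (Z n \<omega> * (P T \<omega> - Pinf \<omega>)) - \<beta>\<^sup>2 * (Z n \<omega> * ?Q T n \<omega>)
          - \<beta> * (Z n \<omega> * Jg n \<omega>)"
      have uv: "?u \<omega> = ?v \<omega>" for \<omega> unfolding lnZ by (simp add: algebra_simps)
      have vi: "integrable M ?v"
        using Zi(1) or(1) ZIJ ZJ ZQP ZPP ZQ ZJg by (intro Bochner_Integration.integrable_add Bochner_Integration.integrable_diff integrable_mult_right)
      have ui: "integrable M ?u" unfolding uv by (rule vi)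
      have "(\<integral>\<omega>. ?u \<omega> \<partial>M) = (\<integral>\<omega>. ?v \<omega> \<partial>M)" unfolding uv ..
      also have "\<dots> = (1 + \<beta>\<^sup>2 / 2 * (ip g g + ?G n)) * (\<integral>\<omega>. Z n \<omega> \<partial>M) + \<beta> * (\<integral>\<omega>. Z n \<omega> * (Iinf \<omega> - I T \<omega>) \<partial>M)
          + \<beta> * (\<integral>\<omega>. Z n \<omega> * (I T \<omega> - J 0 T n \<omega>) \<partial>M) + \<beta> * (\<integral>\<omega>. Z n \<omega> * J 0 T n \<omega> \<partial>M)
          + \<beta>\<^sup>2 * (\<integral>\<omega>. Z n \<omega> * (?Q T n \<omega> - P T \<omega>) \<partial>M) + \<beta>\<^sup>2 * (\<integral>\<omega>. Z n \<omega> * (P T \<omega> - Pinf \<omega>) \<partial>M)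
          - \<beta>\<^sup>2 * (\<integral>\<omega>. Z n \<omega> * ?Q T n \<omega> \<partial>M) - \<beta> * (\<integral>\<omega>. Z n \<omega> * Jg n \<omega> \<partial>M)"
        using Zi(1) or(1) ZIJ ZJ ZQP ZPP ZQ ZJg
        by (simp only: Bochner_Integration.integral_add Bochner_Integration.integral_diff integral_mult_right_zero
            Bochner_Integration.integrable_add Bochner_Integration.integrable_diff integrable_mult_right)
      also have "\<dots> = 1 + (\<beta>\<^sup>2 / 2 * (ip g g - ?G n) + \<beta> * (\<integral>\<omega>. Z n \<omega> * (I T \<omega> - J 0 T n \<omega>) \<partial>M)
        + \<beta>\<^sup>2 * (\<integral>\<omega>. Z n \<omega> * (?Q T n \<omega> - P T \<omega>) \<partial>M) + \<beta>\<^sup>2 * (\<integral>\<omega>. Z n \<omega> * (P T \<omega> - Pinf \<omega>) \<partial>M))"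
        unfolding Zi(2) or(2) has_bochner_integral_integral_eq[OF girsX] has_bochner_integral_integral_eq[OF girsg]
        by (simp add: field_simps power2_eq_square)
      finally have ueq: "(\<integral>\<omega>. ?u \<omega> \<partial>M) = 1 + (\<beta>\<^sup>2 / 2 * (ip g g - ?G n) + \<beta> * (\<integral>\<omega>. Z n \<omega> * (I T \<omega> - J 0 T n \<omega>) \<partial>M)
        + \<beta>\<^sup>2 * (\<integral>\<omega>. Z n \<omega> * (?Q T n \<omega> - P T \<omega>) \<partial>M) + \<beta>\<^sup>2 * (\<integral>\<omega>. Z n \<omega> * (P T \<omega> - Pinf \<omega>) \<partial>M))" .
      have "\<beta>\<^sup>2 * (- (C * L' T)) \<le> \<beta>\<^sup>2 * (\<integral>\<omega>. Z n \<omega> * (P T \<omega> - Pinf \<omega>) \<partial>M)"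
        by (rule mult_left_mono[OF ZPP_bd]) simp
      then have "ennreal (1 + (\<beta>\<^sup>2 / 2 * (ip g g - ?G n) + \<beta> * (\<integral>\<omega>. Z n \<omega> * (I T \<omega> - J 0 T n \<omega>) \<partial>M)
        + \<beta>\<^sup>2 * (\<integral>\<omega>. Z n \<omega> * (?Q T n \<omega> - P T \<omega>) \<partial>M) - \<beta>\<^sup>2 * (C * L' T))) \<le> ennreal (\<integral>\<omega>. ?u \<omega> \<partial>M)"
        unfolding ueq by (intro ennreal_leI) linarith
      also have "\<dots> \<le> (\<integral>\<^sup>+ \<omega>. ennreal (?u \<omega>) \<partial>M)" by (rule ennreal_integral_le_nn_integral[OF ui])
      also have "\<dots> \<le> (\<integral>\<^sup>+ \<omega>. ennreal (exp (?y \<omega>)) \<partial>M)"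
        by (intro nn_integral_mono ennreal_leI exp_ge_entropy Zp)
      finally show ?thesis by (simp add: Pinf_def)
    qed
    have "(\<lambda>n. ennreal (1 + (\<beta>\<^sup>2 / 2 * (ip g g - ?G n) + \<beta> * (\<integral>\<omega>. Z n \<omega> * (I T \<omega> - J 0 T n \<omega>) \<partial>M)
        + \<beta>\<^sup>2 * (\<integral>\<omega>. Z n \<omega> * (?Q T n \<omega> - P T \<omega>) \<partial>M) - \<beta>\<^sup>2 * (C * L' T))))
      \<longlonglongrightarrow> ennreal (1 + (\<beta>\<^sup>2 / 2 * (ip g g - (LINT t:{0..T}|lborel. (g t)\<^sup>2)) + \<beta> * 0 + \<beta>\<^sup>2 * 0 - \<beta>\<^sup>2 * (C * L' T)))"
      by (intro tendsto_ennrealI tendsto_intros G_lim e1 e2)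
    then have "ennreal (1 + (\<beta>\<^sup>2 / 2 * (ip g g - (LINT t:{0..T}|lborel. (g t)\<^sup>2)) + \<beta> * 0 + \<beta>\<^sup>2 * 0 - \<beta>\<^sup>2 * (C * L' T))) \<le> ?E"
      by (rule LIMSEQ_le_const2) (intro exI[of _ 1] allI impI low, simp)
    then show ?thesis by simp
  qed
  have "(\<lambda>N. ennreal (1 + (\<beta>\<^sup>2 / 2 * (ip g g - (LINT t:{0..real N}|lborel. (g t)\<^sup>2)) - \<beta>\<^sup>2 * (C * L' (real N)))))
    \<longlonglongrightarrow> ennreal (1 + (\<beta>\<^sup>2 / 2 * (ip g g - ip g g) - \<beta>\<^sup>2 * (C * 0)))"
  proof (intro tendsto_ennrealI tendsto_intros L'_lim)
    have "((\<lambda>T. LINT t:{0..T}|lborel. (g t)\<^sup>2) \<longlongrightarrow> (LINT t:{0..}|lborel. (g t)\<^sup>2)) at_top"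
      by (rule tendsto_set_lebesgue_integral_at_top) (use g2 in auto)
    then show "(\<lambda>N. LINT t:{0..real N}|lborel. (g t)\<^sup>2) \<longlonglongrightarrow> ip g g"
      unfolding ip_def power2_eq_square by (rule filterlim_compose[OF _ filterlim_real_sequentially])
  qed
  then have "ennreal (1 + (\<beta>\<^sup>2 / 2 * (ip g g - ip g g) - \<beta>\<^sup>2 * (C * 0))) \<le> ?E"
    by (rule LIMSEQ_le_const2) (intro exI[of _ 0] allI impI main, simp)
  then show "1 \<le> ?E" by simp
qed

end

section \<open>Strategies and revenues\<close>

lemma ac_rate_measurable:
  assumes "ac_rate f fd"
  shows "set_borel_measurable lborel {0..} fd"
  unfolding set_borel_measurable_def
proof (rule borel_measurable_LIMSEQ_real)
  show "(\<lambda>t. indicator {0..real n} t *\<^sub>R fd t) \<in> borel_measurable lborel" for n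
    using ac_rate_integrable[OF assms, of 0 "real n"] by (auto simp: set_integrable_def)
  fix t :: real
  obtain N where N: "t \<le> real N" using real_arch_simple by blast
  have "eventually (\<lambda>n. indicator {0..real n} t *\<^sub>R fd t = indicator {0..} t *\<^sub>R fd t) sequentially"
    using N by (intro eventually_sequentiallyI[of N]) (auto simp: indicator_def)
  then show "(\<lambda>n. indicator {0..real n} t *\<^sub>R fd t) \<longlonglongrightarrow> indicator {0..} t *\<^sub>R fd t"
    by (rule tendsto_eventually)
qed

lemma sqiI:
  assumes m: "set_borel_measurable lborel {0..} u"
    and fin: "(\<integral>\<^sup>+ t\<in>{0..}. ennreal ((u t)\<^sup>2) \<partial>lborel) < \<infinity>"
  shows "sqi u"
proof -
  have m2: "set_borel_measurable lborel {0..} (\<lambda>t. (u t)\<^sup>2)"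
    unfolding power2_eq_square by (intro set_borel_measurable_mult m)
  have "integrable lborel (\<lambda>t. indicator {0..} t *\<^sub>R (u t)\<^sup>2)"
  proof (rule integrableI_nonneg)
    have "(\<integral>\<^sup>+ t. ennreal (indicator {0..} t *\<^sub>R (u t)\<^sup>2) \<partial>lborel) = (\<integral>\<^sup>+ t\<in>{0..}. ennreal ((u t)\<^sup>2) \<partial>lborel)"
      by (intro nn_integral_cong) (auto simp: indicator_def)
    then show "(\<integral>\<^sup>+ t. ennreal (indicator {0..} t *\<^sub>R (u t)\<^sup>2) \<partial>lborel) < \<infinity>" using fin by simp
  qed (use m2 in \<open>auto simp: set_borel_measurable_def\<close>)
  then show ?thesis using m by (simp add: sqi_def set_integrable_def)
qed

lemma sqi_nn_integral:
  assumes "sqi u"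
  shows "(\<integral>\<^sup>+ t\<in>{0..}. ennreal ((u t)\<^sup>2) \<partial>lborel) < \<infinity>"
proof -
  have "(\<integral>\<^sup>+ t\<in>{0..}. ennreal ((u t)\<^sup>2) \<partial>lborel) = (\<integral>\<^sup>+ t. ennreal (norm (indicator {0..} t *\<^sub>R (u t)\<^sup>2)) \<partial>lborel)"
    by (intro nn_integral_cong) (auto simp: indicator_def)
  also have "\<dots> < \<infinity>" using assms by (simp add: sqi_def set_integrable_def integrable_iff_bounded)
  finally show ?thesis .
qed

text \<open>Versions of a rate agree almost everywhere in time, so admissibility does not depend on
  the version; this covers the rate selected by \<open>rate\<close>.\<close>

lemma adm_rate_cong:
  assumes "adm f fd" "ac_rate f fd'"
  shows "adm f fd'"
proof -
  have ae: "AE t in lborel. t \<ge> 0 \<longrightarrow> fd t = fd' t" using ac_rate_unique[OF admD(1)[OF assms(1)] assms(2)] .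
  have "(\<integral>\<^sup>+ t\<in>{0..}. ennreal ((fd' t)\<^sup>2) \<partial>lborel) = (\<integral>\<^sup>+ t\<in>{0..}. ennreal ((fd t)\<^sup>2) \<partial>lborel)"
    by (intro nn_integral_cong_AE) (use ae in eventually_elim, auto simp: indicator_def)
  then have "sqi fd'"
    using sqi_nn_integral[OF admD(2)[OF assms(1)]] ac_rate_measurable[OF assms(2)] by (intro sqiI) auto
  then show ?thesis using assms by (simp add: adm_def)
qed

text \<open>No almost sure existence of the limit is needed: where it fails, \<open>Lim\<close> takes one fixed junk value.\<close>

lemma Lim_measurable:
  fixes G :: "real \<Rightarrow> 'a \<Rightarrow> real"
  assumes m: "\<And>T. 0 \<le> T \<Longrightarrow> G T \<in> borel_measurable M"
    and c: "\<And>\<omega>. \<omega> \<in> space M \<Longrightarrow> continuous_on {0..} (\<lambda>T. G T \<omega>)"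
  shows "(\<lambda>\<omega>. Lim at_top (\<lambda>T. G T \<omega>)) \<in> borel_measurable M"
proof -
  \<comment> \<open>The Cauchy criterion with countably many tests. Rational increments enter by
    absolute value, so that all times stay to the right of \<open>N\<close>; path continuity extends
    the estimate to real times.\<close>
  define A where "A = {\<omega>\<in>space M. \<forall>k::nat. \<exists>N::nat. \<forall>r::rat.
    \<bar>G (real N + \<bar>of_rat r\<bar>) \<omega> - G (real N) \<omega>\<bar> \<le> 1 / real (Suc k)}"
  have AM: "A \<in> sets M"
    unfolding A_def
    by (intro sets.sets_Collect_countable_All sets.sets_Collect_countable_Ex borel_measurable_le
        borel_measurable_abs borel_measurable_diff borel_measurable_const m) auto
  have conv: "(\<exists>l. ((\<lambda>T. G T \<omega>) \<longlongrightarrow> l) at_top) \<longleftrightarrow> \<omega> \<in> A" if w: "\<omega> \<in> space M" for \<omega>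
  proof
    assume "\<exists>l. ((\<lambda>T. G T \<omega>) \<longlongrightarrow> l) at_top"
    then obtain l where l: "((\<lambda>T. G T \<omega>) \<longlongrightarrow> l) at_top" by blast
    show "\<omega> \<in> A" unfolding A_def
    proof (intro CollectI conjI w allI)
      fix k :: nat
      define d where "d = 1 / (2 * real (Suc k))"
      have "eventually (\<lambda>T. dist (G T \<omega>) l < d) at_top"
        using l by (rule tendstoD) (simp add: d_def)
      then obtain T where T: "\<And>t. t \<ge> T \<Longrightarrow> \<bar>G t \<omega> - l\<bar> < d"
        by (auto simp: eventually_at_top_linorder dist_real_def)
      obtain N where N: "T \<le> real N" using real_arch_simple by blast
      have h: "1 / real (Suc k) = d + d" by (simp add: d_def field_simps)
      show "\<exists>N::nat. \<forall>r::rat. \<bar>G (real N + \<bar>of_rat r\<bar>) \<omega> - G (real N) \<omega>\<bar> \<le> 1 / real (Suc k)"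
      proof (intro exI[of _ N] allI)
        fix r :: rat
        have "T \<le> real N + \<bar>of_rat r\<bar>" using N by (simp add: add_increasing2)
        from T[OF this] T[OF N] show "\<bar>G (real N + \<bar>of_rat r\<bar>) \<omega> - G (real N) \<omega>\<bar> \<le> 1 / real (Suc k)"
          unfolding h by arith
      qed
    qed
  next
    assume wA: "\<omega> \<in> A"
    have *: "\<exists>N::nat. \<forall>t\<ge>real N. \<bar>G t \<omega> - G (real N) \<omega>\<bar> \<le> 1 / real (Suc k)" for k :: nat
    proof -
      obtain N where N: "\<And>r::rat. \<bar>G (real N + \<bar>of_rat r\<bar>) \<omega> - G (real N) \<omega>\<bar> \<le> 1 / real (Suc k)"
        using wA unfolding A_def by blast
      have "\<bar>G t \<omega> - G (real N) \<omega>\<bar> \<le> 1 / real (Suc k)" if t: "t \<ge> real N" for t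
      proof (rule ccontr)
        assume "\<not> ?thesis"
        then have gt: "\<bar>G t \<omega> - G (real N) \<omega>\<bar> - 1 / real (Suc k) > 0" by simp
        have "\<exists>d>0. \<forall>t'\<in>{0..}. dist t' t < d \<longrightarrow> dist (G t' \<omega>) (G t \<omega>) < \<bar>G t \<omega> - G (real N) \<omega>\<bar> - 1 / real (Suc k)"
        proof -
          have "t \<in> {0..}" using t by (simp add: order_trans[OF of_nat_0_le_iff])
          then show ?thesis using c[OF w] gt unfolding continuous_on_iff by blast
        qed
        then obtain d where d: "d > 0" "\<And>t'. 0 \<le> t' \<Longrightarrow> \<bar>t' - t\<bar> < d \<Longrightarrow>
           \<bar>G t' \<omega> - G t \<omega>\<bar> < \<bar>G t \<omega> - G (real N) \<omega>\<bar> - 1 / real (Suc k)"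
          by (auto simp: dist_real_def)
        obtain r :: rat where r: "t - real N < of_rat r" "of_rat r < t - real N + d"
          using of_rat_dense[of "t - real N" "t - real N + d"] d(1) by auto
        have "\<bar>G (real N + \<bar>of_rat r\<bar>) \<omega> - G t \<omega>\<bar> < \<bar>G t \<omega> - G (real N) \<omega>\<bar> - 1 / real (Suc k)"
        proof (rule d(2))
          have "\<bar>of_rat r :: real\<bar> = of_rat r" using r t by linarith
          then show "\<bar>real N + \<bar>of_rat r\<bar> - t\<bar> < d" "0 \<le> real N + \<bar>of_rat r :: real\<bar>" using r t by linarith+
        qed
        then show False using N[of r] by linarith
      qed
      then show ?thesis by blast
    qed
    have small: "\<exists>k::nat. 2 / real (Suc k) < e" if "e > 0" for e :: real
    proof -
      obtain k :: nat where "2 / e < real k" using reals_Archimedean2 by blast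
      then have "2 / real (Suc k) < e" using that by (simp add: field_simps)
      then show ?thesis by blast
    qed
    have "convergent (\<lambda>n. G (real n) \<omega>)"
    proof (rule Cauchy_convergent, rule metric_CauchyI)
      fix e :: real assume "e > 0"
      then obtain k :: nat where k: "2 / real (Suc k) < e" using small by blast
      obtain N :: nat where N: "\<And>t. t \<ge> real N \<Longrightarrow> \<bar>G t \<omega> - G (real N) \<omega>\<bar> \<le> 1 / real (Suc k)" using * by blast
      have "dist (G (real m) \<omega>) (G (real n) \<omega>) < e" if "m \<ge> N" "n \<ge> N" for m n
      proof -
        have "\<bar>G (real m) \<omega> - G (real n) \<omega>\<bar> \<le> 1 / real (Suc k) + 1 / real (Suc k)"
          using N[of "real m"] N[of "real n"] that by (auto simp: abs_if split: if_splits)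
        then show ?thesis using k by (simp add: dist_real_def)
      qed
      then show "\<exists>M. \<forall>m\<ge>M. \<forall>n\<ge>M. dist (G (real m) \<omega>) (G (real n) \<omega>) < e" by blast
    qed
    then obtain l where l: "(\<lambda>n. G (real n) \<omega>) \<longlonglongrightarrow> l" by (auto simp: convergent_def)
    have "((\<lambda>T. G T \<omega>) \<longlongrightarrow> l) at_top"
    proof (rule tendstoI)
      fix e :: real assume "e > 0"
      then obtain k :: nat where k: "2 / real (Suc k) < e" using small by blast
      obtain N :: nat where N: "\<And>t. t \<ge> real N \<Longrightarrow> \<bar>G t \<omega> - G (real N) \<omega>\<bar> \<le> 1 / real (Suc k)" using * by blast
      have "\<bar>l - G (real N) \<omega>\<bar> \<le> 1 / real (Suc k)"
      proof (rule LIMSEQ_le_const2)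
        show "(\<lambda>n. \<bar>G (real n) \<omega> - G (real N) \<omega>\<bar>) \<longlonglongrightarrow> \<bar>l - G (real N) \<omega>\<bar>" by (intro tendsto_intros l)
        show "\<exists>M. \<forall>n\<ge>M. \<bar>G (real n) \<omega> - G (real N) \<omega>\<bar> \<le> 1 / real (Suc k)"
          using N by (auto intro!: exI[of _ N])
      qed
      then have le: "\<bar>G t \<omega> - l\<bar> \<le> 1 / real (Suc k) + 1 / real (Suc k)" if "t \<ge> real N" for t
        using N[OF that] by (auto simp: abs_if split: if_splits)
      show "eventually (\<lambda>T. dist (G T \<omega>) l < e) at_top"
        using eventually_ge_at_top[of "real N"]
      proof eventually_elim
        case (elim t)
        then show ?case using le[OF elim] k by (simp add: dist_real_def)
      qed
    qed
    then show "\<exists>l. ((\<lambda>T. G T \<omega>) \<longlongrightarrow> l) at_top" by blast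
  qed
  have "Lim at_top (\<lambda>T. G T \<omega>) = (if \<omega> \<in> A then lim (\<lambda>n. G (real n) \<omega>) else (THE l. False))" if w: "\<omega> \<in> space M" for \<omega>
  proof (cases "\<omega> \<in> A")
    case True
    then obtain l where l: "((\<lambda>T. G T \<omega>) \<longlongrightarrow> l) at_top" using conv[OF w] by blast
    have "(\<lambda>n. G (real n) \<omega>) \<longlonglongrightarrow> l" by (rule filterlim_compose[OF l filterlim_real_sequentially])
    then have "lim (\<lambda>n. G (real n) \<omega>) = l" by (rule limI)
    moreover have "Lim at_top (\<lambda>T. G T \<omega>) = l" using l by (intro tendsto_Lim) auto
    ultimately show ?thesis using True by simp
  next
    case False
    then have "(\<lambda>l. ((\<lambda>T. G T \<omega>) \<longlongrightarrow> l) at_top) = (\<lambda>l. False)" using conv[OF w] by (auto simp: fun_eq_iff)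
    then show ?thesis using False by (simp add: Topological_Spaces.Lim_def)
  qed
  moreover have "(\<lambda>\<omega>. if \<omega> \<in> A then lim (\<lambda>n. G (real n) \<omega>) else (THE l. False)) \<in> borel_measurable M"
    using AM m by (intro measurable_If_set borel_measurable_lim_metric borel_measurable_const) (auto simp: Int_absorb2 sets.sets_into_space)
  ultimately show ?thesis by (simp cong: measurable_cong)
qed

section \<open>Revenues, and deterministic strategies as admissible functions\<close>

context trading_process
begin

text \<open>Up to a finite horizon the part linear in the rate and the Brownian part are integrated
  in closed form; the initial positions in the price move into the constant.\<close>

lemma path_integral:
  assumes w: "\<omega> \<in> space M" and f: "\<And>j. j < n \<Longrightarrow> adm (f j) (fd j)" and i: "i < n" and T: "0 \<le> T"
    and X: "\<And>t. f i t = X t \<omega>" "\<And>t. fd i t = Xd t \<omega>"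
  shows "(LINT t:{0..T}|lborel. fd i t * (S0 + \<sigma> * W t \<omega> + \<gamma> * (\<Sum>j<n. f j t - f j 0) + lam * (\<Sum>j<n. fd j t)))
    = (S0 - \<gamma> * (\<Sum>j<n. f j 0)) * (f i T - f i 0) + \<sigma> * (f i T * W T \<omega> - I T \<omega>)
      + (LINT t:{0..T}|lborel. fd i t * (\<gamma> * (\<Sum>j<n. f j t) + lam * (\<Sum>j<n. fd j t)))"
proof -
  let ?c = "S0 - \<gamma> * (\<Sum>j<n. f j 0)"
  let ?h = "\<lambda>t. \<gamma> * (\<Sum>j<n. f j t) + lam * (\<Sum>j<n. fd j t)"
  have i1: "set_integrable lborel {0..T} (fd i)" using ac_rate_integrable[OF admD(1)[OF f[OF i]]] by simp
  have i2: "set_integrable lborel {0..T} (\<lambda>t. W t \<omega> * fd i t)" using W_Xd_integrable[OF w, of T] by (simp add: X(2))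
  have "sqi ?h" using f by (intro sqi_lincomb sqi_sum) (auto dest: admD)
  then have i3: "set_integrable lborel {0..T} (\<lambda>t. fd i t * ?h t)"
    using sqi_mult[OF admD(2)[OF f[OF i]]] by (intro set_integrable_subset[of lborel "{0..}" _ "{0..T}"]) auto
  have "(LINT t:{0..T}|lborel. fd i t * (S0 + \<sigma> * W t \<omega> + \<gamma> * (\<Sum>j<n. f j t - f j 0) + lam * (\<Sum>j<n. fd j t)))
    = (LINT t:{0..T}|lborel. ?c * fd i t + \<sigma> * (W t \<omega> * fd i t) + fd i t * ?h t)"
    by (intro arg_cong[where f="set_lebesgue_integral lborel {0..T}"] ext) (simp add: sum_subtractf algebra_simps)
  also have "\<dots> = ?c * (LINT t:{0..T}|lborel. fd i t) + \<sigma> * (LINT t:{0..T}|lborel. W t \<omega> * fd i t) + (LINT t:{0..T}|lborel. fd i t * ?h t)"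
    using i1 i2 i3 by (subst set_integral_add; (subst set_integral_add)?) auto
  also have "(LINT t:{0..T}|lborel. fd i t) = f i T - f i 0"
    using ac_rate_diff[OF admD(1)[OF f[OF i]] order_refl T] by simp
  also have "(LINT t:{0..T}|lborel. W t \<omega> * fd i t) = f i T * W T \<omega> - I T \<omega>"
    by (simp add: I_def X)
  finally show ?thesis .
qed

end

context brownian_space
begin

lemma rate_is_rate: "X \<in> strategies M F x \<Longrightarrow> is_rate M F X (rate M F X)"
  unfolding rate_def by (rule someI_ex[where P="is_rate M F X"]) (simp add: strategies_def)

lemma strategy_process:
  assumes "X \<in> strategies M F x"
  shows "\<exists>C. l2_trading_process M F W X (rate M F X) C"
proof -
  obtain C where C: "\<And>t \<omega>. 0 \<le> t \<Longrightarrow> \<omega> \<in> space M \<Longrightarrow> \<bar>X t \<omega>\<bar> \<le> C"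
    using assms unfolding strategies_def by blast
  have "l2_trading_process M F W X (rate M F X) C"
  proof (unfold_locales)
    show "\<And>t. 0 \<le> t \<Longrightarrow> X t \<in> borel_measurable (F t)" using assms by (auto simp: strategies_def)
    show "ac_rate (\<lambda>t. X t \<omega>) (\<lambda>t. rate M F X t \<omega>)" if "\<omega> \<in> space M" for \<omega>
      using rate_is_rate[OF assms] that unfolding is_rate_def ac_rate_def by blast
    show "(\<integral>\<^sup>+ \<omega>. (\<integral>\<^sup>+ t\<in>{0..}. ennreal ((X t \<omega>)\<^sup>2) \<partial>lborel) \<partial>M) < \<infinity>"
      using assms by (auto simp: strategies_def)
  qed (rule C)
  then show ?thesis by blast
qed

text \<open>A finite mean of the time integral of the squared position gives almost sure finiteness
  once that integral is measurable in the sample point. It is an increasing limit of integrals over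
  \<open>{0..real n}\<close>, whose measurability is known.\<close>

lemma strategy_adm:
  assumes "X \<in> strategies M F x"
  shows "AE \<omega> in M. adm (\<lambda>t. X t \<omega>) (\<lambda>t. rate M F X t \<omega>)"
proof -
  obtain C where "l2_trading_process M F W X (rate M F X) C" using strategy_process[OF assms] by blast
  then interpret P: l2_trading_process M F W X "rate M F X" C .
  have Xm: "set_borel_measurable lborel {0..} (\<lambda>t. X t \<omega>)" if "\<omega> \<in> space M" for \<omega>
    unfolding set_borel_measurable_def
    using borel_measurable_continuous_on_indicator[OF _ ac_rate_continuous[OF P.ac[OF that]]] by simp
  let ?N = "\<lambda>\<omega>. \<integral>\<^sup>+ t\<in>{0..}. ennreal ((X t \<omega>)\<^sup>2) \<partial>lborel"
  have lim: "(\<lambda>n. ennreal (LINT t:{0..real n}|lborel. (X t \<omega>)\<^sup>2)) \<longlonglongrightarrow> ?N \<omega>" if w: "\<omega> \<in> space M" for \<omega>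
  proof -
    let ?f = "\<lambda>n t. ennreal (indicator {0..real n} t *\<^sub>R (X t \<omega>)\<^sup>2)"
    have "(\<lambda>n. \<integral>\<^sup>+ t. ?f n t \<partial>lborel) \<longlonglongrightarrow> ?N \<omega>"
    proof (rule nn_integral_LIMSEQ)
      show "incseq ?f" by (auto simp: incseq_def le_fun_def indicator_def)
      show "?f n \<in> borel_measurable lborel" for n
        using P.X2_integrable[OF w order_refl, of "real n"] by (auto simp: set_integrable_def)
      fix t :: real
      obtain N where N: "t \<le> real N" using real_arch_simple by blast
      have "eventually (\<lambda>n. ?f n t = ennreal ((X t \<omega>)\<^sup>2) * indicator {0..} t) sequentially"
        using N by (intro eventually_sequentiallyI[of N]) (auto simp: indicator_def)
      then show "(\<lambda>n. ?f n t) \<longlonglongrightarrow> ennreal ((X t \<omega>)\<^sup>2) * indicator {0..} t" by (rule tendsto_eventually)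
    qed
    moreover have "(\<integral>\<^sup>+ t. ?f n t \<partial>lborel) = ennreal (LINT t:{0..real n}|lborel. (X t \<omega>)\<^sup>2)" for n
      using P.X2_integrable[OF w order_refl, of "real n"] unfolding set_lebesgue_integral_def set_integrable_def
      by (intro nn_integral_eq_integral) auto
    ultimately show ?thesis by simp
  qed
  have "?N \<in> borel_measurable M"
    by (rule borel_measurable_LIMSEQ_order[OF lim]) (use P.integral_X2(1) in simp_all)
  then have N: "AE \<omega> in M. ?N \<omega> \<noteq> \<infinity>"
    using P.fin by (intro nn_integral_PInf_AE) auto
  have "AE \<omega> in M. (\<integral>\<^sup>+ t\<in>{0..}. ennreal ((rate M F X t \<omega>)\<^sup>2) \<partial>lborel) < \<infinity>"
    using rate_is_rate[OF assms] by (auto simp: is_rate_def)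
  moreover have "AE \<omega> in M. ((\<lambda>t. (X t \<omega>)\<^sup>2 * t * ln (ln t)) \<longlongrightarrow> 0) at_top"
    using assms by (auto simp: strategies_def)
  ultimately show ?thesis using N AE_space
  proof eventually_elim
    case (elim \<omega>)
    then show ?case
      unfolding adm_def
      by (intro conjI P.ac sqiI ac_rate_measurable[OF P.ac] Xm) (auto simp: less_top[symmetric])
  qed
qed

lemma strategy_0: "X \<in> strategies M F x \<Longrightarrow> \<omega> \<in> space M \<Longrightarrow> X 0 \<omega> = x"
  by (auto simp: strategies_def)

text \<open>In \<open>path_integral\<close> the terminal position tends to 0, and so does its
  product with \<open>W\<close> by \<open>mult_W_tendsto_0\<close>. Apart from the initial data,
  only \<open>Iinf\<close> and the impact cost survive.\<close>

lemma revenue_AE: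
  assumes Xs: "\<And>j. j < n \<Longrightarrow> Xs j \<in> strategies M F (x j)" and i: "i < n"
  shows "AE \<omega> in M. revenue M F W S0 \<sigma> \<gamma> lam n Xs i \<omega>
    = (S0 - \<gamma> * (\<Sum>j<n. x j)) * x i + \<sigma> * l2_trading_process.Iinf W (Xs i) (rate M F (Xs i)) \<omega>
      - ip (\<lambda>t. rate M F (Xs i) t \<omega>) (\<lambda>t. \<gamma> * (\<Sum>j<n. Xs j t \<omega>) + lam * (\<Sum>j<n. rate M F (Xs j) t \<omega>))"
proof -
  obtain C where "l2_trading_process M F W (Xs i) (rate M F (Xs i)) C" using strategy_process[OF Xs[OF i]] by blast
  then interpret P: l2_trading_process M F W "Xs i" "rate M F (Xs i)" C .
  have "AE \<omega> in M. \<forall>j\<in>{..<n}. adm (\<lambda>t. Xs j t \<omega>) (\<lambda>t. rate M F (Xs j) t \<omega>)"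
    using strategy_adm[OF Xs] by (intro AE_finite_allI) auto
  then show ?thesis
    using P.I_tendsto_Iinf W_loglog_bound AE_space
  proof eventually_elim
    case (elim \<omega>)
    let ?f = "\<lambda>j t. Xs j t \<omega>" and ?fd = "\<lambda>j t. rate M F (Xs j) t \<omega>"
    let ?h = "\<lambda>t. \<gamma> * (\<Sum>j<n. ?f j t) + lam * (\<Sum>j<n. ?fd j t)"
    have f: "adm (?f j) (?fd j)" if "j < n" for j using elim(1) that by auto
    have f0: "?f j 0 = x j" if "j < n" for j using strategy_0[OF Xs[OF that] elim(4)] .
    have fW: "((\<lambda>T. ?f i T * W T \<omega>) \<longlongrightarrow> 0) at_top"
      by (rule mult_W_tendsto_0[OF _ elim(3)]) (use f[OF i] in \<open>simp add: adm_def\<close>)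
    have "sqi ?h" using f by (intro sqi_lincomb sqi_sum) (auto dest: admD)
    then have ipt: "((\<lambda>T. LINT t:{0..T}|lborel. ?fd i t * ?h t) \<longlongrightarrow> ip (?fd i) ?h) at_top"
      using f[OF i] by (intro ip_tendsto) (auto dest: admD)
    have "((\<lambda>T. (S0 - \<gamma> * (\<Sum>j<n. ?f j 0)) * (?f i T - ?f i 0) + \<sigma> * (?f i T * W T \<omega> - P.I T \<omega>)
        + (LINT t:{0..T}|lborel. ?fd i t * ?h t))
      \<longlongrightarrow> (S0 - \<gamma> * (\<Sum>j<n. ?f j 0)) * (0 - ?f i 0) + \<sigma> * (0 - P.Iinf \<omega>) + ip (?fd i) ?h) at_top"
      using fW ipt elim(2) adm_tendsto_0[OF f[OF i]] by (intro tendsto_intros)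
    then have "((\<lambda>T. LINT t:{0..T}|lborel. rate M F (Xs i) t \<omega> * price M F W S0 \<sigma> \<gamma> lam n Xs t \<omega>)
      \<longlongrightarrow> (S0 - \<gamma> * (\<Sum>j<n. ?f j 0)) * (0 - ?f i 0) + \<sigma> * (0 - P.Iinf \<omega>) + ip (?fd i) ?h) at_top"
    proof (rule Lim_transform_eventually)
      show "eventually (\<lambda>T. (S0 - \<gamma> * (\<Sum>j<n. ?f j 0)) * (?f i T - ?f i 0) + \<sigma> * (?f i T * W T \<omega> - P.I T \<omega>)
        + (LINT t:{0..T}|lborel. ?fd i t * ?h t)
        = (LINT t:{0..T}|lborel. rate M F (Xs i) t \<omega> * price M F W S0 \<sigma> \<gamma> lam n Xs t \<omega>)) at_top"
        using eventually_ge_at_top[of 0]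
      proof eventually_elim
        case T: (elim T)
        show ?case
          unfolding price_def
          by (rule P.path_integral[where f="?f" and fd="?fd", OF elim(4) f i T refl refl, symmetric])
      qed
    qed
    then have "Lim at_top (\<lambda>T. LINT t:{0..T}|lborel. rate M F (Xs i) t \<omega> * price M F W S0 \<sigma> \<gamma> lam n Xs t \<omega>)
      = (S0 - \<gamma> * (\<Sum>j<n. ?f j 0)) * (0 - ?f i 0) + \<sigma> * (0 - P.Iinf \<omega>) + ip (?fd i) ?h"
      by (intro tendsto_Lim) auto
    moreover have "(\<Sum>j<n. ?f j 0) = (\<Sum>j<n. x j)" using f0 by (intro sum.cong) auto
    ultimately show ?case unfolding revenue_def using f0[OF i] by (simp add: algebra_simps)
  qed
qed

lemma adm_det_strategies:
  assumes "adm f fd"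
  shows "f \<in> det_strategies M F (f 0)"
proof -
  obtain C where C: "\<And>t. t \<ge> 0 \<Longrightarrow> \<bar>f t\<bar> \<le> C" using adm_bounded[OF assms] by blast
  have "is_rate M F (\<lambda>t \<omega>. f t) (\<lambda>t \<omega>. fd t)"
    unfolding is_rate_def
  proof (intro conjI allI impI ballI)
    fix t :: real assume t: "0 \<le> t"
    have "fd \<in> borel_measurable (restrict_space borel {0..t})"
      using ac_rate_integrable[OF admD(1)[OF assms], of 0 t]
      by (subst borel_measurable_restrict_space_iff) (auto simp: set_integrable_def mult.commute)
    then show "(\<lambda>(s, \<omega>). fd s) \<in> borel_measurable (restrict_space borel {0..t} \<Otimes>\<^sub>M F t)"
      by (simp add: case_prod_beta' measurable_compose[OF measurable_fst])
  next
    fix t :: real assume "0 \<le> t"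
    then show "set_integrable lborel {0..t} fd" "f t = f 0 + (LINT s:{0..t}|lborel. fd s)"
      using admD(1)[OF assms] unfolding ac_rate_def by blast+
  next
    show "AE \<omega> in M. (\<integral>\<^sup>+ t\<in>{0..}. ennreal ((fd t)\<^sup>2) \<partial>lborel) < \<infinity>"
      using sqi_nn_integral[OF admD(2)[OF assms]] by simp
  qed
  then have ex: "\<exists>Xd. is_rate M F (\<lambda>t \<omega>. f t) Xd" by blast
  have "(\<integral>\<^sup>+ \<omega>. (\<integral>\<^sup>+ t\<in>{0..}. ennreal ((f t)\<^sup>2) \<partial>lborel) \<partial>M) < \<infinity>"
    using sqi_nn_integral[OF admD(3)[OF assms]] by (simp add: emeasure_space_1)
  then show ?thesis
    unfolding det_strategies_def strategies_def using ex C assms by (auto simp: adm_def)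
qed

lemma det_strategies_adm:
  assumes "f \<in> det_strategies M F x"
  shows "\<exists>fd. adm f fd" "f 0 = x"
proof -
  have s: "(\<lambda>t \<omega>. f t) \<in> strategies M F x" using assms by (simp add: det_strategies_def)
  \<comment> \<open>As \<open>f\<close> does not depend on the sample point, a single point of the
    almost sure event supplies a rate.\<close>
  have "\<exists>\<omega>. adm f (\<lambda>t. rate M F (\<lambda>t \<omega>. f t) t \<omega>)"
  proof (rule ccontr)
    assume "\<nexists>\<omega>. adm f (\<lambda>t. rate M F (\<lambda>t \<omega>. f t) t \<omega>)"
    then show False using AE_contr[OF strategy_adm[OF s]] by simp
  qed
  then show "\<exists>fd. adm f fd" by blast
  show "f 0 = x" using strategy_0[OF s] not_empty by blast
qed

text \<open>True at every sample point, not just almost surely: the selected rate may vary with the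
  point, but at each one it is a rate of the same \<open>f\<close>.\<close>

lemma det_rate_adm:
  assumes "adm f fd" "\<omega> \<in> space M"
  shows "adm f (\<lambda>t. rate M F (\<lambda>t \<omega>. f t) t \<omega>)"
proof -
  have s: "(\<lambda>t \<omega>. f t) \<in> strategies M F (f 0)" using adm_det_strategies[OF assms(1)] by (simp add: det_strategies_def)
  have "ac_rate f (\<lambda>t. rate M F (\<lambda>t \<omega>. f t) t \<omega>)"
    using rate_is_rate[OF s] assms(2) unfolding is_rate_def ac_rate_def by blast
  then show ?thesis by (rule adm_rate_cong[OF assms(1)])
qed

lemma det_rate_AE:
  assumes "adm f fd" "\<omega> \<in> space M"
  shows "AE t in lborel. t \<ge> 0 \<longrightarrow> rate M F (\<lambda>t \<omega>. f t) t \<omega> = fd t"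
  using ac_rate_unique[OF admD(1)[OF det_rate_adm[OF assms]] admD(1)[OF assms(1)]] .

end

section \<open>Stationarity and equilibria\<close>

text \<open>Expansion of the impact cost of agent \<open>i\<close> under the variation
  \<open>h\<close>. Integration by parts with \<open>h 0 = 0\<close> removes the pairing of
  \<open>h'\<close> with \<open>h\<close> and moves that of \<open>h\<close> with
  \<open>fd i\<close> onto \<open>f i\<close>; what remains in the \<open>\<gamma>\<close> term is
  the aggregate without the agent's own position.\<close>

lemma cost_diff:
  fixes n :: nat
  assumes f: "\<And>j. j < n \<Longrightarrow> adm (f j) (fd j)" and i: "i < n" and h: "adm h h'" "h 0 = 0"
  shows "ip (\<lambda>t. fd i t + h' t) (\<lambda>t. \<gamma> * ((\<Sum>j<n. f j t) + h t) + lam * ((\<Sum>j<n. fd j t) + h' t))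
    = ip (fd i) (\<lambda>t. \<gamma> * (\<Sum>j<n. f j t) + lam * (\<Sum>j<n. fd j t))
      + ip h' (\<lambda>t. \<gamma> * ((\<Sum>j<n. f j t) - f i t) + lam * ((\<Sum>j<n. fd j t) + fd i t)) + lam * ip h' h'"
proof -
  define Z where "Z t = (\<Sum>j<n. f j t)" for t
  define Zd where "Zd t = (\<Sum>j<n. fd j t)" for t
  have adZ: "adm Z Zd" unfolding Z_def[abs_def] Zd_def[abs_def] using f by (intro adm_sum) auto
  note s = admD(2,3)[OF adZ] admD(2,3)[OF f[OF i]] admD(2,3)[OF h(1)]
  have b1: "ip h h' = 0" using adm_ibp[OF h(1) h(1)] h(2) by simp
  have b2: "ip h (fd i) = - ip (f i) h'" using adm_ibp[OF h(1) f[OF i]] h(2) by simp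
  show ?thesis
    unfolding Z_def[symmetric] Zd_def[symmetric]
    using b1 b2
    by (simp add: ip_add_left ip_add_right ip_diff_right ip_cmult_right s sqi_add sqi_diff sqi_cmult
        ip_commute[of h' h] ip_commute[of "fd i" h] ip_commute[of h' "f i"] ip_commute[of h' "fd i"] algebra_simps)
qed

lemma (in l2_trading_process) Vinf_det:
  assumes "sqi g" and det: "\<And>t \<omega>. 0 \<le> t \<Longrightarrow> \<omega> \<in> space M \<Longrightarrow> X t \<omega> = g t"
  shows "Vinf = ip g g"
proof (rule LIMSEQ_unique[OF V_tendsto])
  have "V (real N) = (LINT t:{0..real N}|lborel. g t * g t)" for N
  proof -
    have "V (real N) = (\<integral>\<omega>. (LINT s:{0..real N}|lborel. g s * g s) \<partial>M)"
      unfolding V_def power2_eq_square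
      by (intro Bochner_Integration.integral_cong set_lebesgue_integral_cong) (auto simp: det)
    then show ?thesis by (simp add: prob_space)
  qed
  then show "(\<lambda>N. V (real N)) \<longlonglongrightarrow> ip g g"
    using filterlim_compose[OF ip_tendsto[OF assms(1) assms(1)] filterlim_real_sequentially] by simp
qed

text \<open>The Euler-Lagrange system in weak form: the left-hand side is minus the first variation
  of agent \<open>i\<close>'s mean-variance functional in the direction \<open>h\<close>. Variations
  start at 0 because initial positions are prescribed.\<close>

definition stationary :: "real \<Rightarrow> real \<Rightarrow> real \<Rightarrow> nat \<Rightarrow> (nat \<Rightarrow> real) \<Rightarrow> (nat \<Rightarrow> real \<Rightarrow> real) \<Rightarrow> (nat \<Rightarrow> real \<Rightarrow> real) \<Rightarrow> bool" where
  "stationary \<sigma> \<gamma> lam n \<alpha> Xs Xd \<longleftrightarrow> (\<forall>i<n. \<forall>h h'. adm h h' \<longrightarrow> h 0 = 0 \<longrightarrow>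
     ip h' (\<lambda>t. \<gamma> * ((\<Sum>j<n. Xs j t) - Xs i t) + lam * ((\<Sum>j<n. Xd j t) + Xd i t)) + \<alpha> i * \<sigma>\<^sup>2 * ip (Xs i) h = 0)"

lemma stationaryD:
  "stationary \<sigma> \<gamma> lam n \<alpha> Xs Xd \<Longrightarrow> i < n \<Longrightarrow> adm h h' \<Longrightarrow> h 0 = 0 \<Longrightarrow>
    ip h' (\<lambda>t. \<gamma> * ((\<Sum>j<n. Xs j t) - Xs i t) + lam * ((\<Sum>j<n. Xd j t) + Xd i t)) + \<alpha> i * \<sigma>\<^sup>2 * ip (Xs i) h = 0"
  unfolding stationary_def by blast

context brownian_space
begin

lemma det_rate_lincomb_AE:
  fixes n :: nat
  assumes f: "\<And>j. j < n \<Longrightarrow> adm (f j) (fd j)" and w: "\<omega> \<in> space M"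
  shows "AE t in lborel. t \<ge> 0 \<longrightarrow> \<gamma> * (\<Sum>j<n. f j t) + lam * (\<Sum>j<n. rate M F (\<lambda>t \<omega>. f j t) t \<omega>)
    = \<gamma> * (\<Sum>j<n. f j t) + lam * (\<Sum>j<n. fd j t)"
proof -
  have "AE t in lborel. \<forall>j\<in>{..<n}. t \<ge> 0 \<longrightarrow> rate M F (\<lambda>t \<omega>. f j t) t \<omega> = fd j t"
    using det_rate_AE[OF f w] by (intro AE_finite_allI) auto
  then show ?thesis by eventually_elim (auto intro!: sum.cong)
qed

lemma det_revenue_AE:
  assumes f: "\<And>j. j < n \<Longrightarrow> adm (f j) (fd j)" and i: "i < n"
  shows "AE \<omega> in M. revenue M F W S0 \<sigma> \<gamma> lam n (\<lambda>j t \<omega>. f j t) i \<omega> = (S0 - \<gamma> * (\<Sum>j<n. f j 0)) * f i 0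
    - ip (fd i) (\<lambda>t. \<gamma> * (\<Sum>j<n. f j t) + lam * (\<Sum>j<n. fd j t))
    + \<sigma> * l2_trading_process.Iinf W (\<lambda>t \<omega>. f i t) (rate M F (\<lambda>t \<omega>. f i t)) \<omega>"
proof -
  let ?Xs = "\<lambda>j t (\<omega>::'a). f j t"
  let ?h = "\<lambda>t. \<gamma> * (\<Sum>j<n. f j t) + lam * (\<Sum>j<n. fd j t)"
  let ?hr = "\<lambda>\<omega> t. \<gamma> * (\<Sum>j<n. f j t) + lam * (\<Sum>j<n. rate M F (?Xs j) t \<omega>)"
  have Xs: "?Xs j \<in> strategies M F (f j 0)" if "j < n" for j
    using adm_det_strategies[OF f[OF that]] by (simp add: det_strategies_def)
  have "AE \<omega> in M. revenue M F W S0 \<sigma> \<gamma> lam n ?Xs i \<omega> = (S0 - \<gamma> * (\<Sum>j<n. f j 0)) * f i 0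
    + \<sigma> * l2_trading_process.Iinf W (?Xs i) (rate M F (?Xs i)) \<omega> - ip (\<lambda>t. rate M F (?Xs i) t \<omega>) (?hr \<omega>)"
    by (rule revenue_AE[where Xs="?Xs" and x="\<lambda>j. f j 0", OF Xs i])
  then show ?thesis using AE_space
  proof eventually_elim
    case (elim \<omega>)
    have s: "sqi (\<lambda>t. rate M F (?Xs i) t \<omega>)" "sqi (?hr \<omega>)" "sqi (fd i)" "sqi ?h"
      using f i det_rate_adm[OF f elim(2)]
      by (auto dest: admD intro!: sqi_lincomb[of "\<lambda>t. \<Sum>j<n. f j t"] sqi_sum)
    have "ip (\<lambda>t. rate M F (?Xs i) t \<omega>) (?hr \<omega>) = ip (fd i) ?h"
      by (rule ip_cong_AE[OF s det_rate_AE[OF f[OF i] elim(2)] det_rate_lincomb_AE[OF f elim(2)]])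
    then show ?case using elim(1) by simp
  qed
qed

lemma MV_value:
  assumes f: "\<And>j. j < n \<Longrightarrow> adm (f j) (fd j)" and i: "i < n"
  shows "mean_variance M a (revenue M F W S0 \<sigma> \<gamma> lam n (\<lambda>j t \<omega>. f j t) i)
    = (S0 - \<gamma> * (\<Sum>j<n. f j 0)) * f i 0
      - ip (fd i) (\<lambda>t. \<gamma> * (\<Sum>j<n. f j t) + lam * (\<Sum>j<n. fd j t)) - a / 2 * (\<sigma>\<^sup>2 * ip (f i) (f i))"
proof -
  let ?Xs = "\<lambda>j t (\<omega>::'a). f j t"
  let ?R = "revenue M F W S0 \<sigma> \<gamma> lam n ?Xs i"
  let ?h = "\<lambda>t. \<gamma> * (\<Sum>j<n. f j t) + lam * (\<Sum>j<n. fd j t)"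
  let ?K = "(S0 - \<gamma> * (\<Sum>j<n. f j 0)) * f i 0"
  have Xs: "?Xs j \<in> strategies M F (f j 0)" if "j < n" for j
    using adm_det_strategies[OF f[OF that]] by (simp add: det_strategies_def)
  obtain C where "l2_trading_process M F W (?Xs i) (rate M F (?Xs i)) C" using strategy_process[OF Xs[OF i]] by blast
  then interpret P: l2_trading_process M F W "?Xs i" "rate M F (?Xs i)" C .
  have sh: "sqi ?h" using f by (intro sqi_lincomb sqi_sum) (auto dest: admD)
  have radm: "adm (f j) (\<lambda>t. rate M F (?Xs j) t \<omega>)" if "j < n" "\<omega> \<in> space M" for j \<omega>
    by (rule det_rate_adm[OF f[OF that(1)] that(2)])
  have rAE: "AE t in lborel. t \<ge> 0 \<longrightarrow> rate M F (?Xs j) t \<omega> = fd j t" if "j < n" "\<omega> \<in> space M" for j \<omega>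
    by (rule det_rate_AE[OF f[OF that(1)] that(2)])
  let ?hr = "\<lambda>\<omega> t. \<gamma> * (\<Sum>j<n. f j t) + lam * (\<Sum>j<n. rate M F (?Xs j) t \<omega>)"
  have hAE: "AE t in lborel. t \<ge> 0 \<longrightarrow> ?hr \<omega> t = ?h t" if w: "\<omega> \<in> space M" for \<omega>
    by (rule det_rate_lincomb_AE[OF f w])
  have shr: "sqi (?hr \<omega>)" if w: "\<omega> \<in> space M" for \<omega>
    using radm[OF _ w] by (intro sqi_lincomb sqi_sum) (auto dest: admD)
  have R_AE: "AE \<omega> in M. ?R \<omega> = ?K - ip (fd i) ?h + \<sigma> * P.Iinf \<omega>"
    by (rule det_revenue_AE[OF f i])
  \<comment> \<open>The almost sure formula does not settle measurability on a possibly incomplete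
    space, and for a nonmeasurable function the Bochner integral would be 0 by default.\<close>
  have R_M: "?R \<in> borel_measurable M"
  proof -
    \<comment> \<open>With the fixed version \<open>fd\<close> in place of the selected rate, the
      time integral is visibly measurable in the sample point and continuous in \<open>T\<close>, as
      \<open>Lim_measurable\<close> asks.\<close>
    let ?G = "\<lambda>T \<omega>. (S0 - \<gamma> * (\<Sum>j<n. f j 0)) * (f i T - f i 0) + \<sigma> * (f i T * W T \<omega> - P.I T \<omega>)
        + (LINT t:{0..T}|lborel. fd i t * ?h t)"
    have eq: "(LINT t:{0..T}|lborel. rate M F (?Xs i) t \<omega> * price M F W S0 \<sigma> \<gamma> lam n ?Xs t \<omega>) = ?G T \<omega>"
      if T: "0 \<le> T" and w: "\<omega> \<in> space M" for T \<omega>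
    proof -
      have int: "set_integrable lborel {0..T} (\<lambda>t. rate M F (?Xs i) t \<omega> * ?hr \<omega> t)"
        "set_integrable lborel {0..T} (\<lambda>t. fd i t * ?h t)"
        using sqi_mult[OF admD(2)[OF radm[OF i w]] shr[OF w]] sqi_mult[OF admD(2)[OF f[OF i]] sh]
        by (auto intro!: set_integrable_subset[of lborel "{0..}" _ "{0..T}"])
      have "(LINT t:{0..T}|lborel. rate M F (?Xs i) t \<omega> * ?hr \<omega> t) = (LINT t:{0..T}|lborel. fd i t * ?h t)"
        unfolding set_lebesgue_integral_def
      proof (rule integral_cong_AE)
        show "(\<lambda>t. indicator {0..T} t *\<^sub>R (rate M F (?Xs i) t \<omega> * ?hr \<omega> t)) \<in> borel_measurable lborel"
          "(\<lambda>t. indicator {0..T} t *\<^sub>R (fd i t * ?h t)) \<in> borel_measurable lborel"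
          using int unfolding set_integrable_def by (auto dest: borel_measurable_integrable)
        show "AE t in lborel. indicator {0..T} t *\<^sub>R (rate M F (?Xs i) t \<omega> * ?hr \<omega> t) = indicator {0..T} t *\<^sub>R (fd i t * ?h t)"
          using rAE[OF i w] hAE[OF w] by eventually_elim (auto simp: indicator_def)
      qed
      then show ?thesis
        unfolding price_def
        using P.path_integral[where f=f and fd="\<lambda>j t. rate M F (?Xs j) t \<omega>" and ?S0.0=S0 and \<sigma>=\<sigma> and \<gamma>=\<gamma> and lam=lam,
          OF w radm[OF _ w] i T refl refl] by simp
    qed
    have "(\<lambda>\<omega>. Lim at_top (\<lambda>T. LINT t:{0..T}|lborel. rate M F (?Xs i) t \<omega> * price M F W S0 \<sigma> \<gamma> lam n ?Xs t \<omega>)) \<in> borel_measurable M"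
    proof (rule Lim_measurable)
      fix T :: real assume T: "0 \<le> T"
      have "?G T \<in> borel_measurable M" using W_M[OF T] P.I_M[OF T] by simp
      then show "(\<lambda>\<omega>. LINT t:{0..T}|lborel. rate M F (?Xs i) t \<omega> * price M F W S0 \<sigma> \<gamma> lam n ?Xs t \<omega>) \<in> borel_measurable M"
        using eq[OF T] by (simp cong: measurable_cong)
    next
      fix \<omega> assume w: "\<omega> \<in> space M"
      have c2: "continuous_on {0..} (\<lambda>T. LINT t:{0..T}|lborel. fd i t * ?h t)"
        using sqi_mult[OF admD(2)[OF f[OF i]] sh]
        by (intro continuous_indefinite_integral set_integrable_subset[of lborel "{0..}" _ "{0.._}"]) auto
      have "continuous_on {0..} (\<lambda>T. ?G T \<omega>)"
        using ac_rate_continuous[OF admD(1)[OF f[OF i]]] W_continuous[OF w] P.I_continuous[OF w] c2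
        by (intro continuous_intros)
      then show "continuous_on {0..} (\<lambda>T. LINT t:{0..T}|lborel. rate M F (?Xs i) t \<omega> * price M F W S0 \<sigma> \<gamma> lam n ?Xs t \<omega>)"
        by (rule continuous_on_eq) (simp add: eq[OF _ w])
    qed
    then show ?thesis unfolding revenue_def[abs_def] by simp
  qed
  have Vinf: "P.Vinf = ip (f i) (f i)" by (rule P.Vinf_det[OF admD(3)[OF f[OF i]]]) simp
  have mean: "(\<integral>\<omega>. ?R \<omega> \<partial>M) = ?K - ip (fd i) ?h"
  proof -
    have "(\<integral>\<omega>. ?R \<omega> \<partial>M) = (\<integral>\<omega>. ?K - ip (fd i) ?h + \<sigma> * P.Iinf \<omega> \<partial>M)"
      by (rule integral_cong_AE[OF R_M _ R_AE]) (use P.Iinf_M in simp)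
    then show ?thesis using P.Iinf_mean by (simp add: has_bochner_integral_iff prob_space)
  qed
  have "(\<integral>\<omega>. (?R \<omega> - (\<integral>\<omega>. ?R \<omega> \<partial>M))\<^sup>2 \<partial>M) = (\<integral>\<omega>. \<sigma>\<^sup>2 * (P.Iinf \<omega>)\<^sup>2 \<partial>M)"
    unfolding mean
  proof (rule integral_cong_AE)
    show "AE \<omega> in M. (?R \<omega> - (?K - ip (fd i) ?h))\<^sup>2 = \<sigma>\<^sup>2 * (P.Iinf \<omega>)\<^sup>2"
      using R_AE by eventually_elim (simp add: power_mult_distrib)
  qed (use R_M P.Iinf_M in simp_all)
  then have "(\<integral>\<omega>. (?R \<omega> - (\<integral>\<omega>. ?R \<omega> \<partial>M))\<^sup>2 \<partial>M) = \<sigma>\<^sup>2 * ip (f i) (f i)"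
    using P.Iinf_square Vinf by simp
  then show ?thesis unfolding mean_variance_def using mean by simp
qed

lemma sum_fun_upd:
  fixes f :: "nat \<Rightarrow> real \<Rightarrow> real"
  assumes "i < n"
  shows "(\<Sum>j<n. (f(i := g)) j t) = (\<Sum>j<n. f j t) + (g t - f i t)"
proof -
  have "(\<Sum>j<n. (f(i := g)) j t) = (\<Sum>j\<in>insert i ({..<n} - {i}). (f(i := g)) j t)"
    using assms by (simp add: insert_absorb)
  also have "\<dots> = g t + (\<Sum>j\<in>{..<n} - {i}. f j t)" by (subst sum.insert) auto
  also have "(\<Sum>j\<in>{..<n} - {i}. f j t) = (\<Sum>j<n. f j t) - f i t" using assms by (simp add: sum_diff1)
  finally show ?thesis by simp
qed

text \<open>The functional is quadratic, so the expansion has no remainder: the first bracket is the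
  expression in \<open>stationary\<close>, and the second is nonnegative for \<open>lam > 0\<close>
  and \<open>a \<ge> 0\<close>.\<close>

lemma MV_deviation:
  assumes f: "\<And>j. j < n \<Longrightarrow> adm (f j) (fd j)" and i: "i < n" and h: "adm h h'" "h 0 = 0"
  shows "mean_variance M a (revenue M F W S0 \<sigma> \<gamma> lam n (\<lambda>j t \<omega>. (f(i := \<lambda>t. f i t + h t)) j t) i)
    = mean_variance M a (revenue M F W S0 \<sigma> \<gamma> lam n (\<lambda>j t \<omega>. f j t) i)
      - (ip h' (\<lambda>t. \<gamma> * ((\<Sum>j<n. f j t) - f i t) + lam * ((\<Sum>j<n. fd j t) + fd i t)) + a * \<sigma>\<^sup>2 * ip (f i) h)
      - (lam * ip h' h' + a / 2 * \<sigma>\<^sup>2 * ip h h)"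
proof -
  let ?f = "f(i := \<lambda>t. f i t + h t)" and ?fd = "fd(i := \<lambda>t. fd i t + h' t)"
  have g: "adm (\<lambda>t. f i t + h t) (\<lambda>t. fd i t + h' t)" using adm_lincomb[OF f[OF i] h(1), of 1 1] by simp
  have f': "adm (?f j) (?fd j)" if "j < n" for j using f[OF that] g by auto
  have s: "sqi (f i)" "sqi h" using f[OF i] h by (auto dest: admD)
  have ff: "ip (\<lambda>t. f i t + h t) (\<lambda>t. f i t + h t) = ip (f i) (f i) + 2 * ip (f i) h + ip h h"
    by (simp add: ip_add_left ip_add_right s sqi_add ip_commute[of h "f i"])
  have sums: "(\<Sum>j<n. ?f j t) = (\<Sum>j<n. f j t) + h t" "(\<Sum>j<n. ?fd j t) = (\<Sum>j<n. fd j t) + h' t" for t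
    unfolding sum_fun_upd[OF i] by simp_all
  have cd: "ip (?fd i) (\<lambda>t. \<gamma> * (\<Sum>j<n. ?f j t) + lam * (\<Sum>j<n. ?fd j t))
     = ip (fd i) (\<lambda>t. \<gamma> * (\<Sum>j<n. f j t) + lam * (\<Sum>j<n. fd j t))
      + ip h' (\<lambda>t. \<gamma> * ((\<Sum>j<n. f j t) - f i t) + lam * ((\<Sum>j<n. fd j t) + fd i t)) + lam * ip h' h'"
    unfolding sums using cost_diff[OF f i h] by simp
  have ffi: "ip (?f i) (?f i) = ip (f i) (f i) + 2 * ip (f i) h + ip h h" using ff by simp
  have z: "(\<Sum>j<n. ?f j 0) = (\<Sum>j<n. f j 0)" "?f i 0 = f i 0" unfolding sums using h(2) by simp_all
  show ?thesis
    by (subst MV_value[where f="?f" and fd="?fd", OF f' i], assumption,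
        subst MV_value[where f=f and fd=fd, OF f i], assumption)
       (simp only: cd ffi z, simp add: algebra_simps)
qed

section \<open>Mean-variance equilibria are the stationary points\<close>

lemma MV_nash_adm:
  assumes "MV_nash M F W S0 \<sigma> \<gamma> lam n x \<alpha> Ys"
  obtains Yd where "\<And>i. i < n \<Longrightarrow> adm (Ys i) (Yd i)" "\<And>i. i < n \<Longrightarrow> Ys i 0 = x i"
proof -
  have "\<forall>i. \<exists>fd. i < n \<longrightarrow> adm (Ys i) fd"
    using assms det_strategies_adm(1) unfolding MV_nash_def by blast
  then obtain Yd where "\<forall>i. i < n \<longrightarrow> adm (Ys i) (Yd i)" by metis
  then show ?thesis using that[of Yd] assms det_strategies_adm(2) unfolding MV_nash_def by blast
qed

text \<open>Varying by \<open>e * h\<close> gives a quadratic polynomial in \<open>e\<close> that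
  never exceeds its value at 0, so its slope there must vanish.\<close>

lemma MV_nash_stationary:
  assumes N: "MV_nash M F W S0 \<sigma> \<gamma> lam n x \<alpha> Ys" and Y: "\<And>i. i < n \<Longrightarrow> adm (Ys i) (Yd i)"
  shows "stationary \<sigma> \<gamma> lam n \<alpha> Ys Yd"
  unfolding stationary_def
proof (intro allI impI)
  fix i h h' assume i: "i < n" and h: "adm h h'" "h 0 = 0"
  let ?E = "ip h' (\<lambda>t. \<gamma> * ((\<Sum>j<n. Ys j t) - Ys i t) + lam * ((\<Sum>j<n. Yd j t) + Yd i t)) + \<alpha> i * \<sigma>\<^sup>2 * ip (Ys i) h"
  let ?Q = "lam * ip h' h' + \<alpha> i / 2 * \<sigma>\<^sup>2 * ip h h"
  have x: "Ys i 0 = x i" using N i det_strategies_adm(2) unfolding MV_nash_def by blast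
  have ineq: "- (e * ?E) - e\<^sup>2 * ?Q \<le> 0" for e
  proof -
    have eh: "adm (\<lambda>t. e * h t) (\<lambda>t. e * h' t)" "e * h 0 = 0"
      using adm_lincomb[OF h(1) adm_zero, of e 0] h(2) by simp_all
    have "adm (\<lambda>t. Ys i t + e * h t) (\<lambda>t. Yd i t + e * h' t)" using adm_lincomb[OF Y[OF i] h(1), of 1 e] by simp
    from adm_det_strategies[OF this] have "(\<lambda>t. Ys i t + e * h t) \<in> det_strategies M F (x i)" using h(2) x by simp
    then have "mean_variance M (\<alpha> i) (revenue M F W S0 \<sigma> \<gamma> lam n (\<lambda>j t \<omega>. (Ys(i := \<lambda>t. Ys i t + e * h t)) j t) i)
      \<le> mean_variance M (\<alpha> i) (revenue M F W S0 \<sigma> \<gamma> lam n (\<lambda>j t \<omega>. Ys j t) i)"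
      using N i unfolding MV_nash_def by blast
    moreover have "mean_variance M (\<alpha> i) (revenue M F W S0 \<sigma> \<gamma> lam n (\<lambda>j t \<omega>. (Ys(i := \<lambda>t. Ys i t + e * h t)) j t) i)
      = mean_variance M (\<alpha> i) (revenue M F W S0 \<sigma> \<gamma> lam n (\<lambda>j t \<omega>. Ys j t) i) - (e * ?E) - e\<^sup>2 * ?Q"
      by (subst MV_deviation[where fd=Yd, OF Y i eh], assumption)
         (simp only: ip_cmult_left ip_cmult_right, simp add: power2_eq_square algebra_simps)
    ultimately show ?thesis by linarith
  qed
  show "?E = 0"
  proof (rule ccontr)
    assume E: "?E \<noteq> 0"
    \<comment> \<open>A positive number above \<open>?Q\<close>: the variation with
      \<open>e = - ?E / k\<close> would then raise the functional by
      \<open>(?E / k)\<^sup>2 * (k - ?Q)\<close>.\<close>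
    define k where "k = \<bar>?Q\<bar> + 1"
    have k: "k > 0" "?Q < k" by (auto simp: k_def)
    have "- (- ?E / k * ?E) - (- ?E / k)\<^sup>2 * ?Q \<le> 0" by (rule ineq)
    moreover have "- (- ?E / k * ?E) - (- ?E / k)\<^sup>2 * ?Q = (?E / k)\<^sup>2 * (k - ?Q)"
      using k by (simp add: power2_eq_square field_simps)
    moreover have "(?E / k)\<^sup>2 * (k - ?Q) > 0" using E k by (intro mult_pos_pos) auto
    ultimately show False by linarith
  qed
qed

text \<open>Testing the difference of the two stationarity conditions with the difference of the strategies and summing
  over the agents, the \<open>\<gamma>\<close>-terms integrate to zero and a positive definite form remains.\<close>

lemma stationary_unique:
  fixes n :: nat
  assumes X: "\<And>i. i < n \<Longrightarrow> adm (Xs i) (Xd i)" and Y: "\<And>i. i < n \<Longrightarrow> adm (Ys i) (Yd i)"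
    and eq: "\<And>i. i < n \<Longrightarrow> Ys i 0 = Xs i 0"
    and stX: "stationary \<sigma> \<gamma> lam n \<alpha> Xs Xd"
    and stY: "stationary \<sigma> \<gamma> lam n \<alpha> Ys Yd"
    and lam: "lam > 0" and \<alpha>: "\<And>i. i < n \<Longrightarrow> \<alpha> i > 0"
    and i: "i < n" and t: "t \<ge> 0"
  shows "Ys i t = Xs i t"
proof -
  define D where "D i t = Ys i t - Xs i t" for i t
  define Dd where "Dd i t = Yd i t - Xd i t" for i t
  define Z where "Z t = (\<Sum>j<n. D j t)" for t
  define Zd where "Zd t = (\<Sum>j<n. Dd j t)" for t
  have aD: "adm (D i) (Dd i)" if "i < n" for i
    unfolding D_def[abs_def] Dd_def[abs_def] using adm_diff[OF Y[OF that] X[OF that]] .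
  have aZ: "adm Z Zd" unfolding Z_def[abs_def] Zd_def[abs_def] using aD by (intro adm_sum) auto
  have D0: "D i 0 = 0" if "i < n" for i using eq[OF that] by (simp add: D_def)
  have Z0: "Z 0 = 0" unfolding Z_def using D0 by simp
  have D1: "ip (Dd i) (D i) = 0" if "i < n" for i
    using adm_ibp[OF aD[OF that] aD[OF that]] D0[OF that] by (simp add: ip_commute)
  have Z1: "ip Zd Z = 0" using adm_ibp[OF aZ aZ] Z0 by (simp add: ip_commute)
  \<comment> \<open>The agent's own part of the \<open>\<gamma>\<close> term is already gone here,
    by \<open>D1\<close>; the aggregate part disappears only after summation over the agents, by
    \<open>Z1\<close>.\<close>
  have key: "\<gamma> * ip (Dd i) Z + lam * ip (Dd i) Zd + lam * ip (Dd i) (Dd i) + \<alpha> i * \<sigma>\<^sup>2 * ip (D i) (D i) = 0" if i: "i < n" for i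
  proof -
    let ?BX = "\<lambda>t. \<gamma> * ((\<Sum>j<n. Xs j t) - Xs i t) + lam * ((\<Sum>j<n. Xd j t) + Xd i t)"
    let ?BY = "\<lambda>t. \<gamma> * ((\<Sum>j<n. Ys j t) - Ys i t) + lam * ((\<Sum>j<n. Yd j t) + Yd i t)"
    have sB: "sqi ?BX" "sqi ?BY"
      using X Y X[OF i] Y[OF i] by (intro sqi_lincomb sqi_diff sqi_add sqi_sum; auto dest: admD)+
    note s = admD(2,3)[OF aZ] admD(2,3)[OF aD[OF i]]
    have d: "ip (Dd i) (\<lambda>t. ?BY t - ?BX t) = ip (Dd i) ?BY - ip (Dd i) ?BX"
      by (rule ip_diff_right[OF sB(2) sB(1) s(3)])
    have "ip (Dd i) (\<lambda>t. ?BY t - ?BX t) + \<alpha> i * \<sigma>\<^sup>2 * (ip (Ys i) (D i) - ip (Xs i) (D i)) = 0"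
      using stationaryD[OF stX i aD[OF i] D0[OF i]] stationaryD[OF stY i aD[OF i] D0[OF i]] unfolding d right_diff_distrib[of "\<alpha> i * \<sigma>\<^sup>2"] by linarith
    moreover have "ip (Ys i) (D i) - ip (Xs i) (D i) = ip (D i) (D i)"
    proof -
      have "ip (\<lambda>t. Ys i t - Xs i t) (D i) = ip (Ys i) (D i) - ip (Xs i) (D i)"
        using X[OF i] Y[OF i] s by (intro ip_diff_left) (auto dest: admD)
      then show ?thesis by (simp add: D_def[abs_def])
    qed
    moreover have "(\<lambda>t. ?BY t - ?BX t) = (\<lambda>t. \<gamma> * (Z t - D i t) + lam * (Zd t + Dd i t))"
      by (simp add: Z_def Zd_def D_def Dd_def sum_subtractf algebra_simps fun_eq_iff)
    moreover have "ip (Dd i) (\<lambda>t. \<gamma> * (Z t - D i t) + lam * (Zd t + Dd i t))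
        = \<gamma> * ip (Dd i) Z + lam * ip (Dd i) Zd + lam * ip (Dd i) (Dd i)"
      using D1[OF i] by (simp add: ip_add_right ip_diff_right ip_cmult_right s sqi_add sqi_diff sqi_cmult algebra_simps)
    ultimately show ?thesis by simp
  qed
  have "(\<Sum>i<n. \<gamma> * ip (Dd i) Z + lam * ip (Dd i) Zd + lam * ip (Dd i) (Dd i) + \<alpha> i * \<sigma>\<^sup>2 * ip (D i) (D i)) = 0"
    using key by simp
  moreover have sD: "sqi (Dd j)" if "j \<in> {..<n}" for j using aD that by (auto dest: admD)
  moreover have Zeq: "(\<lambda>t. \<Sum>j<n. Dd j t) = Zd" by (simp add: Zd_def[abs_def])
  moreover have "(\<Sum>i<n. ip (Dd i) Z) = 0"
    using ip_sum_left[of "{..<n}" Dd Z, OF sD admD(3)[OF aZ]] Z1 unfolding Zeq by simp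
  moreover have "(\<Sum>i<n. ip (Dd i) Zd) = ip Zd Zd"
    using ip_sum_left[of "{..<n}" Dd Zd, OF sD admD(2)[OF aZ]] unfolding Zeq by simp
  ultimately have tot: "lam * ip Zd Zd + lam * (\<Sum>i<n. ip (Dd i) (Dd i)) + (\<Sum>i<n. \<alpha> i * \<sigma>\<^sup>2 * ip (D i) (D i)) = 0"
    by (simp add: sum.distrib sum_distrib_left[symmetric])
  have "(\<Sum>i<n. \<alpha> i * \<sigma>\<^sup>2 * ip (D i) (D i)) \<ge> 0"
    using \<alpha> ip_nonneg by (intro sum_nonneg) (auto intro!: mult_nonneg_nonneg simp: less_imp_le)
  moreover have "lam * ip Zd Zd \<ge> 0" using lam ip_nonneg by simp
  \<comment> \<open>Three nonnegative groups add up to 0. The vanishing energy of each rate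
    difference, with \<open>D i 0 = 0\<close>, then gives equality at every time rather than almost
    everywhere.\<close>
  ultimately have "lam * (\<Sum>i<n. ip (Dd i) (Dd i)) \<le> 0" using tot by linarith
  then have "(\<Sum>i<n. ip (Dd i) (Dd i)) \<le> 0" using lam by (simp add: mult_le_0_iff)
  moreover have "ip (Dd i) (Dd i) \<le> (\<Sum>i<n. ip (Dd i) (Dd i))"
    using i ip_nonneg by (intro member_le_sum) auto
  ultimately have "ip (Dd i) (Dd i) = 0" using ip_nonneg[of "Dd i"] by linarith
  from adm_rate_zero[OF aD[OF i] this t] show ?thesis using D0[OF i] by (simp add: D_def)
qed

lemma stationary_MV_nash:
  assumes X: "\<And>i. i < n \<Longrightarrow> adm (Xs i) (Xd i)" "\<And>i. i < n \<Longrightarrow> Xs i 0 = x i"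
    and st: "stationary \<sigma> \<gamma> lam n \<alpha> Xs Xd"
    and lam: "lam > 0" and \<alpha>: "\<And>i. i < n \<Longrightarrow> \<alpha> i > 0"
  shows "MV_nash M F W S0 \<sigma> \<gamma> lam n x \<alpha> Xs"
  unfolding MV_nash_def
proof (intro allI impI conjI ballI)
  fix i assume i: "i < n"
  show "Xs i \<in> det_strategies M F (x i)" using adm_det_strategies[OF X(1)[OF i]] X(2)[OF i] by simp
  fix f assume f: "f \<in> det_strategies M F (x i)"
  obtain fd where fd: "adm f fd" using det_strategies_adm(1)[OF f] by blast
  define h where "h t = f t - Xs i t" for t
  have h: "adm h (\<lambda>t. fd t - Xd i t)" "h 0 = 0"
    using adm_diff[OF fd X(1)[OF i]] det_strategies_adm(2)[OF f] X(2)[OF i] by (auto simp: h_def[abs_def])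
  have fh: "f = (\<lambda>t. Xs i t + h t)" by (simp add: h_def)
  have q: "0 \<le> lam * ip (\<lambda>t. fd t - Xd i t) (\<lambda>t. fd t - Xd i t) + \<alpha> i / 2 * \<sigma>\<^sup>2 * ip h h"
    using lam \<alpha>[OF i] ip_nonneg by (intro add_nonneg_nonneg mult_nonneg_nonneg) (auto simp: less_imp_le)
  show "mean_variance M (\<alpha> i) (revenue M F W S0 \<sigma> \<gamma> lam n (\<lambda>j t \<omega>. (Xs(i := f)) j t) i)
    \<le> mean_variance M (\<alpha> i) (revenue M F W S0 \<sigma> \<gamma> lam n (\<lambda>j t \<omega>. Xs j t) i)"
    unfolding fh
    by (subst MV_deviation[where fd=Xd, OF X(1) i h], assumption) (use stationaryD[OF st i h] q in linarith)
qed

section \<open>Optimality of stationary points for CARA utility\<close>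

text \<open>Reduces the comparison to nonnegative integrals of exponentials, infinite values
  included.\<close>

lemma cara_utility_mono:
  assumes "a > 0" "(\<integral>\<^sup>+ \<omega>. ennreal (exp (- a * R \<omega>)) \<partial>M) \<le> (\<integral>\<^sup>+ \<omega>. ennreal (exp (- a * R' \<omega>)) \<partial>M)"
  shows "cara_utility M a R' \<le> cara_utility M a R"
  unfolding cara_utility_def using assms
  by (intro ereal_minus_mono ereal_mult_left_mono) (auto simp: less_eq_ennreal.rep_eq)

text \<open>Stationarity quantifies over all admissible \<open>h\<close>, so it applies path by path
  to the difference of a random strategy and the candidate. It turns the linear cost term into a
  pairing with the candidate, and the nonnegative rest \<open>lam * ip h' h'\<close> is
  dropped.\<close>

lemma stationary_revenue_le:
  assumes X: "\<And>i. i < n \<Longrightarrow> adm (Xs i) (Xd i)" "\<And>i. i < n \<Longrightarrow> Xs i 0 = x i"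
    and st: "stationary \<sigma> \<gamma> lam n \<alpha> Xs Xd"
    and lam: "lam > 0" and i: "i < n" and Y: "Y \<in> strategies M F (x i)"
  shows "AE \<omega> in M. revenue M F W S0 \<sigma> \<gamma> lam n ((\<lambda>j t \<omega>. Xs j t)(i := Y)) i \<omega>
    \<le> (S0 - \<gamma> * (\<Sum>j<n. x j)) * x i - ip (Xd i) (\<lambda>t. \<gamma> * (\<Sum>j<n. Xs j t) + lam * (\<Sum>j<n. Xd j t))
      + \<sigma> * l2_trading_process.Iinf W Y (rate M F Y) \<omega>
      + \<alpha> i * \<sigma>\<^sup>2 * (ip (Xs i) (\<lambda>t. Y t \<omega>) - ip (Xs i) (Xs i))"
proof -
  let ?Ys = "(\<lambda>j t (\<omega>::'a). Xs j t)(i := Y)"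
  have Ys: "?Ys j \<in> strategies M F (x j)" if "j < n" for j
    using adm_det_strategies[OF X(1)[OF that]] X(2)[OF that] Y by (auto simp: det_strategies_def)
  have rev: "AE \<omega> in M. revenue M F W S0 \<sigma> \<gamma> lam n ?Ys i \<omega>
    = (S0 - \<gamma> * (\<Sum>j<n. x j)) * x i + \<sigma> * l2_trading_process.Iinf W (?Ys i) (rate M F (?Ys i)) \<omega>
      - ip (\<lambda>t. rate M F (?Ys i) t \<omega>) (\<lambda>t. \<gamma> * (\<Sum>j<n. ?Ys j t \<omega>) + lam * (\<Sum>j<n. rate M F (?Ys j) t \<omega>))"
    by (rule revenue_AE[where Xs="?Ys", OF Ys i])
  then show ?thesis using strategy_adm[OF Y] AE_space
  proof eventually_elim
    case (elim \<omega>)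
    define h where "h t = Y t \<omega> - Xs i t" for t
    define h' where "h' t = rate M F Y t \<omega> - Xd i t" for t
    have h: "adm h h'" unfolding h_def[abs_def] h'_def[abs_def] by (rule adm_diff[OF elim(2) X(1)[OF i]])
    have h0: "h 0 = 0" using strategy_0[OF Y elim(3)] X(2)[OF i] by (simp add: h_def)
    have r: "(\<lambda>t. rate M F Y t \<omega>) = (\<lambda>t. Xd i t + h' t)" by (simp add: h'_def)
    have sumY: "(\<Sum>j<n. ?Ys j t \<omega>) = (\<Sum>j<n. Xs j t) + h t" for t
    proof -
      have "(\<Sum>j<n. ?Ys j t \<omega>) = (\<Sum>j<n. (Xs(i := \<lambda>t. Y t \<omega>)) j t)" by (intro sum.cong) auto
      then show ?thesis unfolding sum_fun_upd[OF i] by (simp add: h_def)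
    qed
    have sumr: "AE t in lborel. t \<ge> 0 \<longrightarrow> (\<Sum>j<n. rate M F (?Ys j) t \<omega>) = (\<Sum>j<n. Xd j t) + h' t"
    proof -
      have "AE t in lborel. \<forall>j\<in>{..<n}. t \<ge> 0 \<longrightarrow> rate M F (\<lambda>t \<omega>. Xs j t) t \<omega> = Xd j t"
        using det_rate_AE[OF X(1) elim(3)] by (intro AE_finite_allI) auto
      then show ?thesis
      proof (eventually_elim, intro impI)
        fix t :: real assume "\<forall>j\<in>{..<n}. t \<ge> 0 \<longrightarrow> rate M F (\<lambda>t \<omega>. Xs j t) t \<omega> = Xd j t" "t \<ge> 0"
        then have "(\<Sum>j<n. rate M F (?Ys j) t \<omega>) = (\<Sum>j<n. (Xd(i := \<lambda>t. rate M F Y t \<omega>)) j t)"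
          by (intro sum.cong) auto
        then show "(\<Sum>j<n. rate M F (?Ys j) t \<omega>) = (\<Sum>j<n. Xd j t) + h' t"
          unfolding sum_fun_upd[OF i] by (simp add: h'_def)
      qed
    qed
    have sd: "sqi (\<lambda>t. rate M F (?Ys j) t \<omega>)" if "j < n" for j
      using det_rate_adm[OF X(1)[OF that] elim(3)] elim(2) by (auto dest: admD)
    have s1: "sqi (\<lambda>t. \<Sum>j<n. Xs j t)" "sqi (\<lambda>t. \<Sum>j<n. Xd j t)" "sqi (\<lambda>t. \<Sum>j<n. rate M F (?Ys j) t \<omega>)"
      using X(1) sd by (intro sqi_sum; auto dest: admD)+
    have sY: "sqi (\<lambda>t. rate M F Y t \<omega>)" using elim(2) by (auto dest: admD)
    have "ip (\<lambda>t. rate M F Y t \<omega>) (\<lambda>t. \<gamma> * (\<Sum>j<n. ?Ys j t \<omega>) + lam * (\<Sum>j<n. rate M F (?Ys j) t \<omega>))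
      = ip (\<lambda>t. rate M F Y t \<omega>) (\<lambda>t. \<gamma> * ((\<Sum>j<n. Xs j t) + h t) + lam * ((\<Sum>j<n. Xd j t) + h' t))"
    proof (rule ip_cong_AE[OF sY _ sY])
      show "sqi (\<lambda>t. \<gamma> * (\<Sum>j<n. ?Ys j t \<omega>) + lam * (\<Sum>j<n. rate M F (?Ys j) t \<omega>))"
        unfolding sumY by (intro sqi_lincomb sqi_add s1 admD(3)[OF h])
      show "sqi (\<lambda>t. \<gamma> * ((\<Sum>j<n. Xs j t) + h t) + lam * ((\<Sum>j<n. Xd j t) + h' t))"
        by (intro sqi_lincomb sqi_add s1 admD(2,3)[OF h])
      show "AE t in lborel. t \<ge> 0 \<longrightarrow> \<gamma> * (\<Sum>j<n. ?Ys j t \<omega>) + lam * (\<Sum>j<n. rate M F (?Ys j) t \<omega>)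
          = \<gamma> * ((\<Sum>j<n. Xs j t) + h t) + lam * ((\<Sum>j<n. Xd j t) + h' t)"
        using sumr by eventually_elim (simp add: sumY del: fun_upd_apply)
    qed simp
    also have "\<dots> = ip (Xd i) (\<lambda>t. \<gamma> * (\<Sum>j<n. Xs j t) + lam * (\<Sum>j<n. Xd j t))
      + ip h' (\<lambda>t. \<gamma> * ((\<Sum>j<n. Xs j t) - Xs i t) + lam * ((\<Sum>j<n. Xd j t) + Xd i t)) + lam * ip h' h'"
      unfolding r by (rule cost_diff[OF X(1) i h h0])
    finally have cost: "ip (\<lambda>t. rate M F Y t \<omega>) (\<lambda>t. \<gamma> * (\<Sum>j<n. ?Ys j t \<omega>) + lam * (\<Sum>j<n. rate M F (?Ys j) t \<omega>))
      = ip (Xd i) (\<lambda>t. \<gamma> * (\<Sum>j<n. Xs j t) + lam * (\<Sum>j<n. Xd j t))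
      + ip h' (\<lambda>t. \<gamma> * ((\<Sum>j<n. Xs j t) - Xs i t) + lam * ((\<Sum>j<n. Xd j t) + Xd i t)) + lam * ip h' h'" .
    have "ip (Xs i) h = ip (Xs i) (\<lambda>t. Y t \<omega>) - ip (Xs i) (Xs i)"
      unfolding h_def[abs_def] using elim(2) X(1)[OF i] by (intro ip_diff_right) (auto dest: admD)
    then have E: "ip h' (\<lambda>t. \<gamma> * ((\<Sum>j<n. Xs j t) - Xs i t) + lam * ((\<Sum>j<n. Xd j t) + Xd i t))
      = - (\<alpha> i * \<sigma>\<^sup>2 * (ip (Xs i) (\<lambda>t. Y t \<omega>) - ip (Xs i) (Xs i)))"
      using stationaryD[OF st i h h0] by simp
    have "lam * ip h' h' \<ge> 0" using lam ip_nonneg by simp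
    then show ?case using elim(1) cost E by (simp del: fun_upd_apply add: fun_upd_same)
  qed
qed

text \<open>The expected exponentials are separated by
  \<open>exp (c + \<beta>\<^sup>2 / 2 * ip ?g ?g)\<close>: the candidate stays below it by
  \<open>exp_Iinf_le\<close>, every competitor above it by \<open>exp_Iinf_ge\<close>.\<close>

lemma stationary_CARA_nash:
  assumes X: "\<And>i. i < n \<Longrightarrow> adm (Xs i) (Xd i)" "\<And>i. i < n \<Longrightarrow> Xs i 0 = x i"
    and st: "stationary \<sigma> \<gamma> lam n \<alpha> Xs Xd"
    and lam: "lam > 0" and \<alpha>: "\<And>i. i < n \<Longrightarrow> \<alpha> i > 0"
    and L1: "\<And>i. i < n \<Longrightarrow> set_integrable lborel {0..} (Xs i)"
  shows "CARA_nash M F W S0 \<sigma> \<gamma> lam n x \<alpha> (\<lambda>i t \<omega>. Xs i t)"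
  unfolding CARA_nash_def
proof (intro allI impI conjI ballI)
  fix i assume i: "i < n"
  have Xst: "(\<lambda>t \<omega>. Xs j t) \<in> strategies M F (x j)" if "j < n" for j
    using adm_det_strategies[OF X(1)[OF that]] X(2)[OF that] by (simp add: det_strategies_def)
  show "(\<lambda>t \<omega>. Xs i t) \<in> strategies M F (x i)" by (rule Xst[OF i])
  fix Y assume Y: "Y \<in> strategies M F (x i)"
  let ?g = "Xs i" and ?K = "(S0 - \<gamma> * (\<Sum>j<n. x j)) * x i"
  let ?cost = "ip (Xd i) (\<lambda>t. \<gamma> * (\<Sum>j<n. Xs j t) + lam * (\<Sum>j<n. Xd j t))"
  \<comment> \<open>With this and the next constant, \<open>- \<alpha> i\<close> times the revenues
    of the candidate is almost surely \<open>c + \<beta> * S.Iinf \<omega>\<close>.\<close>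
  define \<beta> where "\<beta> = - \<alpha> i * \<sigma>"
  define c where "c = - \<alpha> i * ?K + \<alpha> i * ?cost"
  obtain C where "l2_trading_process M F W Y (rate M F Y) C" using strategy_process[OF Y] by blast
  then interpret P: l2_trading_process M F W Y "rate M F Y" C .
  obtain C' where "l2_trading_process M F W (\<lambda>t \<omega>. Xs i t) (rate M F (\<lambda>t \<omega>. Xs i t)) C'"
    using strategy_process[OF Xst[OF i]] by blast
  then interpret S: l2_trading_process M F W "\<lambda>t \<omega>. Xs i t" "rate M F (\<lambda>t \<omega>. Xs i t)" C' .
  obtain D where D: "\<And>t. 0 \<le> t \<Longrightarrow> \<bar>?g t\<bar> \<le> D" using adm_bounded[OF X(1)[OF i]] by blast
  have gc: "continuous_on {0..} ?g" by (rule ac_rate_continuous[OF admD(1)[OF X(1)[OF i]]])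
  have g2: "set_integrable lborel {0..} (\<lambda>t. (?g t)\<^sup>2)" using admD(3)[OF X(1)[OF i]] by (simp add: sqi_def)
  note low = P.exp_Iinf_ge[OF gc L1[OF i] g2 D, of \<beta>] and ipm = P.ip_measurable[OF gc L1[OF i] g2 D]
  have "(\<integral>\<^sup>+ \<omega>. ennreal (exp (- \<alpha> i * revenue M F W S0 \<sigma> \<gamma> lam n (\<lambda>i t \<omega>. Xs i t) i \<omega>)) \<partial>M)
    \<le> (\<integral>\<^sup>+ \<omega>. ennreal (exp c) * ennreal (exp (\<beta> * S.Iinf \<omega>)) \<partial>M)"
  proof (rule nn_integral_mono_AE)
    have "AE \<omega> in M. revenue M F W S0 \<sigma> \<gamma> lam n (\<lambda>i t \<omega>. Xs i t) i \<omega>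
      = (S0 - \<gamma> * (\<Sum>j<n. Xs j 0)) * Xs i 0 - ?cost + \<sigma> * S.Iinf \<omega>"
      by (rule det_revenue_AE[OF X(1) i])
    moreover have "(\<Sum>j<n. Xs j 0) = (\<Sum>j<n. x j)" using X(2) by (intro sum.cong) auto
    ultimately have "AE \<omega> in M. revenue M F W S0 \<sigma> \<gamma> lam n (\<lambda>i t \<omega>. Xs i t) i \<omega> = ?K - ?cost + \<sigma> * S.Iinf \<omega>"
      using X(2)[OF i] by simp
    then show "AE \<omega> in M. ennreal (exp (- \<alpha> i * revenue M F W S0 \<sigma> \<gamma> lam n (\<lambda>i t \<omega>. Xs i t) i \<omega>))
      \<le> ennreal (exp c) * ennreal (exp (\<beta> * S.Iinf \<omega>))"
    proof eventually_elim
      case (elim \<omega>)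
      have "- \<alpha> i * revenue M F W S0 \<sigma> \<gamma> lam n (\<lambda>i t \<omega>. Xs i t) i \<omega> = c + \<beta> * S.Iinf \<omega>"
        unfolding elim c_def \<beta>_def by (simp add: algebra_simps)
      then show ?case by (simp add: exp_add ennreal_mult)
    qed
  qed
  also have "\<dots> = ennreal (exp c) * (\<integral>\<^sup>+ \<omega>. ennreal (exp (\<beta> * S.Iinf \<omega>)) \<partial>M)"
    using S.Iinf_M by (intro nn_integral_cmult) simp
  also have "\<dots> \<le> ennreal (exp c) * ennreal (exp (\<beta>\<^sup>2 / 2 * ip ?g ?g))"
    using S.exp_Iinf_le[of ?g \<beta>] S.Vinf_det[OF admD(3)[OF X(1)[OF i]]] by (intro mult_left_mono) auto
  also have "\<dots> = ennreal (exp (c + \<beta>\<^sup>2 / 2 * ip ?g ?g)) * 1" by (simp add: exp_add ennreal_mult)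
  \<comment> \<open>Inserts the integral of \<open>exp_Iinf_ge\<close>, which is at least 1. The two
    exponents then add up to \<open>- \<alpha> i\<close> times the linearised upper bound on the
    revenues under \<open>Y\<close>.\<close>
  also have "\<dots> \<le> ennreal (exp (c + \<beta>\<^sup>2 / 2 * ip ?g ?g))
      * (\<integral>\<^sup>+ \<omega>. ennreal (exp (\<beta>\<^sup>2 / 2 * ip ?g ?g + \<beta> * P.Iinf \<omega> - \<beta>\<^sup>2 * ip ?g (\<lambda>t. Y t \<omega>))) \<partial>M)"
    by (intro mult_left_mono low) simp_all
  also have "\<dots> = (\<integral>\<^sup>+ \<omega>. ennreal (exp (c + \<beta>\<^sup>2 / 2 * ip ?g ?g))
      * ennreal (exp (\<beta>\<^sup>2 / 2 * ip ?g ?g + \<beta> * P.Iinf \<omega> - \<beta>\<^sup>2 * ip ?g (\<lambda>t. Y t \<omega>))) \<partial>M)"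
    using P.Iinf_M ipm by (intro nn_integral_cmult[symmetric]) simp
  also have "\<dots> \<le> (\<integral>\<^sup>+ \<omega>. ennreal (exp (- \<alpha> i * revenue M F W S0 \<sigma> \<gamma> lam n ((\<lambda>i t \<omega>. Xs i t)(i := Y)) i \<omega>)) \<partial>M)"
  proof (rule nn_integral_mono_AE)
    show "AE \<omega> in M. ennreal (exp (c + \<beta>\<^sup>2 / 2 * ip ?g ?g))
      * ennreal (exp (\<beta>\<^sup>2 / 2 * ip ?g ?g + \<beta> * P.Iinf \<omega> - \<beta>\<^sup>2 * ip ?g (\<lambda>t. Y t \<omega>)))
      \<le> ennreal (exp (- \<alpha> i * revenue M F W S0 \<sigma> \<gamma> lam n ((\<lambda>i t \<omega>. Xs i t)(i := Y)) i \<omega>))"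
      using stationary_revenue_le[where Xs=Xs and Xd=Xd and x=x and \<alpha>=\<alpha> and \<sigma>=\<sigma> and \<gamma>=\<gamma> and lam=lam and n=n and i=i and ?S0.0=S0, OF _ _ st lam i Y]
    proof (rule eventually_mono)
      fix \<omega>
      let ?R = "revenue M F W S0 \<sigma> \<gamma> lam n ((\<lambda>i t \<omega>. Xs i t)(i := Y)) i \<omega>"
      assume "?R \<le> ?K - ?cost + \<sigma> * P.Iinf \<omega> + \<alpha> i * \<sigma>\<^sup>2 * (ip ?g (\<lambda>t. Y t \<omega>) - ip ?g ?g)"
      then have "\<alpha> i * ?R \<le> \<alpha> i * (?K - ?cost + \<sigma> * P.Iinf \<omega> + \<alpha> i * \<sigma>\<^sup>2 * (ip ?g (\<lambda>t. Y t \<omega>) - ip ?g ?g))"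
        using \<alpha>[OF i] by (intro mult_left_mono) auto
      also have "\<dots> = - (c + \<beta>\<^sup>2 / 2 * ip ?g ?g + (\<beta>\<^sup>2 / 2 * ip ?g ?g + \<beta> * P.Iinf \<omega> - \<beta>\<^sup>2 * ip ?g (\<lambda>t. Y t \<omega>)))"
        by (simp add: c_def \<beta>_def power2_eq_square algebra_simps)
      finally have "c + \<beta>\<^sup>2 / 2 * ip ?g ?g + (\<beta>\<^sup>2 / 2 * ip ?g ?g + \<beta> * P.Iinf \<omega> - \<beta>\<^sup>2 * ip ?g (\<lambda>t. Y t \<omega>)) \<le> - \<alpha> i * ?R"
        by simp
      then show "ennreal (exp (c + \<beta>\<^sup>2 / 2 * ip ?g ?g))
        * ennreal (exp (\<beta>\<^sup>2 / 2 * ip ?g ?g + \<beta> * P.Iinf \<omega> - \<beta>\<^sup>2 * ip ?g (\<lambda>t. Y t \<omega>)))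
        \<le> ennreal (exp (- \<alpha> i * ?R))"
        by (simp only: ennreal_mult[symmetric] exp_ge_zero exp_add[symmetric] ennreal_leI exp_le_cancel_iff)
    qed (use X in auto)
  qed
  finally show "cara_utility M (\<alpha> i) (revenue M F W S0 \<sigma> \<gamma> lam n ((\<lambda>i t \<omega>. Xs i t)(i := Y)) i)
    \<le> cara_utility M (\<alpha> i) (revenue M F W S0 \<sigma> \<gamma> lam n (\<lambda>i t \<omega>. Xs i t) i)"
    by (rule cara_utility_mono[OF \<alpha>[OF i]])
qed

end

section \<open>Exponential strategies and the characteristic equations\<close>

lemma set_integrable_exp:
  fixes \<tau> :: real
  assumes "\<tau> < 0"
  shows "set_integrable lborel {0..} (\<lambda>t. exp (\<tau> * t))"
proof -
  have "(exp (\<tau> / 2 * t))\<^sup>2 = exp (\<tau> * t)" for t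
    by (simp add: power2_eq_square exp_add[symmetric])
  then show ?thesis using sqi_exp[of "\<tau> / 2"] assms by (simp add: sqi_def)
qed

lemma adm_exp2:
  assumes "p < 0" "r < 0"
  shows "adm (\<lambda>t. c * exp (p * t) + d * exp (r * t)) (\<lambda>t. c * (p * exp (p * t)) + d * (r * exp (r * t)))"
  by (rule adm_lincomb[OF adm_exp[OF assms(1)] adm_exp[OF assms(2)]])

text \<open>The hypotheses on \<open>c\<close> and \<open>d\<close> are the Euler--Lagrange equations, compared coefficientwise.\<close>

lemma exp_stationary:
  fixes n :: nat
  assumes pr: "p < 0" "r < 0"
    and c: "p * (\<gamma> * ((\<Sum>j<n. c j) - c i) + lam * p * ((\<Sum>j<n. c j) + c i)) = b * c i"
    and d: "r * (\<gamma> * ((\<Sum>j<n. d j) - d i) + lam * r * ((\<Sum>j<n. d j) + d i)) = b * d i"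
    and h: "adm h h'" "h 0 = 0"
  defines "f j t \<equiv> c j * exp (p * t) + d j * exp (r * t)"
    and "f' j t \<equiv> c j * (p * exp (p * t)) + d j * (r * exp (r * t))"
  shows "ip h' (\<lambda>t. \<gamma> * ((\<Sum>j<n. f j t) - f i t) + lam * ((\<Sum>j<n. f' j t) + f' i t)) + b * ip (f i) h = 0"
proof -
  \<comment> \<open>\<open>b1\<close> and \<open>b2\<close> are the coefficients of the two
    exponentials in the bracket. By hypothesis the derivative of the bracket is
    \<open>b * f i t\<close>, so integration by parts against \<open>h\<close> gives the weak
    form.\<close>
  define b1 where "b1 = \<gamma> * ((\<Sum>j<n. c j) - c i) + lam * p * ((\<Sum>j<n. c j) + c i)"
  define b2 where "b2 = \<gamma> * ((\<Sum>j<n. d j) - d i) + lam * r * ((\<Sum>j<n. d j) + d i)"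
  let ?B = "\<lambda>t. b1 * exp (p * t) + b2 * exp (r * t)"
  let ?B' = "\<lambda>t. b1 * (p * exp (p * t)) + b2 * (r * exp (r * t))"
  have eq: "(\<lambda>t. \<gamma> * ((\<Sum>j<n. f j t) - f i t) + lam * ((\<Sum>j<n. f' j t) + f' i t)) = ?B"
  proof
    fix t
    have s: "(\<Sum>j<n. f j t) = (\<Sum>j<n. c j) * exp (p * t) + (\<Sum>j<n. d j) * exp (r * t)"
      "(\<Sum>j<n. f' j t) = (\<Sum>j<n. c j) * (p * exp (p * t)) + (\<Sum>j<n. d j) * (r * exp (r * t))"
      by (simp_all add: f_def f'_def sum.distrib sum_distrib_right)
    show "\<gamma> * ((\<Sum>j<n. f j t) - f i t) + lam * ((\<Sum>j<n. f' j t) + f' i t) = ?B t"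
      unfolding s by (simp add: b1_def b2_def f_def f'_def algebra_simps)
  qed
  have B': "?B' = (\<lambda>t. b * f i t)"
  proof
    fix t
    have "?B' t = (p * b1) * exp (p * t) + (r * b2) * exp (r * t)" by (simp add: algebra_simps)
    also have "\<dots> = b * f i t" using c d unfolding b1_def b2_def f_def by (simp add: algebra_simps)
    finally show "?B' t = b * f i t" .
  qed
  have "ip h ?B' + ip ?B h' = 0"
    using adm_ibp[OF h(1) adm_exp2[OF pr]] h(2) by simp
  then show ?thesis unfolding eq B' ip_cmult_right by (simp add: ip_commute)
qed

lemma (in brownian_space) exp_equilibrium:
  fixes n :: nat
  assumes pr: "p < 0" "r < 0" and lam: "lam > 0" and \<alpha>: "\<And>i. i < n \<Longrightarrow> \<alpha> i > 0"
    and c: "\<And>i. i < n \<Longrightarrow> p * (\<gamma> * ((\<Sum>j<n. c j) - c i) + lam * p * ((\<Sum>j<n. c j) + c i)) = \<alpha> i * \<sigma>\<^sup>2 * c i"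
    and d: "\<And>i. i < n \<Longrightarrow> r * (\<gamma> * ((\<Sum>j<n. d j) - d i) + lam * r * ((\<Sum>j<n. d j) + d i)) = \<alpha> i * \<sigma>\<^sup>2 * d i"
    and x: "\<And>i. i < n \<Longrightarrow> c i + d i = x i"
  defines "Xs i t \<equiv> c i * exp (p * t) + d i * exp (r * t)"
  shows "MV_nash M F W S0 \<sigma> \<gamma> lam n x \<alpha> Xs"
    and "MV_nash M F W S0 \<sigma> \<gamma> lam n x \<alpha> Ys \<Longrightarrow> i < n \<Longrightarrow> t \<ge> 0 \<Longrightarrow> Ys i t = Xs i t"
    and "CARA_nash M F W S0 \<sigma> \<gamma> lam n x \<alpha> (\<lambda>i t \<omega>. Xs i t)"
proof -
  define Xd where "Xd i t = c i * (p * exp (p * t)) + d i * (r * exp (r * t))" for i t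
  have X: "adm (Xs i) (Xd i)" for i unfolding Xs_def[abs_def] Xd_def[abs_def] by (rule adm_exp2[OF pr])
  have X0: "Xs i 0 = x i" if "i < n" for i using x[OF that] by (simp add: Xs_def)
  have st: "stationary \<sigma> \<gamma> lam n \<alpha> Xs Xd"
    unfolding stationary_def Xs_def[abs_def] Xd_def[abs_def] by (intro allI impI exp_stationary[OF pr c d])
  show "MV_nash M F W S0 \<sigma> \<gamma> lam n x \<alpha> Xs"
    by (rule stationary_MV_nash[OF X X0 st lam \<alpha>])
  \<comment> \<open>Beyond admissibility the CARA comparison asks for an absolutely integrable
    candidate, which decaying exponentials provide.\<close>
  have "set_integrable lborel {0..} (Xs i)" for i
    unfolding Xs_def[abs_def]
    by (intro set_integral_add(1) set_integrable_mult_right set_integrable_exp pr)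
  then show "CARA_nash M F W S0 \<sigma> \<gamma> lam n x \<alpha> (\<lambda>i t \<omega>. Xs i t)"
    by (intro stationary_CARA_nash[OF X X0 st lam \<alpha>])
  assume N: "MV_nash M F W S0 \<sigma> \<gamma> lam n x \<alpha> Ys" and i: "i < n" and t: "t \<ge> 0"
  obtain Yd where Y: "\<And>i. i < n \<Longrightarrow> adm (Ys i) (Yd i)" "\<And>i. i < n \<Longrightarrow> Ys i 0 = x i"
    using MV_nash_adm[OF N] by blast
  show "Ys i t = Xs i t"
    by (rule stationary_unique[where Yd=Yd and Xd=Xd and n=n, OF X Y(1) _ st MV_nash_stationary[OF N Y(1)] lam \<alpha> i t])
       (auto simp: Y(2) X0)
qed

section \<open>The quartic, its negative roots and the associated kernel vectors\<close>

text \<open>Eliminating \<open>c2\<close> and then \<open>c0\<close> from the three equations leaves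
  \<open>u - v\<close> times a positive cofactor, so no three positive roots can be
  distinct.\<close>

lemma quartic_root_unique:
  fixes s u v c0 c2 c3 :: real
  assumes pos: "s > 0" "u > 0" "v > 0" "c3 \<ge> 0" and ne: "s \<noteq> u" "s \<noteq> v"
    and s: "s ^ 4 + c3 * s ^ 3 - c2 * s\<^sup>2 + c0 = 0" and u: "u ^ 4 + c3 * u ^ 3 - c2 * u\<^sup>2 + c0 = 0"
    and v: "v ^ 4 + c3 * v ^ 3 - c2 * v\<^sup>2 + c0 = 0"
  shows "u = v"
proof -
  \<comment> \<open>\<open>c2\<close> cancels from \<open>w\<^sup>2\<close> times the equation of
    \<open>s\<close> minus \<open>s\<^sup>2\<close> times that of \<open>w\<close>, and the
    difference is divisible by \<open>s - w\<close>.\<close>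
  have E: "s\<^sup>2 * w\<^sup>2 * (s + w + c3) = c0 * (s + w)" if "s \<noteq> w" "w ^ 4 + c3 * w ^ 3 - c2 * w\<^sup>2 + c0 = 0" for w
  proof -
    have "w\<^sup>2 * (s ^ 4 + c3 * s ^ 3 - c2 * s\<^sup>2 + c0) - s\<^sup>2 * (w ^ 4 + c3 * w ^ 3 - c2 * w\<^sup>2 + c0)
      = (s - w) * (s\<^sup>2 * w\<^sup>2 * (s + w + c3) - c0 * (s + w))"
      by algebra
    then show ?thesis using that s by simp
  qed
  have "s\<^sup>2 * ((u - v) * ((s + u) * (s + v) * (u + v) + c3 * (s * (u + v) + u * v)))
     = (s\<^sup>2 * u\<^sup>2 * (s + u + c3) - c0 * (s + u)) * (s + v) - (s\<^sup>2 * v\<^sup>2 * (s + v + c3) - c0 * (s + v)) * (s + u)"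
    by algebra
  also have "\<dots> = 0" using E[OF ne(1) u] E[OF ne(2) v] by simp
  finally have "s\<^sup>2 * ((u - v) * ((s + u) * (s + v) * (u + v) + c3 * (s * (u + v) + u * v))) = 0" .
  moreover have "(s + u) * (s + v) * (u + v) + c3 * (s * (u + v) + u * v) > 0"
    using pos by (intro add_pos_nonneg mult_pos_pos mult_nonneg_nonneg add_nonneg_nonneg) auto
  ultimately show ?thesis using pos by simp
qed

text \<open>The quartic is, up to the factor \<open>3 lam\<^sup>2\<close>, the determinant of the symmetric \<open>2 \<times> 2\<close> matrix of the
  Euler--Lagrange system for exponential strategies.\<close>

lemma quartic_det:
  fixes lam \<gamma> A B \<tau> :: real
  assumes "lam > 0"
  shows "3 * lam\<^sup>2 * (\<tau> ^ 4 - (2 * \<gamma>) / (3 * lam) * \<tau> ^ 3 - (\<gamma>\<^sup>2 + 2 * lam * (A + B)) / (3 * lam\<^sup>2) * \<tau>\<^sup>2 + A * B / (3 * lam\<^sup>2))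
    = (2 * lam * \<tau>\<^sup>2 - A) * (2 * lam * \<tau>\<^sup>2 - B) - (lam * \<tau>\<^sup>2 + \<gamma> * \<tau>)\<^sup>2"
proof -
  let ?c3 = "(2 * \<gamma>) / (3 * lam)" and ?c2 = "(\<gamma>\<^sup>2 + 2 * lam * (A + B)) / (3 * lam\<^sup>2)" and ?c0 = "A * B / (3 * lam\<^sup>2)"
  have c: "3 * lam\<^sup>2 * ?c3 = 2 * lam * \<gamma>" "3 * lam\<^sup>2 * ?c2 = \<gamma>\<^sup>2 + 2 * lam * (A + B)" "3 * lam\<^sup>2 * ?c0 = A * B"
    using assms by (simp_all add: power2_eq_square)
  have "3 * lam\<^sup>2 * (\<tau> ^ 4 - ?c3 * \<tau> ^ 3 - ?c2 * \<tau>\<^sup>2 + ?c0)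
    = 3 * lam\<^sup>2 * \<tau> ^ 4 - (3 * lam\<^sup>2 * ?c3) * \<tau> ^ 3 - (3 * lam\<^sup>2 * ?c2) * \<tau>\<^sup>2 + 3 * lam\<^sup>2 * ?c0"
    by (simp only: right_diff_distrib distrib_left mult.assoc)
  also have "\<dots> = (2 * lam * \<tau>\<^sup>2 - A) * (2 * lam * \<tau>\<^sup>2 - B) - (lam * \<tau>\<^sup>2 + \<gamma> * \<tau>)\<^sup>2"
    unfolding c by algebra
  finally show ?thesis .
qed

text \<open>By \<open>quartic_det\<close> the quartic is, up to a positive factor, minus a square
  wherever \<open>2 * lam * \<tau>\<^sup>2\<close> equals \<open>A\<close> or \<open>B\<close>. This
  yields a negative value between two positive ones, hence two roots;
  \<open>quartic_root_unique\<close> after reflection excludes a third.\<close>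

lemma quartic_negative_roots:
  fixes lam \<gamma> A B :: real
  assumes lam: "lam > 0" and \<gamma>: "\<gamma> \<ge> 0" and AB: "A > 0" "B > 0" "A \<noteq> B"
  defines "P \<tau> \<equiv> \<tau> ^ 4 - (2 * \<gamma>) / (3 * lam) * \<tau> ^ 3 - (\<gamma>\<^sup>2 + 2 * lam * (A + B)) / (3 * lam\<^sup>2) * \<tau>\<^sup>2 + A * B / (3 * lam\<^sup>2)"
  shows "\<exists>\<tau>1 \<tau>2. \<tau>1 \<noteq> \<tau>2 \<and> {\<tau>. \<tau> < 0 \<and> P \<tau> = 0} = {\<tau>1, \<tau>2}"
proof -
  define c3 where "c3 = (2 * \<gamma>) / (3 * lam)"
  define c2 where "c2 = (\<gamma>\<^sup>2 + 2 * lam * (A + B)) / (3 * lam\<^sup>2)"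
  define c0 where "c0 = A * B / (3 * lam\<^sup>2)"
  have cp: "c3 \<ge> 0" "c2 \<ge> 0" "c0 > 0" using lam \<gamma> AB by (auto simp: c3_def c2_def c0_def)
  have P: "P \<tau> = \<tau> ^ 4 - c3 * \<tau> ^ 3 - c2 * \<tau>\<^sup>2 + c0" for \<tau> by (simp add: P_def c3_def c2_def c0_def)
  have det: "3 * lam\<^sup>2 * P \<tau> = (2 * lam * \<tau>\<^sup>2 - A) * (2 * lam * \<tau>\<^sup>2 - B) - (lam * \<tau>\<^sup>2 + \<gamma> * \<tau>)\<^sup>2" for \<tau>
    unfolding P_def by (rule quartic_det[OF lam])
  have cont: "continuous_on S P" for S unfolding P by (intro continuous_intros)
  have "\<exists>t<0. P t < 0"
  proof -
    define tA where "tA = - sqrt (A / (2 * lam))"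
    define tB where "tB = - sqrt (B / (2 * lam))"
    have t: "tA < 0" "tB < 0" "2 * lam * tA\<^sup>2 = A" "2 * lam * tB\<^sup>2 = B"
      using AB lam by (auto simp: tA_def tB_def)
    have "3 * lam\<^sup>2 * P tA = - (tA * (lam * tA + \<gamma>))\<^sup>2" "3 * lam\<^sup>2 * P tB = - (tB * (lam * tB + \<gamma>))\<^sup>2"
      unfolding det t(3,4) by (simp_all add: power2_eq_square algebra_simps)
    \<comment> \<open>If both squares vanished, \<open>tA\<close> and \<open>tB\<close> would
      coincide; here distinctness of the risk aversions enters.\<close>
    moreover have "lam * tA + \<gamma> \<noteq> 0 \<or> lam * tB + \<gamma> \<noteq> 0"
    proof (rule ccontr)
      assume "\<not> ?thesis"
      then have "lam * tA = lam * tB" by linarith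
      then show False using lam t(3,4) AB(3) by simp
    qed
    ultimately have "3 * lam\<^sup>2 * P tA < 0 \<or> 3 * lam\<^sup>2 * P tB < 0" using t(1,2) by auto
    then show ?thesis using t(1,2) lam by (auto simp: mult_less_0_iff)
  qed
  then obtain t0 where t0: "t0 < 0" "P t0 < 0" by blast
  \<comment> \<open>Far enough to the left that \<open>c2 \<le> s\<^sup>2\<close>, so that the
    positive powers dominate and \<open>P s\<close> is at least \<open>c0\<close>.\<close>
  define s where "s = t0 - 1 - c2"
  have s: "s < t0" "P s > 0"
  proof -
    show "s < t0" using cp by (simp add: s_def)
    have "1 + c2 \<le> - s" using t0 by (simp add: s_def)
    then have "(1 + c2)\<^sup>2 \<le> (- s)\<^sup>2" using cp by (intro power_mono) auto
    moreover have "c2 \<le> (1 + c2)\<^sup>2" using cp by (simp add: power2_eq_square algebra_simps)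
    ultimately have "c2 \<le> s\<^sup>2" by simp
    then have "0 \<le> s\<^sup>2 * (s\<^sup>2 - c2)" by simp
    moreover have "0 \<le> c3 * (- (s ^ 3))"
    proof -
      have "s < 0" using \<open>s < t0\<close> t0 by simp
      then have "s ^ 3 < 0" by simp
      then show ?thesis using cp mult_nonneg_nonpos[of c3 "s ^ 3"] by simp
    qed
    moreover have "P s = s\<^sup>2 * (s\<^sup>2 - c2) + c3 * (- (s ^ 3)) + c0" unfolding P by algebra
    ultimately show "P s > 0" using cp by linarith
  qed
  obtain \<tau>1 where 1: "t0 \<le> \<tau>1" "\<tau>1 \<le> 0" "P \<tau>1 = 0"
    using IVT'[of P t0 0 0] t0 cont cp by (auto simp: P less_imp_le)
  obtain \<tau>2 where 2: "s \<le> \<tau>2" "\<tau>2 \<le> t0" "P \<tau>2 = 0"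
    using IVT2'[of P t0 0 s] t0 s cont by (auto simp: less_imp_le)
  have neg: "\<tau>1 < 0" "\<tau>2 < 0" using 1 2 t0 cp by (auto simp: P less_le)
  have ne: "\<tau>1 \<noteq> \<tau>2" using 1 2 t0 by (metis less_irrefl order_antisym)
  have "{\<tau>. \<tau> < 0 \<and> P \<tau> = 0} = {\<tau>1, \<tau>2}"
  proof (intro equalityI subsetI)
    fix \<tau> assume "\<tau> \<in> {\<tau>. \<tau> < 0 \<and> P \<tau> = 0}"
    then have t: "\<tau> < 0" "P \<tau> = 0" by auto
    have flip: "(- w) ^ 4 + c3 * (- w) ^ 3 - c2 * (- w)\<^sup>2 + c0 = 0" if "P w = 0" for w
      using that unfolding P by (simp add: power2_eq_square power3_eq_cube power4_eq_xxxx)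
    show "\<tau> \<in> {\<tau>1, \<tau>2}"
      using quartic_root_unique[of "- \<tau>" "- \<tau>1" "- \<tau>2" c3 c2 c0] t neg cp ne flip[OF t(2)] flip[OF 1(3)] flip[OF 2(3)]
      by auto
  qed (use neg 1 2 in auto)
  then show ?thesis using ne by blast
qed

lemma kernel_2x2:
  fixes p q w :: real
  assumes "p * w = q\<^sup>2"
  shows "\<exists>u v. (u, v) \<noteq> (0, 0) \<and> p * u + q * v = 0 \<and> q * u + w * v = 0"
proof (cases "p = 0 \<and> q = 0")
  case True
  then have "(1::real, 0::real) \<noteq> (0, 0) \<and> p * 1 + q * 0 = 0 \<and> q * 1 + w * 0 = 0" by simp
  then show ?thesis by blast
next
  case False
  then have "(q, - p) \<noteq> (0, 0) \<and> p * q + q * (- p) = 0 \<and> q * q + w * (- p) = 0"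
    using assms by (auto simp: power2_eq_square mult.commute)
  then show ?thesis by blast
qed

text \<open>Contracting the two kernel equations with the vector itself gives a quadratic equation for \<open>\<tau>\<close> whose roots have
  opposite signs; hence different negative roots of the quartic have independent kernel vectors.\<close>

lemma kernel_root_unique:
  fixes lam \<gamma> A B u v :: real
  assumes lam: "lam > 0" and AB: "A > 0" "B > 0" and uv: "(u, v) \<noteq> (0, 0)" and neg: "\<tau>1 < 0" "\<tau>2 < 0"
    and 1: "(2 * lam * \<tau>1\<^sup>2 - A) * u + (lam * \<tau>1\<^sup>2 + \<gamma> * \<tau>1) * v = 0" "(lam * \<tau>1\<^sup>2 + \<gamma> * \<tau>1) * u + (2 * lam * \<tau>1\<^sup>2 - B) * v = 0"
    and 2: "(2 * lam * \<tau>2\<^sup>2 - A) * u + (lam * \<tau>2\<^sup>2 + \<gamma> * \<tau>2) * v = 0" "(lam * \<tau>2\<^sup>2 + \<gamma> * \<tau>2) * u + (2 * lam * \<tau>2\<^sup>2 - B) * v = 0"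
  shows "\<tau>1 = \<tau>2"
proof (rule ccontr)
  assume ne: "\<tau>1 \<noteq> \<tau>2"
  define P where "P = lam * (u\<^sup>2 + v\<^sup>2 + (u + v)\<^sup>2)"
  define Q where "Q = 2 * \<gamma> * u * v"
  define R where "R = A * u\<^sup>2 + B * v\<^sup>2"
  have uvp: "u\<^sup>2 + v\<^sup>2 > 0" using uv by (simp add: sum_power2_gt_zero_iff)
  have Pp: "P > 0" using lam uvp by (auto simp: P_def intro!: mult_pos_pos add_pos_nonneg)
  have Rp: "R > 0"
    using AB uv by (auto simp: R_def intro: add_pos_nonneg add_nonneg_pos)
  have q1: "P * \<tau>1\<^sup>2 + Q * \<tau>1 = R"
  proof -
    have "P * \<tau>1\<^sup>2 + Q * \<tau>1 - R = u * ((2 * lam * \<tau>1\<^sup>2 - A) * u + (lam * \<tau>1\<^sup>2 + \<gamma> * \<tau>1) * v)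
      + v * ((lam * \<tau>1\<^sup>2 + \<gamma> * \<tau>1) * u + (2 * lam * \<tau>1\<^sup>2 - B) * v)"
      unfolding P_def Q_def R_def by algebra
    then show ?thesis using 1 by simp
  qed
  have q2: "P * \<tau>2\<^sup>2 + Q * \<tau>2 = R"
  proof -
    have "P * \<tau>2\<^sup>2 + Q * \<tau>2 - R = u * ((2 * lam * \<tau>2\<^sup>2 - A) * u + (lam * \<tau>2\<^sup>2 + \<gamma> * \<tau>2) * v)
      + v * ((lam * \<tau>2\<^sup>2 + \<gamma> * \<tau>2) * u + (2 * lam * \<tau>2\<^sup>2 - B) * v)"
      unfolding P_def Q_def R_def by algebra
    then show ?thesis using 2 by simp
  qed
  \<comment> \<open>Eliminating \<open>Q\<close> amounts to Vieta's relation: the product of two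
    distinct roots would be \<open>- R / P\<close>, which is negative.\<close>
  have "(\<tau>2 - \<tau>1) * (P * (\<tau>1 * \<tau>2) + R) = \<tau>2 * (R - (P * \<tau>1\<^sup>2 + Q * \<tau>1)) - \<tau>1 * (R - (P * \<tau>2\<^sup>2 + Q * \<tau>2))"
    by algebra
  then have "P * (\<tau>1 * \<tau>2) + R = 0" using q1 q2 ne by simp
  moreover have "P * (\<tau>1 * \<tau>2) > 0" using Pp neg by (intro mult_pos_pos mult_neg_neg)
  ultimately show False using Rp by linarith
qed

text \<open>Were the two vectors proportional, one nonzero vector would lie in both kernels, which
  \<open>kernel_root_unique\<close> excludes.\<close>

lemma kernel_independent:
  fixes lam \<gamma> A B :: real
  assumes lam: "lam > 0" and AB: "A > 0" "B > 0" and neg: "\<tau>1 < 0" "\<tau>2 < 0" "\<tau>1 \<noteq> \<tau>2"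
    and nz: "(u1, v1) \<noteq> (0, 0)" "(u2, v2) \<noteq> (0, 0)"
    and 1: "(2 * lam * \<tau>1\<^sup>2 - A) * u1 + (lam * \<tau>1\<^sup>2 + \<gamma> * \<tau>1) * v1 = 0" "(lam * \<tau>1\<^sup>2 + \<gamma> * \<tau>1) * u1 + (2 * lam * \<tau>1\<^sup>2 - B) * v1 = 0"
    and 2: "(2 * lam * \<tau>2\<^sup>2 - A) * u2 + (lam * \<tau>2\<^sup>2 + \<gamma> * \<tau>2) * v2 = 0" "(lam * \<tau>2\<^sup>2 + \<gamma> * \<tau>2) * u2 + (2 * lam * \<tau>2\<^sup>2 - B) * v2 = 0"
  shows "u1 * v2 - u2 * v1 \<noteq> 0"
proof
  assume D: "u1 * v2 - u2 * v1 = 0"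
  obtain k where k: "k \<noteq> 0" "u2 = k * u1" "v2 = k * v1"
  proof (cases "u1 = 0")
    case True
    then have "v1 \<noteq> 0" "u2 = 0" using nz(1) D by auto
    then show ?thesis using that[of "v2 / v1"] nz(2) True by auto
  next
    case False
    then have "v2 = u2 / u1 * v1" using D by (simp add: field_simps)
    then show ?thesis using that[of "u2 / u1"] nz(2) False by auto
  qed
  have "k * ((2 * lam * \<tau>2\<^sup>2 - A) * u1 + (lam * \<tau>2\<^sup>2 + \<gamma> * \<tau>2) * v1) = 0"
    "k * ((lam * \<tau>2\<^sup>2 + \<gamma> * \<tau>2) * u1 + (2 * lam * \<tau>2\<^sup>2 - B) * v1) = 0"
    using 2 unfolding k(2,3) by (simp_all add: algebra_simps)
  then have "\<tau>1 = \<tau>2" using k(1) by (intro kernel_root_unique[OF lam AB nz(1) neg(1,2) 1]) auto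
  then show False using neg(3) by simp
qed

text \<open>The roots have opposite signs because \<open>A\<close> and \<open>C\<close> are
  positive, and \<open>t\<close> is the smaller one. Both exponents of the symmetric case are
  instances.\<close>

lemma quadratic_negative_root:
  fixes A B C :: real
  assumes "A > 0" "C > 0"
  defines "t \<equiv> - B / (2 * A) - sqrt (B\<^sup>2 + 4 * A * C) / (2 * A)"
  shows "t < 0" "A * t\<^sup>2 + B * t = C"
proof -
  define q where "q = sqrt (B\<^sup>2 + 4 * A * C)"
  have pos: "4 * A * C > 0" using assms by simp
  have q2: "q\<^sup>2 = B\<^sup>2 + 4 * A * C" unfolding q_def using pos by (simp add: add_nonneg_nonneg less_imp_le)
  have "sqrt (B\<^sup>2) < q" unfolding q_def using pos by (intro real_sqrt_less_mono) simp
  then have q: "- B < q" by simp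
  have "t = - B / (2 * A) - q / (2 * A)" unfolding t_def q_def ..
  then have tq: "2 * A * t = - B - q" using assms(1) by (simp add: field_simps)
  then have "2 * A * t < 0" using q by simp
  then show "t < 0" using assms(1) by (simp add: mult_less_0_iff)
  have "4 * A * (A * t\<^sup>2 + B * t) = (2 * A * t + B)\<^sup>2 - B\<^sup>2" by algebra
  also have "\<dots> = 4 * A * C" using q2 unfolding tq by simp
  finally show "A * t\<^sup>2 + B * t = C" using assms(1) by simp
qed

theorem theorem3p1:
  fixes M :: "'a measure" and F :: "real \<Rightarrow> 'a measure" and W :: "real \<Rightarrow> 'a \<Rightarrow> real"
    and S0 \<sigma> \<gamma> lam a :: real and n :: nat and \<alpha> x :: "nat \<Rightarrow> real"
  assumes "prob_space M" and "filtration_on M F" and "brownian_motion M F W"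
    and "\<sigma> \<noteq> 0" and "\<gamma> \<ge> 0" and "lam > 0"
    and cases: "(n \<ge> 1 \<and> a > 0 \<and> (\<forall>i<n. \<alpha> i = a)) \<or>
                (n = 2 \<and> \<alpha> 0 > 0 \<and> \<alpha> 1 > 0 \<and> \<alpha> 0 \<noteq> \<alpha> 1)"
  shows "\<exists>Xs. MV_nash M F W S0 \<sigma> \<gamma> lam n x \<alpha> Xs
           \<and> (\<forall>Ys. MV_nash M F W S0 \<sigma> \<gamma> lam n x \<alpha> Ys \<longrightarrow> (\<forall>i<n. \<forall>t\<ge>0. Ys i t = Xs i t))
           \<and> CARA_nash M F W S0 \<sigma> \<gamma> lam n x \<alpha> (\<lambda>i t \<omega>. Xs i t)
           \<and> ((n \<ge> 1 \<and> a > 0 \<and> (\<forall>i<n. \<alpha> i = a)) \<longrightarrow>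
               (let xbar = (\<Sum>j<n. x j) / real n;
                    \<theta> = \<gamma> / (2 * lam) - sqrt (\<gamma>\<^sup>2 + 4 * a * \<sigma>\<^sup>2 * lam) / (2 * lam);
                    \<rho> = - ((real n - 1) * \<gamma>) / (2 * (real n + 1) * lam)
                        - sqrt ((real n - 1)\<^sup>2 * \<gamma>\<^sup>2 + 4 * (real n + 1) * a * \<sigma>\<^sup>2 * lam) / (2 * (real n + 1) * lam)
                in \<forall>i<n. \<forall>t\<ge>0. Xs i t = (x i - xbar) * exp (\<theta> * t) + xbar * exp (\<rho> * t)))
           \<and> ((n = 2 \<and> \<alpha> 0 > 0 \<and> \<alpha> 1 > 0 \<and> \<alpha> 0 \<noteq> \<alpha> 1) \<longrightarrow>
               (\<exists>\<tau>1 \<tau>2. \<tau>1 \<noteq> \<tau>2 \<and>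
                  {\<tau>::real. \<tau> < 0 \<and>
                     \<tau> ^ 4 - (2 * \<gamma>) / (3 * lam) * \<tau> ^ 3
                     - (\<gamma>\<^sup>2 + 2 * lam * \<sigma>\<^sup>2 * (\<alpha> 0 + \<alpha> 1)) / (3 * lam\<^sup>2) * \<tau>\<^sup>2
                     + (\<sigma> ^ 4 * \<alpha> 0 * \<alpha> 1) / (3 * lam\<^sup>2) = 0} = {\<tau>1, \<tau>2} \<and>
                  (\<forall>i<2. \<exists>c1 c2. \<forall>t\<ge>0. Xs i t = c1 * exp (\<tau>1 * t) + c2 * exp (\<tau>2 * t))))"
proof -
  interpret brownian_space M F W
    using assms(1-3) by (simp add: brownian_space_def brownian_space_axioms_def)
  have \<sigma>2: "\<sigma>\<^sup>2 > 0" using assms(4) by simp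
  from cases show ?thesis
  proof
    assume a: "n \<ge> 1 \<and> a > 0 \<and> (\<forall>i<n. \<alpha> i = a)"
    define xbar where "xbar = (\<Sum>j<n. x j) / real n"
    define \<theta> where "\<theta> = \<gamma> / (2 * lam) - sqrt (\<gamma>\<^sup>2 + 4 * a * \<sigma>\<^sup>2 * lam) / (2 * lam)"
    define \<rho> where "\<rho> = - ((real n - 1) * \<gamma>) / (2 * (real n + 1) * lam)
      - sqrt ((real n - 1)\<^sup>2 * \<gamma>\<^sup>2 + 4 * (real n + 1) * a * \<sigma>\<^sup>2 * lam) / (2 * (real n + 1) * lam)"
    \<comment> \<open>For equal risk aversions the Euler-Lagrange system preserves both patterns,
      deviations with sum 0 and positions common to all agents, so each pattern decays with its own
      exponent.\<close>
    define Xs where "Xs i t = (x i - xbar) * exp (\<theta> * t) + xbar * exp (\<rho> * t)" for i t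
    have as: "a * \<sigma>\<^sup>2 > 0" using a \<sigma>2 by simp
    have \<theta>: "\<theta> < 0" "lam * \<theta>\<^sup>2 + (- \<gamma>) * \<theta> = a * \<sigma>\<^sup>2"
    proof -
      have eq: "\<theta> = - (- \<gamma>) / (2 * lam) - sqrt ((- \<gamma>)\<^sup>2 + 4 * lam * (a * \<sigma>\<^sup>2)) / (2 * lam)"
        unfolding \<theta>_def by (simp add: mult_ac)
      show "\<theta> < 0" "lam * \<theta>\<^sup>2 + (- \<gamma>) * \<theta> = a * \<sigma>\<^sup>2"
        unfolding eq by (rule quadratic_negative_root[OF assms(6) as])+
    qed
    have \<rho>: "\<rho> < 0" "((real n + 1) * lam) * \<rho>\<^sup>2 + ((real n - 1) * \<gamma>) * \<rho> = a * \<sigma>\<^sup>2"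
    proof -
      have n1: "(real n + 1) * lam > 0" using assms(6) by simp
      have eq: "\<rho> = - ((real n - 1) * \<gamma>) / (2 * ((real n + 1) * lam))
        - sqrt (((real n - 1) * \<gamma>)\<^sup>2 + 4 * ((real n + 1) * lam) * (a * \<sigma>\<^sup>2)) / (2 * ((real n + 1) * lam))"
        unfolding \<rho>_def power_mult_distrib by (simp only: mult_ac)
      show "\<rho> < 0" "((real n + 1) * lam) * \<rho>\<^sup>2 + ((real n - 1) * \<gamma>) * \<rho> = a * \<sigma>\<^sup>2"
        unfolding eq by (rule quadratic_negative_root[OF n1 as])+
    qed
    have nx: "real n * xbar = (\<Sum>j<n. x j)" using a by (simp add: xbar_def)
    have s1: "(\<Sum>j<n. x j - xbar) = 0" using nx by (simp add: sum_subtractf)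
    have s2: "(\<Sum>j<n. xbar) = real n * xbar" by simp
    \<comment> \<open>The aggregate of the deviations is 0, so the agents decouple and the quadratic
      equation of \<open>\<theta>\<close> remains, without \<open>n\<close>.\<close>
    have c: "\<theta> * (\<gamma> * ((\<Sum>j<n. x j - xbar) - (x i - xbar)) + lam * \<theta> * ((\<Sum>j<n. x j - xbar) + (x i - xbar))) = \<alpha> i * \<sigma>\<^sup>2 * (x i - xbar)"
      if "i < n" for i
    proof -
      have "\<theta> * (\<gamma> * (0 - (x i - xbar)) + lam * \<theta> * (0 + (x i - xbar))) = (lam * \<theta>\<^sup>2 + (- \<gamma>) * \<theta>) * (x i - xbar)" by algebra
      then show ?thesis unfolding s1 \<theta>(2) using a that by simp
    qed
    \<comment> \<open>Now the aggregate is \<open>n\<close> times a single position, the source of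
      the factors \<open>n - 1\<close> and \<open>n + 1\<close> in \<open>\<rho>\<close>.\<close>
    have d: "\<rho> * (\<gamma> * ((\<Sum>j<n. xbar) - xbar) + lam * \<rho> * ((\<Sum>j<n. xbar) + xbar)) = \<alpha> i * \<sigma>\<^sup>2 * xbar" if "i < n" for i
    proof -
      have "\<rho> * (\<gamma> * (real n * xbar - xbar) + lam * \<rho> * (real n * xbar + xbar))
        = (((real n + 1) * lam) * \<rho>\<^sup>2 + ((real n - 1) * \<gamma>) * \<rho>) * xbar" by algebra
      then show ?thesis unfolding s2 \<rho>(2) using a that by simp
    qed
    have \<alpha>: "\<alpha> i > 0" if "i < n" for i using a that by simp
    have x0: "(x i - xbar) + xbar = x i" if "i < n" for i by simp
    have "MV_nash M F W S0 \<sigma> \<gamma> lam n x \<alpha> Xs" unfolding Xs_def[abs_def]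
      by (rule exp_equilibrium(1)[where c="\<lambda>i. x i - xbar" and d="\<lambda>_. xbar", OF \<theta>(1) \<rho>(1) assms(6) \<alpha> c d x0])
    moreover have "\<forall>Ys. MV_nash M F W S0 \<sigma> \<gamma> lam n x \<alpha> Ys \<longrightarrow> (\<forall>i<n. \<forall>t\<ge>0. Ys i t = Xs i t)"
      unfolding Xs_def[abs_def]
      by (intro allI impI exp_equilibrium(2)[where c="\<lambda>i. x i - xbar" and d="\<lambda>_. xbar", OF \<theta>(1) \<rho>(1) assms(6) \<alpha> c d x0])
    moreover have "CARA_nash M F W S0 \<sigma> \<gamma> lam n x \<alpha> (\<lambda>i t \<omega>. Xs i t)" unfolding Xs_def[abs_def]
      by (rule exp_equilibrium(3)[where c="\<lambda>i. x i - xbar" and d="\<lambda>_. xbar", OF \<theta>(1) \<rho>(1) assms(6) \<alpha> c d x0])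
    \<comment> \<open>The two cases exclude each other, so the clause on the quartic holds
      vacuously.\<close>
    moreover have "\<not> (n = 2 \<and> \<alpha> 0 > 0 \<and> \<alpha> 1 > 0 \<and> \<alpha> 0 \<noteq> \<alpha> 1)" using a by auto
    moreover have "\<forall>i<n. \<forall>t\<ge>0. Xs i t = (x i - xbar) * exp (\<theta> * t) + xbar * exp (\<rho> * t)"
      by (simp add: Xs_def)
    ultimately show ?thesis
      unfolding Let_def xbar_def \<theta>_def \<rho>_def by (intro exI[of _ Xs]) blast
  next
    assume b: "n = 2 \<and> \<alpha> 0 > 0 \<and> \<alpha> 1 > 0 \<and> \<alpha> 0 \<noteq> \<alpha> 1"
    define A where "A = \<alpha> 0 * \<sigma>\<^sup>2"
    define B where "B = \<alpha> 1 * \<sigma>\<^sup>2"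
    have AB: "A > 0" "B > 0" "A \<noteq> B" using b \<sigma>2 by (auto simp: A_def B_def)
    have coef: "\<gamma>\<^sup>2 + 2 * lam * (A + B) = \<gamma>\<^sup>2 + 2 * lam * \<sigma>\<^sup>2 * (\<alpha> 0 + \<alpha> 1)" "A * B = \<sigma> ^ 4 * \<alpha> 0 * \<alpha> 1"
      by (simp_all add: A_def B_def algebra_simps power2_eq_square power4_eq_xxxx)
    obtain \<tau>1 \<tau>2 where \<tau>: "\<tau>1 \<noteq> \<tau>2" "{\<tau>. \<tau> < 0 \<and> \<tau> ^ 4 - (2 * \<gamma>) / (3 * lam) * \<tau> ^ 3
        - (\<gamma>\<^sup>2 + 2 * lam * (A + B)) / (3 * lam\<^sup>2) * \<tau>\<^sup>2 + A * B / (3 * lam\<^sup>2) = 0} = {\<tau>1, \<tau>2}"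
      using quartic_negative_roots[OF assms(6,5) AB] by blast
    have neg: "\<tau>1 < 0" "\<tau>2 < 0" using \<tau>(2) by blast+
    \<comment> \<open>Amplitudes of the two agents for which a pure \<open>exp (\<tau> * t)\<close>
      solves the Euler-Lagrange system; they exist because the determinant vanishes at roots of the
      quartic.\<close>
    have ker: "\<exists>u v. (u, v) \<noteq> (0, 0) \<and> (2 * lam * \<tau>\<^sup>2 - A) * u + (lam * \<tau>\<^sup>2 + \<gamma> * \<tau>) * v = 0
        \<and> (lam * \<tau>\<^sup>2 + \<gamma> * \<tau>) * u + (2 * lam * \<tau>\<^sup>2 - B) * v = 0" if "\<tau> \<in> {\<tau>1, \<tau>2}" for \<tau>
    proof (rule kernel_2x2)
      have "\<tau> ^ 4 - (2 * \<gamma>) / (3 * lam) * \<tau> ^ 3 - (\<gamma>\<^sup>2 + 2 * lam * (A + B)) / (3 * lam\<^sup>2) * \<tau>\<^sup>2 + A * B / (3 * lam\<^sup>2) = 0"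
        using that unfolding \<tau>(2)[symmetric] by simp
      then show "(2 * lam * \<tau>\<^sup>2 - A) * (2 * lam * \<tau>\<^sup>2 - B) = (lam * \<tau>\<^sup>2 + \<gamma> * \<tau>)\<^sup>2"
        using quartic_det[OF assms(6), of \<tau> \<gamma> A B] by simp
    qed
    obtain u1 v1 where 1: "(u1, v1) \<noteq> (0, 0)" "(2 * lam * \<tau>1\<^sup>2 - A) * u1 + (lam * \<tau>1\<^sup>2 + \<gamma> * \<tau>1) * v1 = 0"
      "(lam * \<tau>1\<^sup>2 + \<gamma> * \<tau>1) * u1 + (2 * lam * \<tau>1\<^sup>2 - B) * v1 = 0" using ker[of \<tau>1] by blast
    obtain u2 v2 where 2: "(u2, v2) \<noteq> (0, 0)" "(2 * lam * \<tau>2\<^sup>2 - A) * u2 + (lam * \<tau>2\<^sup>2 + \<gamma> * \<tau>2) * v2 = 0"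
      "(lam * \<tau>2\<^sup>2 + \<gamma> * \<tau>2) * u2 + (2 * lam * \<tau>2\<^sup>2 - B) * v2 = 0" using ker[of \<tau>2] by blast
    define D where "D = u1 * v2 - u2 * v1"
    have D: "D \<noteq> 0" unfolding D_def by (rule kernel_independent[OF assms(6) AB(1,2) neg \<tau>(1) 1(1) 2(1) 1(2,3) 2(2,3)])
    \<comment> \<open>Cramer's rule for expanding the initial positions \<open>(x 0, x 1)\<close> in
      the basis of the two kernel vectors, whose determinant is \<open>D\<close>.\<close>
    define k1 where "k1 = (x 0 * v2 - x 1 * u2) / D"
    define k2 where "k2 = (u1 * x 1 - v1 * x 0) / D"
    define c where "c i = (if i = 0 then k1 * u1 else k1 * v1)" for i :: nat
    define d where "d i = (if i = 0 then k2 * u2 else k2 * v2)" for i :: nat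
    define Xs where "Xs i t = c i * exp (\<tau>1 * t) + d i * exp (\<tau>2 * t)" for i t
    have k: "k1 * u1 + k2 * u2 = x 0" "k1 * v1 + k2 * v2 = x 1"
    proof -
      have "D * (k1 * u1 + k2 * u2) = (x 0 * v2 - x 1 * u2) * u1 + (u1 * x 1 - v1 * x 0) * u2"
        "D * (k1 * v1 + k2 * v2) = (x 0 * v2 - x 1 * u2) * v1 + (u1 * x 1 - v1 * x 0) * v2"
        using D by (simp_all add: k1_def k2_def field_simps)
      moreover have "(x 0 * v2 - x 1 * u2) * u1 + (u1 * x 1 - v1 * x 0) * u2 = D * x 0"
        "(x 0 * v2 - x 1 * u2) * v1 + (u1 * x 1 - v1 * x 0) * v2 = D * x 1"
        unfolding D_def by algebra+
      ultimately show "k1 * u1 + k2 * u2 = x 0" "k1 * v1 + k2 * v2 = x 1" using D by simp_all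
    qed
    have i2: "i = 0 \<or> i = 1" if "i < n" for i using b that by auto
    have sum2: "(\<Sum>j<n. f j) = f 0 + f 1" for f :: "nat \<Rightarrow> real" using b by (simp add: numeral_2_eq_2)
    \<comment> \<open>The two rows of the kernel system, scaled by \<open>k\<close>, are the
      coefficient equations of agents 0 and 1.\<close>
    have EL: "\<tau> * (\<gamma> * ((w 0 + w 1) - w i) + lam * \<tau> * ((w 0 + w 1) + w i)) = \<alpha> i * \<sigma>\<^sup>2 * w i"
      if i: "i < n" and w: "w 0 = k * u" "w 1 = k * v"
        and K: "(2 * lam * \<tau>\<^sup>2 - A) * u + (lam * \<tau>\<^sup>2 + \<gamma> * \<tau>) * v = 0"
          "(lam * \<tau>\<^sup>2 + \<gamma> * \<tau>) * u + (2 * lam * \<tau>\<^sup>2 - B) * v = 0" for i k u v \<tau> and w :: "nat \<Rightarrow> real"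
    proof -
      have e0: "\<tau> * (\<gamma> * (k * v) + lam * \<tau> * ((k * u + k * v) + k * u)) - A * (k * u)
        = k * ((2 * lam * \<tau>\<^sup>2 - A) * u + (lam * \<tau>\<^sup>2 + \<gamma> * \<tau>) * v)" by algebra
      have e1: "\<tau> * (\<gamma> * (k * u) + lam * \<tau> * ((k * u + k * v) + k * v)) - B * (k * v)
        = k * ((lam * \<tau>\<^sup>2 + \<gamma> * \<tau>) * u + (2 * lam * \<tau>\<^sup>2 - B) * v)" by algebra
      show ?thesis using i2[OF i] e0 e1 K w by (auto simp: A_def B_def)
    qed
    have cEL: "\<tau>1 * (\<gamma> * ((\<Sum>j<n. c j) - c i) + lam * \<tau>1 * ((\<Sum>j<n. c j) + c i)) = \<alpha> i * \<sigma>\<^sup>2 * c i" if "i < n" for i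
      unfolding sum2 by (rule EL[OF that _ _ 1(2,3)]) (auto simp: c_def)
    have dEL: "\<tau>2 * (\<gamma> * ((\<Sum>j<n. d j) - d i) + lam * \<tau>2 * ((\<Sum>j<n. d j) + d i)) = \<alpha> i * \<sigma>\<^sup>2 * d i" if "i < n" for i
      unfolding sum2 by (rule EL[OF that _ _ 2(2,3)]) (auto simp: d_def)
    have cd: "c i + d i = x i" if "i < n" for i using i2[OF that] k by (auto simp: c_def d_def)
    have \<alpha>: "\<alpha> i > 0" if "i < n" for i using b i2[OF that] by auto
    have "MV_nash M F W S0 \<sigma> \<gamma> lam n x \<alpha> Xs" unfolding Xs_def[abs_def]
      by (rule exp_equilibrium(1)[OF neg assms(6) \<alpha> cEL dEL cd])
    moreover have "\<forall>Ys. MV_nash M F W S0 \<sigma> \<gamma> lam n x \<alpha> Ys \<longrightarrow> (\<forall>i<n. \<forall>t\<ge>0. Ys i t = Xs i t)"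
      unfolding Xs_def[abs_def] by (intro allI impI exp_equilibrium(2)[OF neg assms(6) \<alpha> cEL dEL cd])
    moreover have "CARA_nash M F W S0 \<sigma> \<gamma> lam n x \<alpha> (\<lambda>i t \<omega>. Xs i t)" unfolding Xs_def[abs_def]
      by (rule exp_equilibrium(3)[OF neg assms(6) \<alpha> cEL dEL cd])
    moreover have "\<not> (n \<ge> 1 \<and> a > 0 \<and> (\<forall>i<n. \<alpha> i = a))" using b by force
    moreover have "\<exists>\<tau>1 \<tau>2. \<tau>1 \<noteq> \<tau>2 \<and>
      {\<tau>::real. \<tau> < 0 \<and> \<tau> ^ 4 - (2 * \<gamma>) / (3 * lam) * \<tau> ^ 3
         - (\<gamma>\<^sup>2 + 2 * lam * \<sigma>\<^sup>2 * (\<alpha> 0 + \<alpha> 1)) / (3 * lam\<^sup>2) * \<tau>\<^sup>2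
         + (\<sigma> ^ 4 * \<alpha> 0 * \<alpha> 1) / (3 * lam\<^sup>2) = 0} = {\<tau>1, \<tau>2} \<and>
      (\<forall>i<2. \<exists>c1 c2. \<forall>t\<ge>0. Xs i t = c1 * exp (\<tau>1 * t) + c2 * exp (\<tau>2 * t))"
      using \<tau> unfolding coef Xs_def by blast
    ultimately show ?thesis by (intro exI[of _ Xs]) blast
  qed
qed

end
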